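(* Let $\Pi$ be an LCL problem and let $\mathbb{G}$ be a class of $\Pi$-colorable finite graphs such that $\mathsf{Rand}_{\Pi,\mathbb{G}}(n)=o(\log n)$. Let $G$ be a Borel graph of finite maximum degree all of whose finite induced subgraphs are in $\mathbb{G}$. If $\mathrm{asi}(G)<\infty$, then $G$ has a Borel $\Pi$-coloring.
   Context: All graphs are undirected and simple; $\mathbb{N}=\{0,1,2,\dots\}$, $\mathbb{N}^+=\mathbb{N}\setminus\{0\}$, and $n\in\mathbb{N}$ is identified with $\{0,\dots,n-1\}$. $B_G(v,R)$ is the set of vertices reachable from $v$ by a path of at most $R$ edges; $G[U]$ is the subgraph induced by $U$. LCL problems. A labeled graph is a pair $(G,f)$ with $f\colon V(G)\to\mathbb{N}$ (a labeling); a rooted labeled graph is a triple $(G,f,v)$ with also $v\in V(G)$; isomorphisms of these are graph isomorphisms preserving the labeling and the root. $[G,f,v]_R$ denotes the isomorphism type of the rooted labeled graph $(G[B_G(v,R)],\,f|_{B_G(v,R)},\,v)$. A locally checkable labeling (LCL) problem is a pair $\Pi=(R,\mathcal{P})$ with $R\in\mathbb{N}$ and $\mathcal{P}$ a map from isomorphism classes of finite rooted labeled graphs to $\{0,1\}$. For a locally finite graph $G$, $f\colon V(G)\to\mathbb{N}$ is a $\Pi$-coloring of $G$ if $\mathcal{P}([G,f,v]_R)=1$ for all $v\in V(G)$; $G$ is $\Pi$-colorable if it has a $\Pi$-coloring. Randomized LOCAL complexity. A LOCAL algorithm is a map $\mathcal{A}$ from isomorphism classes of finite rooted labeled graphs to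 $\mathbb{N}$. For a locally finite labeled graph $(G,f)$ and $T\in\mathbb{N}$, define $\mathcal{A}_T(G,f)\colon V(G)\to\mathbb{N}$ by $(\mathcal{A}_T(G,f))(v)=\mathcal{A}([G,f,v]_T)$. For an LCL problem $\Pi$, a class $\mathbb{G}$ of finite graphs, and $n\in\mathbb{N}^+$, $\mathsf{Rand}_{\Pi,\mathbb{G}}(n)$ is the smallest $T\in\mathbb{N}$ for which there exist $\ell\in\mathbb{N}^+$ and a LOCAL algorithm $\mathcal{A}$ such that for every $n$-vertex graph $G\in\mathbb{G}$, if $\theta\colon V(G)\to\ell$ is chosen uniformly at random, then $\mathbb{P}[\mathcal{A}_T(G,\theta)\text{ is a }\Pi\text{-coloring of }G]\geq 1-1/n$ (and $\infty$ if no such $T$ exists). Borel notions. A Borel graph is a graph $G$ whose vertex set is a standard Borel space and whose adjacency relation is Borel in $V(G)^2$. A $\Pi$-coloring $f\colon V(G)\to\mathbb{N}$ is Borel if each $f^{-1}(i)$ is Borel. A graph is component-finite if all its connected components are finite. $\mathrm{si}(G)$ is the smallest $s\in\mathbb{N}$ for which there is a partition $V(G)=U_0\sqcup\dots\sqcup U_s$ into $s+1$ Borel sets such that every $G[U_i]$ is component-finite ($\infty$ if no such $s$ exists). $G^R$ is the graph on $V(G)$ in which two distinct vertices are adjacent iff they are joined by a path of at most $R$ edges in $G$. $\mathrm{asi}(G)=\sup_{R\in\mathbb{N}}\mathrm{si}(G^R)$. *)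

theory Defs
  imports "HOL-Probability.Probability"
begin

section \<open>Graphs\<close>

text \<open>An undirected edge is represented by both of its ordered pairs, so that the adjacency
  relation of a graph is a symmetric irreflexive relation on its vertex set.\<close>

record 'a ugraph =
  verts :: "'a set"
  edges :: "('a \<times> 'a) set"

definition simple_graph :: "'a ugraph \<Rightarrow> bool" where
  "simple_graph G \<longleftrightarrow> edges G \<subseteq> verts G \<times> verts G \<and> sym (edges G) \<and> irrefl (edges G)"

definition finite_graph :: "'a ugraph \<Rightarrow> bool" where
  "finite_graph G \<longleftrightarrow> simple_graph G \<and> finite (verts G)"

definition induced :: "'a ugraph \<Rightarrow> 'a set \<Rightarrow> 'a ugraph" where
  "induced G U = \<lparr>verts = verts G \<inter> U, edges = edges G \<inter> U \<times> U\<rparr>"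

text \<open>\<open>(u, v) \<in> edges G ^^ k\<close> says that there is a walk with exactly \<open>k\<close> edges from \<open>u\<close> to \<open>v\<close>;
  a walk with at most \<open>R\<close> edges exists iff a path with at most \<open>R\<close> edges does.\<close>

definition joined_within :: "'a ugraph \<Rightarrow> nat \<Rightarrow> 'a \<Rightarrow> 'a \<Rightarrow> bool" where
  "joined_within G R u v \<longleftrightarrow> (\<exists>k\<le>R. (u, v) \<in> edges G ^^ k)"

definition graph_ball :: "'a ugraph \<Rightarrow> 'a \<Rightarrow> nat \<Rightarrow> 'a set" where
  "graph_ball G v R = {u \<in> verts G. joined_within G R v u}"

definition graph_power :: "'a ugraph \<Rightarrow> nat \<Rightarrow> 'a ugraph" where
  "graph_power G R = \<lparr>verts = verts G,
     edges = {(u, v). u \<in> verts G \<and> v \<in> verts G \<and> u \<noteq> v \<and> joined_within G R u v}\<rparr>"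

definition component_finite :: "'a ugraph \<Rightarrow> bool" where
  "component_finite G \<longleftrightarrow> (\<forall>v\<in>verts G. finite {u \<in> verts G. (v, u) \<in> (edges G)\<^sup>*})"

definition finite_max_degree :: "'a ugraph \<Rightarrow> bool" where
  "finite_max_degree G \<longleftrightarrow>
     (\<exists>d. \<forall>v\<in>verts G. finite {u. (v, u) \<in> edges G} \<and> card {u. (v, u) \<in> edges G} \<le> d)"

definition is_graph_iso :: "('a \<Rightarrow> 'b) \<Rightarrow> 'a ugraph \<Rightarrow> 'b ugraph \<Rightarrow> bool" where
  "is_graph_iso \<phi> G H \<longleftrightarrow> bij_betw \<phi> (verts G) (verts H) \<and>
     (\<forall>x\<in>verts G. \<forall>y\<in>verts G. (x, y) \<in> edges G \<longleftrightarrow> (\<phi> x, \<phi> y) \<in> edges H)"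

text \<open>A class of finite graphs is represented by a set of finite graphs whose vertices are natural
  numbers. A finite graph on an arbitrary vertex type belongs to the class if it is isomorphic to
  a member of that set.\<close>

definition in_class :: "'a ugraph \<Rightarrow> nat ugraph set \<Rightarrow> bool" where
  "in_class G \<GG> \<longleftrightarrow> (\<exists>H\<in>\<GG>. \<exists>\<phi>. is_graph_iso \<phi> G H)"

section \<open>LCL problems\<close>

text \<open>The isomorphism type of a finite rooted labeled graph \<open>(G, f, v)\<close> is the set of all
  rooted labeled graphs isomorphic to it whose vertices are natural numbers. This makes types of
  graphs over different vertex types comparable. Values of labelings outside the
  vertex set are irrelevant.\<close>

type_synonym iso_class = "(nat ugraph \<times> (nat \<Rightarrow> nat) \<times> nat) set"

definition iso_type :: "'a ugraph \<Rightarrow> ('a \<Rightarrow> nat) \<Rightarrow> 'a \<Rightarrow> iso_class" where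
  "iso_type G f v = {(H, g, w). finite_graph H \<and> w \<in> verts H \<and>
     (\<exists>\<phi>. is_graph_iso \<phi> G H \<and> (\<forall>x\<in>verts G. g (\<phi> x) = f x) \<and> \<phi> v = w)}"

definition local_type :: "'a ugraph \<Rightarrow> ('a \<Rightarrow> nat) \<Rightarrow> 'a \<Rightarrow> nat \<Rightarrow> iso_class" where
  "local_type G f v R = iso_type (induced G (graph_ball G v R)) f v"

text \<open>A problem \<open>(R, P)\<close>; the values of \<open>P\<close> on sets that are not isomorphism types are never used.\<close>

type_synonym lcl = "nat \<times> (iso_class \<Rightarrow> bool)"

definition is_coloring :: "lcl \<Rightarrow> 'a ugraph \<Rightarrow> ('a \<Rightarrow> nat) \<Rightarrow> bool" where
  "is_coloring L G f \<longleftrightarrow> (\<forall>v\<in>verts G. snd L (local_type G f v (fst L)))"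

definition colorable :: "lcl \<Rightarrow> 'a ugraph \<Rightarrow> bool" where
  "colorable L G \<longleftrightarrow> (\<exists>f. is_coloring L G f)"

section \<open>Randomized LOCAL complexity\<close>

type_synonym local_algorithm = "iso_class \<Rightarrow> nat"

definition run_local :: "local_algorithm \<Rightarrow> nat \<Rightarrow> 'a ugraph \<Rightarrow> ('a \<Rightarrow> nat) \<Rightarrow> 'a \<Rightarrow> nat" where
  "run_local A T G f v = A (local_type G f v T)"

text \<open>Here \<open>Inf {} = \<infinity>\<close>.\<close>

definition Rand :: "lcl \<Rightarrow> nat ugraph set \<Rightarrow> nat \<Rightarrow> enat" where
  "Rand L \<GG> n = Inf {enat T | T. \<exists>l::nat. l > 0 \<and> (\<exists>A::local_algorithm.
     \<forall>G\<in>\<GG>. card (verts G) = n \<longrightarrow>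
       measure_pmf.prob (pmf_of_set (verts G \<rightarrow>\<^sub>E {..<l}))
         {\<theta>. is_coloring L G (run_local A T G \<theta>)} \<ge> 1 - 1 / real n)}"

text \<open>\<open>the_enat\<close> is unspecified at \<open>\<infinity>\<close>, so eventual finiteness has to be required separately.\<close>

definition little_o_log :: "(nat \<Rightarrow> enat) \<Rightarrow> bool" where
  "little_o_log h \<longleftrightarrow> (\<forall>\<^sub>F n in sequentially. h n \<noteq> \<infinity>) \<and>
     (\<lambda>n. real (the_enat (h n))) \<in> o(\<lambda>n. ln (real n))"

section \<open>Borel graphs\<close>

text \<open>A measurable space is given by a \<open>measure\<close> of which only the carrier and the
  sigma-algebra matter.\<close>

definition standard_borel_space :: "'a measure \<Rightarrow> bool" where
  "standard_borel_space M \<longleftrightarrow> (\<exists>X. completely_metrizable_space X \<and> separable_space X \<and>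
     topspace X = space M \<and> sets M = sigma_sets (space M) {U. openin X U})"

definition borel_graph :: "'a measure \<Rightarrow> 'a ugraph \<Rightarrow> bool" where
  "borel_graph M G \<longleftrightarrow> standard_borel_space M \<and> simple_graph G \<and> verts G = space M \<and>
     edges G \<in> sets (M \<Otimes>\<^sub>M M)"

definition borel_map :: "'a measure \<Rightarrow> 'a ugraph \<Rightarrow> ('a \<Rightarrow> nat) \<Rightarrow> bool" where
  "borel_map M G f \<longleftrightarrow> (\<forall>i. {v \<in> verts G. f v = i} \<in> sets M)"

definition si :: "'a measure \<Rightarrow> 'a ugraph \<Rightarrow> enat" where
  "si M G = Inf {enat s | s. \<exists>U :: nat \<Rightarrow> 'a set.
     (\<forall>i\<le>s. U i \<in> sets M) \<and> disjoint_family_on U {..s} \<and> (\<Union>i\<le>s. U i) = verts G \<and>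
     (\<forall>i\<le>s. component_finite (induced G (U i)))}"

definition asi :: "'a measure \<Rightarrow> 'a ugraph \<Rightarrow> enat" where
  "asi M G = (SUP R. si M (graph_power G R))"

end

theory Submission
  imports Defs
begin

text \<open>Let \<open>s\<close> be the asymptotic separation index of \<open>G\<close>, and let a randomized algorithm of radius \<open>T\<close> fail with
  probability at most \<open>1/n\<close> on \<open>n\<close>-vertex graphs. Whether it fails at \<open>v\<close> depends only on the labels in the
  ball of radius \<open>k = R + T\<close>, so each failure event shares labels with at most \<open>D = (d + 1)^(2 k)\<close> others,
  and \<open>T = o(log n)\<close> makes \<open>(4 D)^(s + 1) / n < 1\<close> for some \<open>n\<close>. Partition the vertices into \<open>s + 1\<close> Borel sets on which the
  power \<open>2 k\<close> of \<open>G\<close> is component-finite and reveal the labels of one set at a time. By Markov's inequality and the Lovasz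
  Local Lemma, every finite component can be labeled such that no conditional failure probability grows
  by more than a factor \<open>4 D\<close>; different components do not interact. After all labels
  are revealed the failure probabilities are below \<open>1\<close> and hence \<open>0\<close>.

  For the labels to be Borel, countably many Borel candidate labelings are fixed that realise every labeling of
  every finite set, and each component uses the first candidate that works for it. This requires that
  the neighbours of a Borel set form a Borel set, which is an instance of the Lusin-Souslin theorem
  for Borel sets with sections of bounded size.\<close>

section \<open>Borel sets in Baire space as injective projections of closed sets\<close>

text \<open>The algorithm is used for one fixed \<open>n\<close> only. In an infinite
  \<open>G\<close> every ball of radius \<open>k\<close> extends to an induced subgraph with exactly
  \<open>n\<close> vertices once \<open>n\<close> is at least the size of the ball, so the failure
  bound \<open>1/n\<close> holds at each vertex of \<open>G\<close>. A finite \<open>G\<close> need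
  not have such subgraphs; it is coloured directly, as a member of the class. The number
  \<open>s\<close> may be fixed before \<open>n\<close> and \<open>T\<close> because it bounds the
  separation index of all powers at once; then \<open>(4 D)^(s + 1)\<close> is a constant times a
  fixed base to the power \<open>T\<close>. The factor \<open>4 D\<close> is the threshold at which
  Markov's inequality gives probability \<open>1/(4 D)\<close>, the largest value that the Local
  Lemma admits for \<open>D\<close> dependencies. The power \<open>2 k\<close> ensures that a ball
  of radius \<open>k\<close> meets at most one component of the set being revealed. The Local Lemma
  alone gives no Borel choice. The set of vertices at which a candidate does not work is Borel
  because, for a Borel labeling, the conditional failure probability depends only on the isomorphism
  type of the labeled ball.\<close>

type_synonym baire = "nat \<Rightarrow> nat"

text \<open>Interleaving identifies Baire space with its square, so that closed subsets of a product
  can be moved back into Baire space.\<close>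

definition evens :: "baire \<Rightarrow> baire" where "evens v = (\<lambda>k. v (2 * k))"
definition odds :: "baire \<Rightarrow> baire" where "odds v = (\<lambda>k. v (Suc (2 * k)))"

lemma continuous_on_evens: "continuous_on UNIV evens"
  unfolding evens_def by (intro continuous_on_coordinatewise_then_product continuous_on_product_coordinates)

lemma continuous_on_odds: "continuous_on UNIV odds"
  unfolding odds_def by (intro continuous_on_coordinatewise_then_product continuous_on_product_coordinates)

lemma evens_odds_eqI:
  assumes "evens v = evens w" "odds v = odds w"
  shows "v = w"
proof
  fix n
  show "v n = w n"
  proof (cases "even n")
    case True
    then show ?thesis using fun_cong[OF assms(1), of "n div 2"] by (simp add: evens_def)
  next
    case False
    then show ?thesis using fun_cong[OF assms(2), of "n div 2"] by (simp add: odds_def)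
  qed
qed

lemma evens_odds_surj: "\<exists>v. evens v = a \<and> odds v = b"
  by (rule exI[of _ "\<lambda>n. if even n then a (n div 2) else b (n div 2)"])
     (simp add: evens_def odds_def)

lemma closed_discrete: "closed (A :: 'a :: discrete_topology set)"
  by (simp add: closed_def discrete_topology_class.open_discrete)

lemma open_cylinder: "open {w :: baire. \<forall>i<n. w i = x i}"
proof -
  have "open (\<Inter>i<n. (\<lambda>w :: baire. w i) -` {x i})"
    by (intro open_INT ballI open_vimage continuous_on_product_coordinates
        discrete_topology_class.open_discrete) auto
  also have "(\<Inter>i<n. (\<lambda>w :: baire. w i) -` {x i}) = {w. \<forall>i<n. w i = x i}" by auto
  finally show ?thesis .
qed

lemma open_contains_cylinder:
  assumes "open U" "(x :: baire) \<in> U"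
  shows "\<exists>n. \<forall>w. (\<forall>i<n. w i = x i) \<longrightarrow> w \<in> U"
proof -
  obtain X where X: "x \<in> Pi\<^sub>E UNIV X" "finite {i. X i \<noteq> topspace euclidean}" "Pi\<^sub>E UNIV X \<subseteq> U"
    using product_topology_open_contains_basis[of "\<lambda>_. euclidean" UNIV U x] assms
    unfolding open_fun_def by auto
  obtain n where n: "\<And>i. X i \<noteq> UNIV \<Longrightarrow> i < n"
    using finite_nat_set_iff_bounded[THEN iffD1, OF X(2)] by auto
  have "w \<in> U" if "\<forall>i<n. w i = x i" for w
  proof -
    have "w i \<in> X i" for i using X(1) that n by (cases "X i = UNIV") (auto simp: PiE_iff)
    then show ?thesis using X(3) by (auto simp: PiE_iff)
  qed
  then show ?thesis by blast
qed

text \<open>Cylinders form a neighbourhood basis, so a point is in the closure of \<open>H\<close>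
  iff each of its finite prefixes is a prefix of a member of \<open>H\<close>.\<close>

lemma closed_baire_iff:
  "closed (H :: baire set) \<longleftrightarrow> (\<forall>x. (\<forall>n. \<exists>w\<in>H. \<forall>i<n. w i = x i) \<longrightarrow> x \<in> H)"
proof
  assume H: "closed H"
  show "\<forall>x. (\<forall>n. \<exists>w\<in>H. \<forall>i<n. w i = x i) \<longrightarrow> x \<in> H"
  proof (intro allI impI, rule ccontr)
    fix x assume "\<forall>n. \<exists>w\<in>H. \<forall>i<n. w i = x i" "x \<notin> H"
    then show False using open_contains_cylinder[of "- H" x] H by (auto simp: closed_def)
  qed
next
  assume *: "\<forall>x. (\<forall>n. \<exists>w\<in>H. \<forall>i<n. w i = x i) \<longrightarrow> x \<in> H"
  have "\<exists>V. open V \<and> x \<in> V \<and> V \<subseteq> - H" if "x \<in> - H" for x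
  proof -
    have "\<not> (\<forall>n. \<exists>w\<in>H. \<forall>i<n. w i = x i)" using *[THEN spec, of x] that by auto
    then obtain n where "\<not> (\<exists>w\<in>H. \<forall>i<n. w i = x i)" unfolding not_all ..
    then have "{w. \<forall>i<n. w i = x i} \<subseteq> - H" by auto
    then show ?thesis using open_cylinder[of n x] by (intro exI conjI) auto
  qed
  then have "open (- H)" using open_subopen[of "- H"] by simp
  then show "closed H" by (simp add: closed_def)
qed

lemma closed_baire_singleton: "closed {x :: baire}"
proof -
  have "y = x" if "\<forall>n. \<exists>w\<in>{x}. \<forall>i<n. w i = y i" for y
  proof
    fix n
    show "y n = x n" using that[rule_format, of "Suc n"] by auto
  qed
  then show ?thesis unfolding closed_baire_iff by auto
qed

text \<open>Classically, a Borel set is an injective continuous image of a closed set. Here the map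
  is the first projection, and \<open>w\<close> is the only certificate for \<open>z\<close>.
  Uniqueness matters because adding certificates then does not enlarge fibres.\<close>

definition unique_witness :: "(baire \<times> baire) set \<Rightarrow> baire set \<Rightarrow> bool" where
  "unique_witness F E \<longleftrightarrow> closed F \<and> fst ` F = E \<and>
     (\<forall>z w w'. (z, w) \<in> F \<longrightarrow> (z, w') \<in> F \<longrightarrow> w = w')"

definition inj_projection :: "baire set \<Rightarrow> bool" where
  "inj_projection E \<longleftrightarrow> (\<exists>F. unique_witness F E)"

lemma inj_projection_closed:
  assumes "closed E"
  shows "inj_projection E"
  unfolding inj_projection_def unique_witness_def
proof (intro exI conjI)
  show "closed (E \<times> {(\<lambda>_. 0) :: baire})" by (intro closed_Times assms closed_baire_singleton)
qed auto

text \<open>A certificate for the intersection packs one certificate for each \<open>A i\<close>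
  into the rows of a single sequence; uniqueness holds row by row.\<close>

lemma inj_projection_INT:
  assumes "\<And>i::nat. inj_projection (A i)"
  shows "inj_projection (\<Inter>i. A i)"
proof -
  obtain F where F0: "\<And>i. unique_witness (F i) (A i)"
    using assms unfolding inj_projection_def by metis
  then have F: "closed (F i)" "fst ` F i = A i"
    "(z, w) \<in> F i \<Longrightarrow> (z, w') \<in> F i \<Longrightarrow> w = w'" for i z w w'
    unfolding unique_witness_def by (simp, simp, metis)
  define row :: "nat \<Rightarrow> baire \<Rightarrow> baire" where "row i w = (\<lambda>k. w (prod_encode (i, k)))" for i w
  have crow: "continuous_on UNIV (row i)" for i
    unfolding row_def by (intro continuous_on_coordinatewise_then_product continuous_on_product_coordinates)
  let ?G = "\<Inter>i. (\<lambda>p. (fst p, row i (snd p))) -` F i"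
  have "closed ?G"
  proof (intro closed_INT ballI closed_vimage F)
    fix i
    show "continuous_on UNIV (\<lambda>p::baire \<times> baire. (fst p, row i (snd p)))"
      by (intro continuous_intros continuous_on_compose2[OF crow]) auto
  qed
  moreover have "fst ` ?G = (\<Inter>i. A i)"
  proof
    show "fst ` ?G \<subseteq> (\<Inter>i. A i)" using F(2) by force
    show "(\<Inter>i. A i) \<subseteq> fst ` ?G"
    proof
      fix z assume "z \<in> (\<Inter>i. A i)"
      then have "\<forall>i. \<exists>w. (z, w) \<in> F i" using F(2) by force
      then obtain w where w: "\<And>i. (z, w i) \<in> F i" by metis
      let ?w = "\<lambda>n. w (fst (prod_decode n)) (snd (prod_decode n))"
      have "row i ?w = w i" for i by (simp add: row_def)
      then have "(z, ?w) \<in> ?G" using w by simp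
      then show "z \<in> fst ` ?G" by (rule image_eqI[rotated]) simp
    qed
  qed
  moreover have "w = w'" if "(z, w) \<in> ?G" "(z, w') \<in> ?G" for z w w'
  proof
    fix n
    obtain i k where n: "n = prod_encode (i, k)" by (metis prod_decode_inverse surj_pair)
    have "row i w = row i w'" using that F(3)[of z _ i] by auto
    then show "w n = w' n" unfolding n row_def by (rule fun_cong)
  qed
  ultimately show ?thesis unfolding inj_projection_def unique_witness_def by blast
qed

text \<open>A certificate for the union begins with an index \<open>i\<close> and continues with a
  certificate for \<open>A i\<close>. Disjointness makes the index, and with it the whole
  certificate, unique.\<close>

lemma inj_projection_disjoint_UN:
  assumes "\<And>i::nat. inj_projection (A i)" and disj: "\<And>i j. i \<noteq> j \<Longrightarrow> A i \<inter> A j = {}"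
  shows "inj_projection (\<Union>i. A i)"
proof -
  obtain F where F0: "\<And>i. unique_witness (F i) (A i)"
    using assms(1) unfolding inj_projection_def by metis
  then have F: "closed (F i)" "fst ` F i = A i"
    "(z, w) \<in> F i \<Longrightarrow> (z, w') \<in> F i \<Longrightarrow> w = w'" for i z w w'
    unfolding unique_witness_def by (simp, simp, metis)
  define tl :: "baire \<Rightarrow> baire" where "tl w = (\<lambda>k. w (Suc k))" for w
  have ctl: "continuous_on UNIV tl"
    unfolding tl_def by (intro continuous_on_coordinatewise_then_product continuous_on_product_coordinates)
  \<comment> \<open>The condition that the tail certifies \<open>z\<close> in the set with index
    \<open>w 0\<close> is written as an intersection over all \<open>i\<close>, each with the clopen
    alternative \<open>w 0 \<noteq> i\<close>, so that closedness is immediate.\<close>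
  let ?G = "\<Inter>i. ((\<lambda>p. snd p 0) -` (- {i})) \<union> (\<lambda>p::baire \<times> baire. (fst p, tl (snd p))) -` F i"
  have c0: "continuous_on UNIV (\<lambda>p::baire \<times> baire. snd p 0)"
    by (intro continuous_on_compose2[OF continuous_on_product_coordinates continuous_on_snd]) 
       (auto intro: continuous_intros)
  have "closed ?G"
  proof (intro closed_INT ballI closed_Un closed_vimage F c0)
    fix i :: nat
    show "closed (- {i})" by (rule closed_discrete)
    show "continuous_on UNIV (\<lambda>p::baire \<times> baire. (fst p, tl (snd p)))"
      by (intro continuous_intros continuous_on_compose2[OF ctl]) auto
  qed
  moreover have G: "(z, w) \<in> ?G \<longleftrightarrow> (z, tl w) \<in> F (w 0)" for z w by auto
  moreover have "fst ` ?G = (\<Union>i. A i)"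
  proof
    show "fst ` ?G \<subseteq> (\<Union>i. A i)"
    proof
      fix z assume "z \<in> fst ` ?G"
      then obtain p where "p \<in> ?G" "z = fst p" by (rule imageE)
      then have "(z, snd p) \<in> ?G" by (simp only: prod.collapse)
      then have "(z, tl (snd p)) \<in> F (snd p 0)" by (simp only: G)
      then have "z \<in> fst ` F (snd p 0)" by force
      then show "z \<in> (\<Union>i. A i)" using F(2) by auto
    qed
    show "(\<Union>i. A i) \<subseteq> fst ` ?G"
    proof
      fix z assume "z \<in> (\<Union>i. A i)"
      then obtain i w where w: "(z, w) \<in> F i" using F(2) by force
      let ?w = "\<lambda>n. case n of 0 \<Rightarrow> i | Suc k \<Rightarrow> w k"
      have "tl ?w = w" "?w 0 = i" by (auto simp: tl_def)
      then have "(z, ?w) \<in> ?G" using w by (simp only: G)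
      then show "z \<in> fst ` ?G" by (rule image_eqI[rotated]) simp
    qed
  qed
  moreover have "w = w'" if "(z, w) \<in> ?G" "(z, w') \<in> ?G" for z w w'
  proof -
    have *: "(z, tl w) \<in> F (w 0)" "(z, tl w') \<in> F (w' 0)" using that by (simp_all only: G)
    then have "z \<in> A (w 0) \<inter> A (w' 0)" using F(2) by force
    then have 0: "w 0 = w' 0" using disj by blast
    then have "tl w = tl w'" using * F(3) by metis
    then have "w (Suc k) = w' (Suc k)" for k unfolding tl_def by (rule fun_cong)
    then have "w n = w' n" for n using 0 by (cases n) auto
    then show "w = w'" ..
  qed
  ultimately show ?thesis unfolding inj_projection_def unique_witness_def by blast
qed

lemma inj_projection_Int:
  assumes "inj_projection A" "inj_projection B"
  shows "inj_projection (A \<inter> B)"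
proof -
  have "inj_projection (\<Inter>i::nat. if i = 0 then A else B)" by (rule inj_projection_INT) (use assms in auto)
  moreover have "(\<Inter>i::nat. if i = 0 then A else B) = A \<inter> B" by (auto split: if_splits)
  ultimately show ?thesis by simp
qed

text \<open>Injective projections are not visibly closed under complements, so the induction over
  the sigma-algebra carries \<open>E\<close> and \<open>- E\<close> together. The generators are
  clopen.\<close>

lemma inj_projection_borel:
  assumes "E \<in> sets borel"
  shows "inj_projection E"
proof -
  have "sets (borel :: baire measure) = sets (PiM UNIV (\<lambda>_. borel))"
    by (rule sets_PiM_equal_borel[symmetric])
  also have "\<dots> = sigma_sets UNIV {{f. f i \<in> A} | i A. True}"
    by (simp add: sets_PiM_single PiE_UNIV_domain sets_borel_eq_count_space)
  finally have "E \<in> sigma_sets UNIV {{f. f i \<in> A} | i A. True}" using assms by simp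
  then have "inj_projection E \<and> inj_projection (- E)"
  proof induction
    case (Basic a)
    then obtain i A where a: "a = (\<lambda>f. f i) -` A" by auto
    have c: "continuous_on UNIV (\<lambda>f::baire. f i)" by (rule continuous_on_product_coordinates)
    have "closed ((\<lambda>f::baire. f i) -` B)" for B
      by (rule closed_vimage[OF _ c]) (rule closed_discrete)
    from this[of A] this[of "- A"] show ?case unfolding a by (auto intro!: inj_projection_closed simp: vimage_Compl)
  next
    case Empty
    then show ?case by (auto intro: inj_projection_closed)
  next
    case (Compl a)
    then show ?case by (simp add: Compl_eq_Diff_UNIV[symmetric])
  next
    case (Union a)
    \<comment> \<open>Only disjoint unions are available, so each \<open>a i\<close> is stripped of
      the earlier sets; their complements are covered by the second half of the induction
      hypothesis.\<close>
    let ?b = "\<lambda>i. a i \<inter> (\<Inter>j. if j < i then - a j else UNIV)"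
    have "inj_projection (\<Union>i. ?b i)"
    proof (rule inj_projection_disjoint_UN)
      show "inj_projection (?b i)" for i
        by (intro inj_projection_Int inj_projection_INT) (use Union in \<open>auto intro: inj_projection_closed\<close>)
      show "?b i \<inter> ?b j = {}" if "i \<noteq> j" for i j
        using that by (cases i j rule: linorder_cases) (auto split: if_splits)
    qed
    moreover have "(\<Union>i. ?b i) = (\<Union>i. a i)"
    proof
      show "(\<Union>i. a i) \<subseteq> (\<Union>i. ?b i)"
      proof
        fix x assume "x \<in> (\<Union>i. a i)"
        then obtain i where "x \<in> a i" by blast
        then have "x \<in> ?b (LEAST i. x \<in> a i)"
          by (auto intro: LeastI dest: not_less_Least)
        then show "x \<in> (\<Union>i. ?b i)" by blast
      qed
    qed auto
    moreover have "inj_projection (\<Inter>i. - a i)" by (rule inj_projection_INT) (use Union in auto)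
    ultimately show ?case by (simp add: Compl_UN)
  qed
  then show ?thesis ..
qed

section \<open>Images with bounded fibres of closed sets are Borel\<close>

text \<open>Lusin separation for several sets at once. Only the total intersection of the hulls has
  to be empty: when fibres have at most \<open>d\<close> points, the images of \<open>d + 1\<close>
  disjoint pieces have no common point, although any two of them may meet.\<close>

definition jointly_separable :: "'i set \<Rightarrow> ('i \<Rightarrow> 'b::topological_space set) \<Rightarrow> bool" where
  "jointly_separable I A \<longleftrightarrow>
     (\<exists>D. (\<forall>i\<in>I. D i \<in> sets borel \<and> A i \<subseteq> D i) \<and> (\<Inter>i\<in>I. D i) = {})"

lemma borel_countable_INT:
  assumes "countable J" "\<And>i. i \<in> J \<Longrightarrow> F i \<in> sets borel"
  shows "(\<Inter>i\<in>J. F i) \<in> sets borel"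
  using assms by (intro sets.countable_INT'') auto

text \<open>Separations \<open>D m\<close> for all selections \<open>m\<close> of pieces are
  combined: a point is put into the hull of \<open>A i\<close> if for some \<open>k\<close> it lies
  in \<open>D m i\<close> for every \<open>m\<close> that selects piece \<open>k\<close> of
  \<open>A i\<close>. A point in all hulls would determine one selection \<open>m\<close> with the
  point in every \<open>D m i\<close>. Finiteness of \<open>I\<close> leaves only countably many
  selections.\<close>

lemma jointly_separable_UN:
  fixes B :: "'i \<Rightarrow> nat \<Rightarrow> 'b::topological_space set"
  assumes "finite I"
    and cover: "\<And>i. i \<in> I \<Longrightarrow> A i \<subseteq> (\<Union>k. B i k)"
    and sep: "\<And>m. jointly_separable I (\<lambda>i. B i (m i))"
  shows "jointly_separable I A"
proof -
  let ?P = "I \<rightarrow>\<^sub>E (UNIV :: nat set)"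
  have cP: "countable ?P" using \<open>finite I\<close> by (intro countable_PiE) auto
  have "\<forall>m. \<exists>D. (\<forall>i\<in>I. D i \<in> sets borel \<and> B i (m i) \<subseteq> D i) \<and> (\<Inter>i\<in>I. D i) = {}"
    using sep unfolding jointly_separable_def by auto
  then obtain D where D: "\<And>m i. i \<in> I \<Longrightarrow> D m i \<in> sets borel"
    "\<And>m i. i \<in> I \<Longrightarrow> B i (m i) \<subseteq> D m i" "\<And>m. (\<Inter>i\<in>I. D m i) = {}"
    unfolding choice_iff by blast
  define E where "E i = (\<Union>k. \<Inter>m\<in>{m\<in>?P. m i = k}. D m i)" for i
  have "E i \<in> sets borel" if "i \<in> I" for i
    unfolding E_def using that
    by (intro sets.countable_UN'' borel_countable_INT D countable_subset[OF _ cP]) auto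
  moreover have "A i \<subseteq> E i" if "i \<in> I" for i
  proof
    fix x assume "x \<in> A i"
    then obtain k where "x \<in> B i k" using cover[OF \<open>i \<in> I\<close>] by auto
    then have "x \<in> (\<Inter>m\<in>{m\<in>?P. m i = k}. D m i)" using D(2)[OF that] by auto
    then show "x \<in> E i" unfolding E_def by blast
  qed
  moreover have "x \<notin> (\<Inter>i\<in>I. E i)" for x
  proof
    assume "x \<in> (\<Inter>i\<in>I. E i)"
    define Q where "Q i k \<longleftrightarrow> (\<forall>m\<in>?P. m i = k \<longrightarrow> x \<in> D m i)" for i k
    have "\<exists>k. Q i k" if "i \<in> I" for i
    proof -
      have "x \<in> E i" using \<open>x \<in> (\<Inter>i\<in>I. E i)\<close> that by blast
      then obtain k where "x \<in> (\<Inter>m\<in>{m\<in>?P. m i = k}. D m i)" unfolding E_def by (rule UN_E)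
      then have "Q i k" unfolding Q_def by simp
      then show ?thesis ..
    qed
    then obtain k where k: "\<And>i. i \<in> I \<Longrightarrow> Q i (k i)" by metis
    have "x \<in> D (restrict k I) i" if "i \<in> I" for i
      using k[OF that] that unfolding Q_def by simp
    then show False using D(3)[of "restrict k I"] by blast
  qed
  ultimately show ?thesis unfolding jointly_separable_def by (intro exI[of _ E]) blast
qed

definition cyl :: "nat \<Rightarrow> baire \<Rightarrow> baire set" where
  "cyl n w = {v. \<forall>k<n. v k = w k}"

lemma open_coordinate: "open {y :: baire. y p = q}"
proof -
  have "open ((\<lambda>w :: baire. w p) -` {q})"
    by (intro open_vimage continuous_on_product_coordinates discrete_topology_class.open_discrete)
  then show ?thesis by (simp add: vimage_def)
qed

lemma continuous_coordinate_eventually_fixed: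
  fixes g :: "baire \<Rightarrow> baire"
  assumes "continuous_on UNIV g"
  shows "\<exists>n. \<forall>v\<in>cyl n a. g v p = g a p"
proof -
  have o: "open (g -` {y. y p = g a p})" by (rule open_vimage[OF open_coordinate assms])
  have "a \<in> g -` {y. y p = g a p}" by simp
  from open_contains_cylinder[OF o this]
  obtain n where n: "\<forall>w. (\<forall>i<n. w i = a i) \<longrightarrow> w \<in> g -` {y. y p = g a p}" ..
  have "g v p = g a p" if "v \<in> cyl n a" for v
  proof -
    have "\<forall>i<n. v i = a i" using that by (simp add: cyl_def)
    then have "v \<in> g -` {y. y p = g a p}" by (rule n[THEN spec, THEN mp])
    then show ?thesis by simp
  qed
  then show ?thesis by blast
qed

lemma cyl_mono: "m \<le> n \<Longrightarrow> cyl n w \<subseteq> cyl m w"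
  by (auto simp: cyl_def)

text \<open>If separation fails, it keeps failing for suitable smaller cylinders, which shrink to one point
  \<open>\<alpha> i\<close> for each \<open>i\<close>. These points either leave \<open>H\<close> or have two different images, and then
  sufficiently small cylinders are separated by open sets.\<close>

lemma jointly_separable_images:
  fixes g :: "baire \<Rightarrow> baire" and w0 :: "'i \<Rightarrow> baire"
  assumes H: "closed H" and g: "continuous_on UNIV g" and I: "finite I"
    and disj: "(\<Inter>i\<in>I. g ` (H \<inter> cyl N (w0 i))) = {}"
  shows "jointly_separable I (\<lambda>i. g ` (H \<inter> cyl N (w0 i)))"
proof (rule ccontr)
  assume nsep: "\<not> ?thesis"
  define bad where "bad n w \<longleftrightarrow> \<not> jointly_separable I (\<lambda>i. g ` (H \<inter> cyl n (w i)))" for n w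
  have step: "\<exists>w'. bad (Suc n) w' \<and> (\<forall>i. \<forall>k<n. w' i k = w i k)" if "bad n w" for n w
  proof -
    \<comment> \<open>A cylinder is the union of its extensions by one coordinate; by
      \<open>jointly_separable_UN\<close>, some choice of extensions is inseparable again.\<close>
    have "\<exists>m. \<not> jointly_separable I (\<lambda>i. g ` (H \<inter> cyl (Suc n) ((w i)(n := m i))))"
    proof (rule ccontr)
      assume *: "\<not> ?thesis"
      have "jointly_separable I (\<lambda>i. g ` (H \<inter> cyl n (w i)))"
      proof (rule jointly_separable_UN[OF I, where B = "\<lambda>i k. g ` (H \<inter> cyl (Suc n) ((w i)(n := k)))"])
        show "g ` (H \<inter> cyl n (w i)) \<subseteq> (\<Union>k. g ` (H \<inter> cyl (Suc n) ((w i)(n := k))))" for i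
        proof (rule image_subsetI)
          fix v assume "v \<in> H \<inter> cyl n (w i)"
          then have "v \<in> H \<inter> cyl (Suc n) ((w i)(n := v n))" by (auto simp: cyl_def less_Suc_eq)
          then show "g v \<in> (\<Union>k. g ` (H \<inter> cyl (Suc n) ((w i)(n := k))))" by blast
        qed
      qed (use * in blast)
      then show False using that unfolding bad_def by simp
    qed
    then obtain m where "bad (Suc n) (\<lambda>i. (w i)(n := m i))" unfolding bad_def by blast
    then show ?thesis by (intro exI[of _ "\<lambda>i. (w i)(n := m i)"]) simp
  qed
  have "\<exists>w. \<forall>j. (bad (N + j) (w j) \<and> (j = 0 \<longrightarrow> w j = w0)) \<and> (\<forall>i. \<forall>k<N + j. w (Suc j) i k = w j i k)"
  proof (rule dependent_nat_choice)
    show "\<exists>x. bad (N + 0) x \<and> (0 = (0::nat) \<longrightarrow> x = w0)" using nsep by (auto simp: bad_def)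
    fix x j assume "bad (N + j) x \<and> (j = 0 \<longrightarrow> x = w0)"
    then show "\<exists>y. (bad (N + Suc j) y \<and> (Suc j = 0 \<longrightarrow> y = w0)) \<and> (\<forall>i. \<forall>k<N + j. y i k = x i k)"
      using step[of "N + j" x] by auto
  qed
  then obtain w where w: "\<And>j. bad (N + j) (w j)" "w 0 = w0"
    "\<And>j i k. k < N + j \<Longrightarrow> w (Suc j) i k = w j i k" by metis
  \<comment> \<open>Stage \<open>j\<close> fixes the first \<open>N + j\<close> entries, so entry
    \<open>k\<close> is final from stage \<open>Suc k\<close> on.\<close>
  define \<alpha> where "\<alpha> i k = w (Suc k) i k" for i k
  have const: "w (j' + j) i k = w j' i k" if "k < N + j'" for i k j j'
    using that by (induction j) (auto simp: w(3))
  have \<alpha>: "w j i k = \<alpha> i k" if "k < N + j" for i k j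
    using const[of k j "Suc k - j" i] const[of k "Suc k" "j - Suc k" i] that
    by (cases "j \<le> Suc k") (auto simp: \<alpha>_def)
  have bad_\<alpha>: "bad (N + j) \<alpha>" for j
  proof -
    have "cyl (N + j) (w j i) = cyl (N + j) (\<alpha> i)" for i using \<alpha> by (auto simp: cyl_def)
    then show ?thesis using w(1)[of j] by (simp add: bad_def)
  qed
  have cyl0: "cyl N (w0 i) = cyl N (\<alpha> i)" for i using \<alpha>[of _ 0 i] w(2) by (auto simp: cyl_def)
  show False
  proof (cases "\<exists>i\<in>I. \<alpha> i \<notin> H")
    case True
    then obtain i where i: "i \<in> I" "\<alpha> i \<notin> H" by blast
    then obtain n where "\<not> (\<exists>v\<in>H. \<forall>k<n. v k = \<alpha> i k)" using H unfolding closed_baire_iff by blast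
    then have "H \<inter> cyl (N + n) (\<alpha> i) = {}" by (auto simp: cyl_def)
    then have "jointly_separable I (\<lambda>i. g ` (H \<inter> cyl (N + n) (\<alpha> i)))"
      unfolding jointly_separable_def
      by (intro exI[of _ "\<lambda>j. if j = i then {} else UNIV"]) (use i in auto)
    then show False using bad_\<alpha>[of n] by (simp add: bad_def)
  next
    case False
    then have \<alpha>H: "\<alpha> i \<in> H" if "i \<in> I" for i using that by blast
    \<comment> \<open>A common image of the limit points would lie in all the sets of
      \<open>disj\<close>. For empty \<open>I\<close> the intersection in \<open>disj\<close> is the
      whole space, which contradicts \<open>disj\<close> as well.\<close>
    have "\<exists>i\<in>I. \<exists>j\<in>I. g (\<alpha> i) \<noteq> g (\<alpha> j)"
    proof (rule ccontr)
      assume *: "\<not> ?thesis"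
      show False
      proof (cases "I = {}")
        case True
        then show False using disj by simp
      next
        case False
        then obtain i0 where "i0 \<in> I" by blast
        have "g (\<alpha> i0) \<in> g ` (H \<inter> cyl N (w0 i))" if "i \<in> I" for i
        proof -
          have "g (\<alpha> i0) = g (\<alpha> i)" using * that \<open>i0 \<in> I\<close> by blast
          moreover have "\<alpha> i \<in> H \<inter> cyl N (w0 i)" using \<alpha>H[OF that] unfolding cyl0 by (simp add: cyl_def)
          ultimately show ?thesis by blast
        qed
        then show False using disj by blast
      qed
    qed
    then obtain i j p where ij: "i \<in> I" "j \<in> I" "g (\<alpha> i) p \<noteq> g (\<alpha> j) p" by (auto simp: fun_eq_iff)
    obtain a b where ab: "\<forall>v\<in>cyl a (\<alpha> i). g v p = g (\<alpha> i) p" "\<forall>v\<in>cyl b (\<alpha> j). g v p = g (\<alpha> j) p"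
      using continuous_coordinate_eventually_fixed[OF g] by meson
    define n where "n = max a b"
    have "cyl (N + n) (\<alpha> i) \<subseteq> cyl a (\<alpha> i)" "cyl (N + n) (\<alpha> j) \<subseteq> cyl b (\<alpha> j)"
      by (auto intro!: cyl_mono simp: n_def)
    then have "g ` (H \<inter> cyl (N + n) (\<alpha> i)) \<subseteq> {y. y p = g (\<alpha> i) p}"
      "g ` (H \<inter> cyl (N + n) (\<alpha> j)) \<subseteq> {y. y p = g (\<alpha> j) p}" using ab by auto
    moreover define U where "U k = (if k = i then {y. y p = g (\<alpha> i) p}
          else if k = j then {y. y p = g (\<alpha> j) p} else UNIV)" for k
    ultimately have "\<forall>k\<in>I. U k \<in> sets borel \<and> g ` (H \<inter> cyl (N + n) (\<alpha> k)) \<subseteq> U k"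
      by (auto intro!: borel_open open_coordinate)
    moreover have "U i \<inter> U j = {}" using ij(3) by (auto simp: U_def)
    then have "(\<Inter>k\<in>I. U k) = {}" using ij(1,2) by blast
    ultimately have "jointly_separable I (\<lambda>i. g ` (H \<inter> cyl (N + n) (\<alpha> i)))"
      unfolding jointly_separable_def by blast
    then show False using bad_\<alpha>[of n] by (simp add: bad_def)
  qed
qed

text \<open>The branch runs through nodes with extensions in \<open>T\<close> on every level
  (\<open>ext\<close>). Such a node has such a child: otherwise each of its finitely many children
  in \<open>T\<close> would die out at some level, but an extension of the node on a level beyond
  all of these passes through one of the children.\<close>

lemma koenig:
  fixes T :: "nat list set"
  assumes prefix: "\<And>s k. s \<in> T \<Longrightarrow> take k s \<in> T"
    and finite_levels: "\<And>n. finite {s \<in> T. length s = n}"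
    and levels: "\<And>n. \<exists>s\<in>T. length s = n"
  shows "\<exists>\<alpha>. \<forall>n. map \<alpha> [0..<n] \<in> T"
proof -
  define ext where "ext s n \<longleftrightarrow> (\<exists>t\<in>T. length t = n \<and> take (length s) t = s)" for s n
  have ext_mono: "ext s m" if e: "ext s n" "m \<le> n" "length s \<le> m" for s m n
  proof -
    obtain t where "t \<in> T" "length t = n" "take (length s) t = s" using e(1) unfolding ext_def by blast
    then show ?thesis unfolding ext_def
      by (intro bexI[of _ "take m t"]) (use e prefix in \<open>auto simp: min_def\<close>)
  qed
  have step: "\<exists>k. \<forall>n\<ge>length (s @ [k]). ext (s @ [k]) n" if s: "\<forall>n\<ge>length s. ext s n" for s
  proof (rule ccontr)
    assume "\<not> ?thesis"
    then have "\<forall>k. \<exists>n\<ge>length (s @ [k]). \<not> ext (s @ [k]) n" by blast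
    then obtain n where n: "\<And>k. n k \<ge> length (s @ [k])" "\<And>k. \<not> ext (s @ [k]) (n k)" by metis
    let ?K = "{k. s @ [k] \<in> T}"
    have "finite ?K"
    proof (rule finite_imageD)
      show "finite ((\<lambda>k. s @ [k]) ` ?K)"
        by (rule finite_subset[OF _ finite_levels[of "Suc (length s)"]]) auto
    qed (auto simp: inj_on_def)
    then have fin: "finite (insert (Suc (length s)) (n ` ?K))" by simp
    define m where "m = Max (insert (Suc (length s)) (n ` ?K))"
    have m: "m \<ge> Suc (length s)" "\<And>k. k \<in> ?K \<Longrightarrow> n k \<le> m"
      unfolding m_def using fin by (auto intro!: Max_ge)
    have "ext s m" using s m(1) by simp
    then obtain t where t: "t \<in> T" "length t = m" "take (length s) t = s" unfolding ext_def by blast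
    let ?k = "t ! length s"
    have *: "take (length (s @ [?k])) t = s @ [?k]"
      using t m(1) by (simp add: take_Suc_conv_app_nth)
    then have "?k \<in> ?K" using prefix[OF t(1), of "length (s @ [?k])"] by simp
    then have "n ?k \<le> m" by (rule m(2))
    moreover have "ext (s @ [?k]) m" using * t unfolding ext_def by blast
    ultimately have "ext (s @ [?k]) (n ?k)" using ext_mono[OF _ _ n(1)] by blast
    then show False using n(2) by blast
  qed
  have "\<exists>f. \<forall>j. (length (f j) = j \<and> (\<forall>n\<ge>length (f j). ext (f j) n)) \<and> (\<exists>k. f (Suc j) = f j @ [k])"
  proof (rule dependent_nat_choice)
    show "\<exists>x. length x = 0 \<and> (\<forall>n\<ge>length x. ext x n)" using levels by (auto simp: ext_def)
    fix x :: "nat list" and j assume "length x = j \<and> (\<forall>n\<ge>length x. ext x n)"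
    then have x: "length x = j" "\<forall>n\<ge>length x. ext x n" by simp_all
    obtain k where "\<forall>n\<ge>length (x @ [k]). ext (x @ [k]) n" using step[OF x(2)] ..
    then show "\<exists>y. (length y = Suc j \<and> (\<forall>n\<ge>length y. ext y n)) \<and> (\<exists>k. y = x @ [k])"
      using x(1) by (intro exI[of _ "x @ [k]"] conjI) simp_all
  qed
  then obtain f where "\<forall>j. (length (f j) = j \<and> (\<forall>n\<ge>length (f j). ext (f j) n)) \<and> (\<exists>k. f (Suc j) = f j @ [k])" ..
  then have f: "length (f j) = j" "\<forall>n\<ge>length (f j). ext (f j) n" "\<exists>k. f (Suc j) = f j @ [k]" for j
    by blast+
  define \<alpha> where "\<alpha> k = f (Suc k) ! k" for k
  have "map \<alpha> [0..<n] = f n" for n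
  proof (induction n)
    case 0
    then show ?case using f(1)[of 0] by simp
  next
    case (Suc n)
    obtain k where "f (Suc n) = f n @ [k]" using f(3) by blast
    moreover then have "\<alpha> n = k" using f(1)[of n] by (simp add: \<alpha>_def nth_append)
    ultimately show ?case using Suc by simp
  qed
  moreover have "f n \<in> T" for n
  proof -
    have "ext (f n) n" using f(2)[of n] f(1)[of n] by simp
    then show ?thesis using f(1)[of n] by (auto simp: ext_def)
  qed
  ultimately show ?thesis by (intro exI[of _ \<alpha>]) simp
qed

definition seq_of :: "nat list \<Rightarrow> baire" where
  "seq_of s k = (if k < length s then s ! k else 0)"

text \<open>The set \<open>g ` H\<close> is the set of points lying in Borel hulls \<open>B s\<close> along an infinite branch: the
  hulls are chosen such that no point lies in more than \<open>d\<close> of them on the same level, so that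
  Koenig's lemma turns the quantifier over branches into one over levels.\<close>

lemma borel_image_closed_bounded_fibres:
  fixes g :: "baire \<Rightarrow> baire"
  assumes H: "closed H" and g: "continuous_on UNIV g"
    and fib: "\<And>x. finite {v \<in> H. g v = x}" "\<And>x. card {v \<in> H. g v = x} \<le> d"
  shows "g ` H \<in> sets borel"
proof -
  define A where "A s = g ` (H \<inter> cyl (length s) (seq_of s))" for s
  \<comment> \<open>A member of \<open>Fam\<close> consists of \<open>d + 1\<close> distinct nodes
    of one level. Their pieces \<open>A s\<close> have no common point, because it would have
    \<open>d + 1\<close> distinct preimages in \<open>H\<close>.\<close>
  define Fam where "Fam = {S :: nat list set. finite S \<and> card S = Suc d \<and> (\<exists>n. \<forall>s\<in>S. length s = n)}"
  have countable_Fam: "countable Fam"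
    by (rule countable_subset[OF _ countable_Collect_finite]) (auto simp: Fam_def)
  have "jointly_separable S A" if S: "S \<in> Fam" for S
  proof -
    obtain n where n: "\<And>s. s \<in> S \<Longrightarrow> length s = n" and fS: "finite S" "card S = Suc d"
      using S by (auto simp: Fam_def)
    have A: "A s = g ` (H \<inter> cyl n (seq_of s))" if "s \<in> S" for s using n that by (simp add: A_def)
    have "x \<notin> (\<Inter>s\<in>S. g ` (H \<inter> cyl n (seq_of s)))" for x
    proof
      assume "x \<in> (\<Inter>s\<in>S. g ` (H \<inter> cyl n (seq_of s)))"
      then have "\<forall>s\<in>S. \<exists>v. v \<in> H \<inter> cyl n (seq_of s) \<and> g v = x" by blast
      then obtain v where v: "\<And>s. s \<in> S \<Longrightarrow> v s \<in> H \<inter> cyl n (seq_of s)"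
        "\<And>s. s \<in> S \<Longrightarrow> g (v s) = x" by metis
      have "inj_on v S"
      proof (rule inj_onI)
        fix s t assume st: "s \<in> S" "t \<in> S" "v s = v t"
        have "s ! k = t ! k" if "k < n" for k
          using v(1)[OF st(1)] v(1)[OF st(2)] st that n by (auto simp: cyl_def seq_of_def)
        then show "s = t" using n[OF st(1)] n[OF st(2)] by (intro nth_equalityI) auto
      qed
      then have "card S = card (v ` S)" by (simp add: card_image)
      also have "\<dots> \<le> card {v \<in> H. g v = x}" by (rule card_mono) (use v fib in auto)
      finally show False using fS fib(2)[of x] by simp
    qed
    then have "jointly_separable S (\<lambda>s. g ` (H \<inter> cyl n (seq_of s)))"
      by (intro jointly_separable_images H g fS) blast
    then show ?thesis using A unfolding jointly_separable_def by (metis (no_types, lifting))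
  qed
  then have "\<forall>S\<in>Fam. \<exists>D. (\<forall>s\<in>S. D s \<in> sets borel \<and> A s \<subseteq> D s) \<and> (\<Inter>s\<in>S. D s) = {}"
    unfolding jointly_separable_def by blast
  then obtain D where D: "\<And>S s. S \<in> Fam \<Longrightarrow> s \<in> S \<Longrightarrow> D S s \<in> sets borel"
    "\<And>S s. S \<in> Fam \<Longrightarrow> s \<in> S \<Longrightarrow> A s \<subseteq> D S s" "\<And>S. S \<in> Fam \<Longrightarrow> (\<Inter>s\<in>S. D S s) = {}"
    unfolding bchoice_iff by blast
  \<comment> \<open>The sets \<open>D S s\<close> keep any \<open>d + 1\<close> nodes of one level
    from sharing a point; the closure forces a point found along a branch to be the value of
    \<open>g\<close> at that branch. Intersecting over prefixes in \<open>B'\<close> makes the nodes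
    whose hull contains a given point a tree.\<close>
  define B where "B s = closure (A s) \<inter> (\<Inter>S\<in>{S\<in>Fam. s \<in> S}. D S s)" for s
  define B' where "B' s = (\<Inter>k\<in>{..length s}. B (take k s))" for s
  have "B s \<in> sets borel" for s
    unfolding B_def
    by (intro sets.Int borel_closed closed_closure borel_countable_INT countable_subset[OF _ countable_Fam] D)
      auto
  then have "B' s \<in> sets borel" for s
    unfolding B'_def by (intro borel_countable_INT) auto
  then have "(\<Inter>n. \<Union>s\<in>{s. length s = n}. B' s) \<in> sets borel"
    by (intro borel_countable_INT sets.countable_UN'') auto
  moreover have "g ` H = (\<Inter>n. \<Union>s\<in>{s. length s = n}. B' s)"
  proof (intro equalityI subsetI)
    fix x assume "x \<in> g ` H"
    then obtain v where v: "v \<in> H" "x = g v" by blast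
    have "x \<in> B (map v [0..<k])" for k
    proof -
      have "x \<in> A (map v [0..<k])" unfolding A_def v(2) by (intro imageI) (use v in \<open>auto simp: cyl_def seq_of_def\<close>)
      then show ?thesis unfolding B_def using D(2) closure_subset[THEN subsetD] by blast
    qed
    then have "x \<in> B' (map v [0..<n])" for n by (simp add: B'_def take_map)
    then show "x \<in> (\<Inter>n. \<Union>s\<in>{s. length s = n}. B' s)" by force
  next
    fix x assume x: "x \<in> (\<Inter>n. \<Union>s\<in>{s. length s = n}. B' s)"
    have "\<exists>\<alpha>. \<forall>n. map \<alpha> [0..<n] \<in> {s. x \<in> B' s}"
    proof (rule koenig)
      show "take k s \<in> {s. x \<in> B' s}" if "s \<in> {s. x \<in> B' s}" for s k
        using that by (auto simp: B'_def min_def split: if_splits)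
      show "\<exists>s\<in>{s. x \<in> B' s}. length s = n" for n using x by blast
      show "finite {s \<in> {s. x \<in> B' s}. length s = n}" for n
      proof (rule ccontr)
        assume "infinite {s \<in> {s. x \<in> B' s}. length s = n}"
        then obtain S where S: "finite S" "card S = Suc d" "S \<subseteq> {s \<in> {s. x \<in> B' s}. length s = n}"
          using infinite_arbitrarily_large by blast
        then have "\<forall>s\<in>S. length s = n" by blast
        then have "S \<in> Fam" using S unfolding Fam_def by blast
        moreover have "x \<in> B s" if "s \<in> S" for s
        proof -
          have "x \<in> B' s" using S that by blast
          then have "x \<in> B (take (length s) s)" unfolding B'_def by blast
          then show ?thesis by simp
        qed
        ultimately have "x \<in> (\<Inter>s\<in>S. D S s)" unfolding B_def by blast
        then show False using D(3)[OF \<open>S \<in> Fam\<close>] by blast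
      qed
    qed
    then obtain \<alpha> where "\<And>n. x \<in> B' (map \<alpha> [0..<n])" by auto
    then have "x \<in> B (take n (map \<alpha> [0..<n]))" for n
      unfolding B'_def by (metis (no_types, lifting) INT_D atMost_iff length_map diff_zero length_upt order_refl)
    then have "x \<in> B (map \<alpha> [0..<n])" for n by simp
    moreover have "cyl n (seq_of (map \<alpha> [0..<n])) = cyl n \<alpha>" for n
      by (auto simp: cyl_def seq_of_def)
    ultimately have cl: "x \<in> closure (g ` (H \<inter> cyl n \<alpha>))" for n
    proof -
      assume *: "\<And>n. x \<in> B (map \<alpha> [0..<n])" "\<And>n. cyl n (seq_of (map \<alpha> [0..<n])) = cyl n \<alpha>"
      have "x \<in> closure (A (map \<alpha> [0..<n]))" using *(1)[of n] unfolding B_def by (rule IntD1)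
      then show ?thesis using *(2)[of n] by (simp add: A_def)
    qed
    have "\<exists>w\<in>H. \<forall>i<n. w i = \<alpha> i" for n
    proof -
      have "g ` (H \<inter> cyl n \<alpha>) \<noteq> {}" using cl[of n] by force
      then show ?thesis by (auto simp: cyl_def)
    qed
    then have "\<alpha> \<in> H" using H by (simp add: closed_baire_iff)
    moreover have "g \<alpha> = x"
    proof (rule ccontr)
      assume "g \<alpha> \<noteq> x"
      then obtain p where p: "g \<alpha> p \<noteq> x p" by (auto simp: fun_eq_iff)
      obtain n where "\<forall>v\<in>cyl n \<alpha>. g v p = g \<alpha> p"
        using continuous_coordinate_eventually_fixed[OF g] by blast
      then have "{y. y p = x p} \<inter> g ` (H \<inter> cyl n \<alpha>) = {}" using p by auto
      then have "{y. y p = x p} \<inter> closure (g ` (H \<inter> cyl n \<alpha>)) = {}"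
        using open_Int_closure_eq_empty[OF open_coordinate] by blast
      then show False using cl[of n] by blast
    qed
    ultimately show "x \<in> g ` H" by blast
  qed
  ultimately show ?thesis by simp
qed

section \<open>Projections of Borel sets with bounded sections\<close>

definition rad :: "nat \<Rightarrow> real" where "rad k = inverse (real (Suc k))"

lemma rad_pos: "0 < rad k" by (simp add: rad_def)

lemma rad_mono: "m \<le> n \<Longrightarrow> rad n \<le> rad m" by (simp add: rad_def)

lemma rad_small: "0 < e \<Longrightarrow> \<exists>k. rad k < e"
  unfolding rad_def by (rule reals_Archimedean)

lemma rad_small_half: "x < y \<Longrightarrow> \<exists>k. rad k < (y - x) / 2"
  by (rule rad_small) simp

lemma pred_coordinate [measurable]: "Measurable.pred borel (\<lambda>y :: baire. y p = q)"
  using borel_open[OF open_coordinate[of p q]] by (simp add: pred_def)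

text \<open>A point of a separable metric space is determined by the balls \<open>ball (a i) (rad k)\<close> containing
  it; the last two conditions say which sets of balls arise in this way when the space is complete.\<close>

locale separable_complete_metric = Metric_space +
  fixes a :: "nat \<Rightarrow> 'a"
  assumes complete: "mcomplete"
    and range_a: "a i \<in> M"
    and dense: "\<lbrakk>x \<in> M; 0 < e\<rbrakk> \<Longrightarrow> \<exists>i. d x (a i) < e"
begin

definition ball_code :: "'a \<Rightarrow> baire" where
  "ball_code x n = (if d x (a (fst (prod_decode n))) < rad (snd (prod_decode n)) then 1 else 0)"

definition codes :: "baire set" where
  "codes = {y. (\<forall>n. y n = 0 \<or> y n = 1) \<and> (\<forall>k. \<exists>i. y (prod_encode (i, k)) = 1) \<and>
     (\<forall>i k j m. y (prod_encode (i, k)) = 1 \<and> y (prod_encode (j, m)) = 1 \<longrightarrow> d (a i) (a j) < rad k + rad m) \<and>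
     (\<forall>i k. y (prod_encode (i, k)) = 1 \<longleftrightarrow> (\<exists>j m. y (prod_encode (j, m)) = 1 \<and> d (a i) (a j) + rad m < rad k))}"

lemma codes_borel: "codes \<in> sets borel"
proof -
  have "Measurable.pred borel (\<lambda>y :: baire. (\<forall>n. y n = 0 \<or> y n = 1) \<and> (\<forall>k. \<exists>i. y (prod_encode (i, k)) = 1) \<and>
     (\<forall>i k j m. y (prod_encode (i, k)) = 1 \<and> y (prod_encode (j, m)) = 1 \<longrightarrow> d (a i) (a j) < rad k + rad m) \<and>
     (\<forall>i k. y (prod_encode (i, k)) = 1 \<longleftrightarrow> (\<exists>j m. y (prod_encode (j, m)) = 1 \<and> d (a i) (a j) + rad m < rad k)))"
    by measurable
  then show ?thesis by (simp add: pred_def codes_def)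
qed

lemma ball_code_eq_1: "ball_code x (prod_encode (i, k)) = 1 \<longleftrightarrow> d x (a i) < rad k"
  by (simp add: ball_code_def)

lemma ball_code_in_codes:
  assumes x: "x \<in> M"
  shows "ball_code x \<in> codes"
proof -
  have "\<exists>i. d x (a i) < rad k" for k using dense[OF x rad_pos] .
  moreover have "d (a i) (a j) < rad k + rad m" if "d x (a i) < rad k" "d x (a j) < rad m" for i k j m
    using triangle[of "a i" x "a j"] that x range_a commute[of x "a i"] by fastforce
  moreover have "\<exists>j m. d x (a j) < rad m \<and> d (a i) (a j) + rad m < rad k" if *: "d x (a i) < rad k" for i k
  proof -
    obtain m where m: "rad m < (rad k - d x (a i)) / 2" using rad_small_half[OF *] by blast
    obtain j where j: "d x (a j) < rad m" using dense[OF x rad_pos] by blast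
    have "d (a i) (a j) \<le> d x (a i) + d x (a j)"
      using triangle[of "a i" x "a j"] x range_a commute[of x "a i"] by simp
    then have "d (a i) (a j) + rad m < rad k" using m j by simp
    then show ?thesis using j by blast
  qed
  moreover have "d x (a i) < rad k" if "d x (a j) < rad m" "d (a i) (a j) + rad m < rad k" for i k j m
    using triangle[of x "a j" "a i"] that x range_a commute[of "a i" "a j"] by simp
  ultimately show ?thesis
    unfolding codes_def mem_Collect_eq ball_code_eq_1 by (intro conjI) (simp add: ball_code_def, blast+)
qed

text \<open>Centres of selected balls of radius \<open>rad k\<close> form a Cauchy sequence because
  selected balls are compatible, and completeness gives the point. Passing to the limit only yields
  \<open>d x (a j) \<le> rad m\<close>; the last condition of \<open>codes\<close> supplies a
  selected ball strictly inside the given one and restores the strict inequality.\<close>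

lemma codes_eq: "codes = ball_code ` M"
proof (intro equalityI subsetI)
  fix y assume y: "y \<in> codes"
  define S where "S i k \<longleftrightarrow> y (prod_encode (i, k)) = 1" for i k
  have S: "\<exists>i. S i k" "S i k \<Longrightarrow> S j m \<Longrightarrow> d (a i) (a j) < rad k + rad m"
    "S i k \<longleftrightarrow> (\<exists>j m. S j m \<and> d (a i) (a j) + rad m < rad k)" for i k j m
    using y unfolding codes_def S_def by blast+
  obtain c where c: "\<And>k. S (c k) k" using S(1) by metis
  have "MCauchy (\<lambda>k. a (c k))"
    unfolding MCauchy_def
  proof (intro conjI allI impI)
    fix e :: real assume "e > 0"
    then obtain N where N: "rad N < e / 2" using rad_small[of "e / 2"] by auto
    have "d (a (c n)) (a (c n')) < e" if "N \<le> n" "N \<le> n'" for n n'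
      using S(2)[OF c c, of n n'] rad_mono[OF that(1)] rad_mono[OF that(2)] N by simp
    then show "\<exists>N. \<forall>n n'. N \<le> n \<longrightarrow> N \<le> n' \<longrightarrow> d (a (c n)) (a (c n')) < e" by blast
  qed (use range_a in auto)
  then obtain x where "limitin mtopology (\<lambda>k. a (c k)) x sequentially"
    using complete unfolding mcomplete_def by blast
  then have x: "x \<in> M" and lim: "\<And>e. e > 0 \<Longrightarrow> \<exists>N. \<forall>n\<ge>N. d (a (c n)) x < e"
    unfolding limit_metric_sequentially by (simp, meson)
  have near: "d x (a j) \<le> rad m" if "S j m" for j m
  proof (rule field_le_epsilon)
    fix e :: real assume "e > 0"
    then obtain N where N: "\<forall>n\<ge>N. d (a (c n)) x < e / 2" using lim[of "e / 2"] by auto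
    obtain q where q: "rad q < e / 2" using rad_small[of "e / 2"] \<open>e > 0\<close> by auto
    define n where "n = max N q"
    have "d (a (c n)) x < e / 2" "rad n < e / 2"
      using N q rad_mono[of q n] by (auto simp: n_def)
    moreover have "d x (a j) \<le> d (a (c n)) x + d (a (c n)) (a j)"
      using triangle[of x "a (c n)" "a j"] x range_a commute[of x "a (c n)"] by simp
    moreover have "d (a (c n)) (a j) < rad n + rad m" using S(2)[OF c that] .
    ultimately show "d x (a j) \<le> rad m + e" by simp
  qed
  have iff: "d x (a i) < rad k \<longleftrightarrow> S i k" for i k
  proof
    assume "S i k"
    then obtain j m where jm: "S j m" "d (a i) (a j) + rad m < rad k" using S(3) by blast
    have "d x (a i) \<le> d x (a j) + d (a i) (a j)"
      using triangle[of x "a j" "a i"] x range_a commute[of "a i" "a j"] by simp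
    then show "d x (a i) < rad k" using near[OF jm(1)] jm(2) by simp
  next
    assume *: "d x (a i) < rad k"
    then obtain p where p: "rad p < (rad k - d x (a i)) / 2" using rad_small_half[OF *] by blast
    have "d (a i) (a (c p)) \<le> d x (a i) + d x (a (c p))"
      using triangle[of "a i" x "a (c p)"] x range_a commute[of x "a i"] by simp
    then have "d (a i) (a (c p)) + rad p < rad k" using near[OF c[of p]] p by simp
    then show "S i k" using S(3) c by blast
  qed
  have "y n = ball_code x n" for n
  proof -
    obtain i k where n: "n = prod_encode (i, k)" by (metis prod_decode_inverse surj_pair)
    have "y n = 0 \<or> y n = 1" using y by (simp add: codes_def)
    moreover have "y n = 1 \<longleftrightarrow> d x (a i) < rad k" using iff n by (simp add: S_def)
    ultimately show ?thesis using n by (auto simp: ball_code_def)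
  qed
  then have "y = ball_code x" by blast
  then show "y \<in> ball_code ` M" using x by blast
qed (use ball_code_in_codes in auto)

lemma inj_ball_code: "inj_on ball_code M"
proof (rule inj_onI, rule ccontr)
  fix x y assume xy: "x \<in> M" "y \<in> M" "ball_code x = ball_code y" "x \<noteq> y"
  then have "0 < d x y / 2" by simp
  then obtain k where k: "rad k < d x y / 2" using rad_small by blast
  obtain i where i: "d x (a i) < rad k" using dense[OF xy(1) rad_pos] by blast
  then have "d y (a i) < rad k" using xy(3) ball_code_eq_1 by metis
  then show False using i k triangle[of x "a i" y] xy range_a commute[of y "a i"] by simp
qed

lemma openin_code:
  assumes "openin mtopology U"
  shows "\<exists>B\<in>sets borel. U = ball_code -` B \<inter> M"
proof -
  define J where "J = {n. \<forall>x\<in>M. ball_code x n = 1 \<longrightarrow> x \<in> U}"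
  have "(\<Union>n\<in>J. {y :: baire. y n = 1}) \<in> sets borel"
    by (intro borel_open open_UN ballI open_coordinate)
  moreover have "U = ball_code -` (\<Union>n\<in>J. {y. y n = 1}) \<inter> M"
  proof (intro equalityI subsetI)
    fix x assume "x \<in> U"
    then obtain r where r: "r > 0" "mball x r \<subseteq> U" and x: "x \<in> M"
      using assms unfolding openin_mtopology by blast
    obtain k where k: "rad k < r / 2" using rad_small[of "r / 2"] r by auto
    obtain i where i: "d x (a i) < rad k" using dense[OF x rad_pos] by blast
    have "z \<in> U" if z: "z \<in> M" "ball_code z (prod_encode (i, k)) = 1" for z
    proof -
      have "d z (a i) < rad k" using z(2) by (simp only: ball_code_eq_1)
      then have "d x z < r" using i k triangle[of x "a i" z] x z range_a commute[of z "a i"] by simp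
      then show ?thesis using r x z by (auto simp: mball_def)
    qed
    then have "prod_encode (i, k) \<in> J" unfolding J_def by blast
    moreover have "ball_code x (prod_encode (i, k)) = 1" using i ball_code_eq_1 by blast
    ultimately show "x \<in> ball_code -` (\<Union>n\<in>J. {y. y n = 1}) \<inter> M" using x by blast
  qed (auto simp: J_def)
  ultimately show ?thesis by blast
qed

lemma openin_ball: "openin mtopology {x \<in> M. ball_code x n = 1}"
proof -
  have "{x \<in> M. ball_code x n = 1} = mball (a (fst (prod_decode n))) (rad (snd (prod_decode n)))"
    using range_a by (auto simp: ball_code_def mball_def commute split: if_splits)
  then show ?thesis by simp
qed

end

lemma standard_borel_space_code:
  fixes M :: "'a measure"
  assumes "standard_borel_space M"
  obtains \<phi> :: "'a \<Rightarrow> baire" where "inj_on \<phi> (space M)" "\<phi> ` space M \<in> sets borel"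
    "\<phi> \<in> borel_measurable M" "\<And>B. B \<in> sets M \<Longrightarrow> \<exists>B'\<in>sets borel. B = \<phi> -` B' \<inter> space M"
proof (cases "space M = {}")
  \<comment> \<open>The empty space has no dense sequence and so does not fit the locale.\<close>
  case True
  have "(\<lambda>_. \<lambda>_. 0 :: nat) \<in> borel_measurable M" by simp
  moreover have "\<exists>B'\<in>sets borel. B = (\<lambda>_. \<lambda>_. 0 :: nat) -` B' \<inter> space M" if "B \<in> sets M" for B
    using sets.sets_into_space[OF that] True by auto
  ultimately show ?thesis using True that[of "\<lambda>_. \<lambda>_. 0"] by auto
next
  case ne: False
  obtain X where X: "completely_metrizable_space X" "separable_space X" "topspace X = space M"
    "sets M = sigma_sets (space M) {U. openin X U}"
    using assms unfolding standard_borel_space_def by blast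
  obtain N d where N: "Metric_space N d" "Metric_space.mcomplete N d" "X = Metric_space.mtopology N d"
    using X(1) unfolding completely_metrizable_space_def by blast
  interpret Metric_space N d by fact
  have N_eq: "N = space M" using X(3) N(3) by simp
  obtain C where C: "countable C" "C \<subseteq> N" "mtopology closure_of C = N"
    using X(2) N(3) unfolding separable_space_def by auto
  have "C \<noteq> {}" using C(3) ne N_eq by auto
  interpret separable_complete_metric N d "from_nat_into C"
  proof
    show "mcomplete" by (rule N(2))
    show "from_nat_into C i \<in> N" for i using from_nat_into[OF \<open>C \<noteq> {}\<close>] C(2) by blast
    show "\<exists>i. d x (from_nat_into C i) < e" if e: "x \<in> N" "0 < e" for x e
    proof -
      have "x \<in> mtopology closure_of C" using C(3) e by simp
      then obtain y where "y \<in> C" "y \<in> mball x e" using e(2) unfolding metric_closure_of by blast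
      then show ?thesis
        using from_nat_into_to_nat_on[OF C(1), of y] by (intro exI[of _ "to_nat_on C y"]) (simp add: mball_def)
    qed
  qed
  show ?thesis
  proof (rule that[of ball_code])
    show "inj_on ball_code (space M)" using inj_ball_code N_eq by simp
    show "ball_code ` space M \<in> sets borel" using codes_eq codes_borel N_eq by simp
    show "ball_code \<in> borel_measurable M"
    proof (rule measurable_coordinatewise_then_product)
      fix n
      have *: "{x \<in> space M. ball_code x n = 1} \<in> sets M"
        unfolding X(4) using openin_ball[of n] N(3) N_eq by (intro sigma_sets.Basic) auto
      have eq: "ball_code x n = indicator {x \<in> space M. ball_code x n = 1} x" if "x \<in> space M" for x
        using that by (auto simp: indicator_def ball_code_def)
      have "(indicator {x \<in> space M. ball_code x n = 1} :: 'a \<Rightarrow> nat) \<in> borel_measurable M"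
        using * by simp
      then show "(\<lambda>x. ball_code x n) \<in> borel_measurable M"
        using measurable_cong[of M "\<lambda>x. ball_code x n", OF eq] by simp
    qed
    show "\<exists>B'\<in>sets borel. B = ball_code -` B' \<inter> space M" if "B \<in> sets M" for B
      using that unfolding X(4)
    proof induction
      case (Basic U)
      then show ?case using openin_code[of U] N(3) N_eq by simp
    next
      case Empty
      then show ?case by (intro bexI[of _ "{}"]) auto
    next
      case (Compl B)
      then obtain B' where "B' \<in> sets borel" "B = ball_code -` B' \<inter> space M" by blast
      then show ?case by (intro bexI[of _ "- B'"]) auto
    next
      case (Union B)
      then obtain B' where "\<And>i::nat. B' i \<in> sets borel" "\<And>i. B i = ball_code -` B' i \<inter> space M" by metis
      then show ?case by (intro bexI[of _ "\<Union>i. B' i"]) auto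
    qed
  qed
qed

text \<open>Adding certificates turns \<open>E\<close> into a closed set \<open>H\<close> on which
  the continuous map \<open>g\<close> reads off the first coordinate of the pair. By uniqueness of
  certificates the fibre of \<open>g\<close> over \<open>x\<close> injects into the section of
  \<open>E\<close> at \<open>x\<close>, so the bound \<open>d\<close> survives.\<close>

lemma borel_projection_baire:
  fixes E :: "(baire \<times> baire) set"
  assumes E: "E \<in> sets (borel \<Otimes>\<^sub>M borel)"
    and fin: "\<And>x. finite {y. (x, y) \<in> E}" "\<And>x. card {y. (x, y) \<in> E} \<le> d"
  shows "fst ` E \<in> sets borel"
proof -
  have m: "(\<lambda>z. (evens z, odds z)) \<in> measurable borel (borel \<Otimes>\<^sub>M borel)"
    by (intro measurable_Pair borel_measurable_continuous_onI continuous_on_evens continuous_on_odds)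
  define E' where "E' = (\<lambda>z. (evens z, odds z)) -` E"
  have "E' \<in> sets borel" using measurable_sets[OF m E] by (simp add: E'_def)
  then have "inj_projection E'" by (rule inj_projection_borel)
  then obtain F where F0: "unique_witness F E'" unfolding inj_projection_def ..
  then have F: "closed F" "fst ` F = E'" "(z, w) \<in> F \<Longrightarrow> (z, w') \<in> F \<Longrightarrow> w = w'" for z w w'
    unfolding unique_witness_def by blast+
  define H where "H = (\<lambda>v. (evens v, odds v)) -` F"
  define g where "g v = evens (evens v)" for v
  have "closed H" unfolding H_def
    by (intro closed_vimage F continuous_on_Pair continuous_on_evens continuous_on_odds)
  moreover have "continuous_on UNIV g" unfolding g_def
    by (intro continuous_on_compose2[OF continuous_on_evens continuous_on_evens]) simp
  moreover have "finite {v \<in> H. g v = x} \<and> card {v \<in> H. g v = x} \<le> d" for x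
  proof -
    have inj: "inj_on (\<lambda>v. odds (evens v)) {v \<in> H. g v = x}"
    proof (rule inj_onI)
      fix v w assume vw: "v \<in> {v \<in> H. g v = x}" "w \<in> {v \<in> H. g v = x}" "odds (evens v) = odds (evens w)"
      have "evens v = evens w" by (rule evens_odds_eqI) (use vw in \<open>auto simp: g_def\<close>)
      moreover have "(evens v, odds v) \<in> F" "(evens w, odds w) \<in> F" using vw by (auto simp: H_def)
      ultimately have "odds v = odds w" using F(3)[of "evens w" "odds v" "odds w"] by simp
      then show "v = w" using \<open>evens v = evens w\<close> by (rule evens_odds_eqI[rotated])
    qed
    have sub: "(\<lambda>v. odds (evens v)) ` {v \<in> H. g v = x} \<subseteq> {y. (x, y) \<in> E}"
    proof (rule image_subsetI)
      fix v assume v: "v \<in> {v \<in> H. g v = x}"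
      then have "evens v \<in> fst ` F" by (force simp: H_def)
      then show "odds (evens v) \<in> {y. (x, y) \<in> E}" using v unfolding F(2) by (auto simp: E'_def g_def)
    qed
    show ?thesis
      using finite_imageD[OF finite_subset[OF sub fin(1)] inj]
        card_image[OF inj] card_mono[OF fin(1) sub] fin(2)[of x] by simp
  qed
  ultimately have "g ` H \<in> sets borel" by (intro borel_image_closed_bounded_fibres[where d = d]) auto
  moreover have "g ` H = fst ` E"
  proof (intro equalityI subsetI)
    fix x assume "x \<in> g ` H"
    then obtain v where v: "(evens v, odds v) \<in> F" "x = evens (evens v)" by (auto simp: H_def g_def)
    then have "evens v \<in> fst ` F" by force
    then show "x \<in> fst ` E" unfolding F(2) using v by (force simp: E'_def)
  next
    fix x assume "x \<in> fst ` E"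
    then obtain y where "(x, y) \<in> E" by auto
    moreover obtain z where z: "evens z = x" "odds z = y" using evens_odds_surj by blast
    ultimately have "z \<in> fst ` F" unfolding F(2) by (simp add: E'_def)
    then obtain w where "(z, w) \<in> F" by force
    moreover obtain v where "evens v = z" "odds v = w" using evens_odds_surj by blast
    ultimately show "x \<in> g ` H" using z by (force simp: H_def g_def)
  qed
  ultimately show ?thesis by simp
qed

theorem borel_projection_bounded_sections:
  assumes M: "standard_borel_space M" and E: "E \<in> sets (M \<Otimes>\<^sub>M M)"
    and fin: "\<And>x. x \<in> space M \<Longrightarrow> finite {y. (x, y) \<in> E}"
      "\<And>x. x \<in> space M \<Longrightarrow> card {y. (x, y) \<in> E} \<le> d"
  shows "{x \<in> space M. \<exists>y. (x, y) \<in> E} \<in> sets M"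
proof -
  obtain \<phi> :: "'a \<Rightarrow> baire" where \<phi>: "inj_on \<phi> (space M)" "\<phi> ` space M \<in> sets borel"
    "\<phi> \<in> borel_measurable M" "\<And>B. B \<in> sets M \<Longrightarrow> \<exists>B'\<in>sets borel. B = \<phi> -` B' \<inter> space M"
    using standard_borel_space_code[OF M] by blast
  have "\<exists>E'\<in>sets (borel \<Otimes>\<^sub>M borel). E = map_prod \<phi> \<phi> -` E' \<inter> space M \<times> space M"
    using E unfolding sets_pair_measure[of M M]
  proof induction
    case (Basic U)
    then obtain A B where AB: "U = A \<times> B" "A \<in> sets M" "B \<in> sets M" by blast
    then obtain A' B' where "A' \<in> sets borel" "B' \<in> sets borel"
      "A = \<phi> -` A' \<inter> space M" "B = \<phi> -` B' \<inter> space M" using \<phi>(4) by metis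
    then show ?case using AB by (intro bexI[of _ "A' \<times> B'"]) auto
  next
    case Empty
    then show ?case by (intro bexI[of _ "{}"]) auto
  next
    case (Compl B)
    then obtain B' where "B' \<in> sets (borel \<Otimes>\<^sub>M borel)" "B = map_prod \<phi> \<phi> -` B' \<inter> space M \<times> space M" by blast
    then show ?case using sets.compl_sets[of B' "borel \<Otimes>\<^sub>M borel"]
      by (intro bexI[of _ "- B'"]) (auto simp: space_pair_measure Compl_eq_Diff_UNIV)
  next
    case (Union B)
    define R where "R B B' \<longleftrightarrow> B' \<in> sets (borel \<Otimes>\<^sub>M borel) \<and> B = map_prod \<phi> \<phi> -` B' \<inter> space M \<times> space M"
      for B B'
    have "\<exists>B'. R (B i) B'" for i using Union.IH[of i] unfolding R_def by blast
    then obtain B' where "\<And>i. R (B i) (B' i)" by metis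
    then have "\<And>i. B' i \<in> sets (borel \<Otimes>\<^sub>M borel)"
      "\<And>i. B i = map_prod \<phi> \<phi> -` B' i \<inter> space M \<times> space M" unfolding R_def by blast+
    then show ?case by (intro bexI[of _ "\<Union>i. B' i"]) auto
  qed
  then obtain E' where E': "E' \<in> sets (borel \<Otimes>\<^sub>M borel)" "E = map_prod \<phi> \<phi> -` E' \<inter> space M \<times> space M" by blast
  \<comment> \<open>Restricting to the image of \<open>\<phi>\<close> removes the part of
    \<open>E'\<close> about which nothing is known; the remaining sections are images of sections of
    \<open>E\<close>.\<close>
  define F where "F = E' \<inter> \<phi> ` space M \<times> \<phi> ` space M"
  have sec: "{y. (\<phi> x, y) \<in> F} = \<phi> ` {y. (x, y) \<in> E}" if "x \<in> space M" for x
    unfolding F_def E'(2) using that by auto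
  have sec0: "{y. (x, y) \<in> F} = {}" if "x \<notin> \<phi> ` space M" for x using that by (auto simp: F_def)
  have "finite {y. (x, y) \<in> F} \<and> card {y. (x, y) \<in> F} \<le> d" for x
  proof (cases "x \<in> \<phi> ` space M")
    case True
    then obtain z where z: "z \<in> space M" "x = \<phi> z" by blast
    show ?thesis unfolding z(2) sec[OF z(1)]
      using fin[OF z(1)] card_image_le[OF fin(1)[OF z(1)], of \<phi>] by auto
  qed (use sec0 in auto)
  moreover have "F \<in> sets (borel \<Otimes>\<^sub>M borel)" unfolding F_def using E'(1) \<phi>(2) by auto
  ultimately have "fst ` F \<in> sets borel" by (intro borel_projection_baire[where d = d]) auto
  from measurable_sets[OF \<phi>(3) this] have "\<phi> -` (fst ` F) \<inter> space M \<in> sets M" .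
  moreover have "\<phi> -` (fst ` F) \<inter> space M = {x \<in> space M. \<exists>y. (x, y) \<in> E}"
  proof -
    have "\<phi> x \<in> fst ` F \<longleftrightarrow> (\<exists>y. (x, y) \<in> E)" if "x \<in> space M" for x
    proof -
      have "\<phi> x \<in> fst ` F \<longleftrightarrow> {y. (\<phi> x, y) \<in> F} \<noteq> {}" by force
      then show ?thesis using sec[OF that] by auto
    qed
    then show ?thesis by auto
  qed
  ultimately show ?thesis by simp
qed

section \<open>Isomorphisms of labeled balls\<close>

lemma relpow_sym:
  assumes "sym E"
  shows "(x, y) \<in> E ^^ n \<longleftrightarrow> (y, x) \<in> E ^^ n"
proof -
  have *: "(y, x) \<in> E ^^ n" if "(x, y) \<in> E ^^ n" for x y
    using that
  proof (induction n arbitrary: y)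
    case (Suc n)
    then obtain z where "(x, z) \<in> E ^^ n" "(z, y) \<in> E" by auto
    then have "(z, x) \<in> E ^^ n" "(y, z) \<in> E" using Suc.IH assms by (auto dest: symD)
    then show ?case by (rule relpow_Suc_I2[rotated])
  qed simp
  show ?thesis using *[of x y] *[of y x] by blast
qed

lemma relpow_mono: "R \<subseteq> S \<Longrightarrow> R ^^ n \<subseteq> S ^^ n" for R S :: "'a rel"
  by (induction n) auto

lemma relpow_verts:
  assumes "simple_graph G" "u \<in> verts G" "(u, v) \<in> edges G ^^ k"
  shows "v \<in> verts G"
  using assms(2,3) by (cases k) (use assms(1) in \<open>auto simp: simple_graph_def\<close>)

lemma joined_within_refl [simp]: "joined_within G k u u"
  by (auto simp: joined_within_def intro: exI[of _ 0])

lemma joined_within_sym: "simple_graph G \<Longrightarrow> joined_within G k u v \<Longrightarrow> joined_within G k v u"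
  unfolding joined_within_def simple_graph_def using relpow_sym[of "edges G" u v] by blast

lemma joined_within_trans:
  assumes "joined_within G a u v" "joined_within G b v w" "a + b \<le> c"
  shows "joined_within G c u w"
proof -
  obtain i j where "i \<le> a" "(u, v) \<in> edges G ^^ i" "j \<le> b" "(v, w) \<in> edges G ^^ j"
    using assms(1,2) unfolding joined_within_def by blast
  then have "i + j \<le> c" "(u, w) \<in> edges G ^^ (i + j)" using assms(3) unfolding relpow_add by auto
  then show ?thesis unfolding joined_within_def by blast
qed

lemma joined_within_mono: "joined_within G a u v \<Longrightarrow> a \<le> b \<Longrightarrow> joined_within G b u v"
  by (rule joined_within_trans[OF _ joined_within_refl[of G 0]]) simp_all

lemma joined_within_Suc:
  "joined_within G (Suc k) u v \<longleftrightarrow> joined_within G k u v \<or> (\<exists>w. joined_within G k u w \<and> (w, v) \<in> edges G)"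
proof
  assume "joined_within G (Suc k) u v"
  then obtain i where i: "i \<le> Suc k" "(u, v) \<in> edges G ^^ i" unfolding joined_within_def by blast
  show "joined_within G k u v \<or> (\<exists>w. joined_within G k u w \<and> (w, v) \<in> edges G)"
  proof (cases "i \<le> k")
    case True
    then show ?thesis using i unfolding joined_within_def by blast
  next
    case False
    then have "i = Suc k" using i by simp
    then obtain w where "(u, w) \<in> edges G ^^ k" "(w, v) \<in> edges G" using i(2) by auto
    then show ?thesis unfolding joined_within_def by blast
  qed
next
  assume "joined_within G k u v \<or> (\<exists>w. joined_within G k u w \<and> (w, v) \<in> edges G)"
  then show "joined_within G (Suc k) u v"
  proof
    assume "\<exists>w. joined_within G k u w \<and> (w, v) \<in> edges G"
    then obtain w i where "i \<le> k" "(u, w) \<in> edges G ^^ i" "(w, v) \<in> edges G"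
      unfolding joined_within_def by blast
    then have "Suc i \<le> Suc k" "(u, v) \<in> edges G ^^ Suc i" by auto
    then show ?thesis unfolding joined_within_def by blast
  qed (auto intro: joined_within_mono)
qed

lemma joined_within_verts:
  "simple_graph G \<Longrightarrow> u \<in> verts G \<Longrightarrow> joined_within G k u v \<Longrightarrow> v \<in> verts G"
  unfolding joined_within_def using relpow_verts[of G u v] by blast

lemma mem_ball_iff: "simple_graph G \<Longrightarrow> v \<in> verts G \<Longrightarrow> u \<in> graph_ball G v k \<longleftrightarrow> joined_within G k v u"
  using joined_within_verts[of G v k u] by (auto simp: graph_ball_def)

lemma centre_in_ball: "v \<in> verts G \<Longrightarrow> v \<in> graph_ball G v k"
  by (simp add: graph_ball_def)

lemma ball_sym: "simple_graph G \<Longrightarrow> v \<in> verts G \<Longrightarrow> u \<in> graph_ball G v k \<Longrightarrow> v \<in> graph_ball G u k"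
  using joined_within_sym[of G k v u] by (simp add: graph_ball_def)

lemma ball_trans:
  "u \<in> graph_ball G v a \<Longrightarrow> w \<in> graph_ball G u b \<Longrightarrow> a + b \<le> c \<Longrightarrow> w \<in> graph_ball G v c"
  using joined_within_trans[of G a v u b w c] by (simp add: graph_ball_def)

lemma finite_card_ball:
  assumes G: "simple_graph G" and v: "v \<in> verts G"
    and deg: "\<And>u. u \<in> verts G \<Longrightarrow> finite {w. (u, w) \<in> edges G} \<and> card {w. (u, w) \<in> edges G} \<le> d"
  shows "finite (graph_ball G v k) \<and> card (graph_ball G v k) \<le> (d + 1) ^ k"
proof (induction k)
  case 0
  have "graph_ball G v 0 = {v}" using v by (auto simp: graph_ball_def joined_within_def)
  then show ?case by simp
next
  case (Suc k)
  let ?B = "graph_ball G v k"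
  let ?N = "\<lambda>u. insert u {w. (u, w) \<in> edges G}"
  have sub: "graph_ball G v (Suc k) \<subseteq> (\<Union>u\<in>?B. ?N u)"
  proof
    fix w assume "w \<in> graph_ball G v (Suc k)"
    then have "joined_within G (Suc k) v w" by (simp add: graph_ball_def)
    then consider "joined_within G k v w" | u where "joined_within G k v u" "(u, w) \<in> edges G"
      unfolding joined_within_Suc by blast
    then show "w \<in> (\<Union>u\<in>?B. ?N u)" by cases (use mem_ball_iff[OF G v] in blast)+
  qed
  have N: "finite (?N u) \<and> card (?N u) \<le> d + 1" if "u \<in> ?B" for u
  proof -
    have "u \<in> verts G" using that by (simp add: graph_ball_def)
    from deg[OF this] show ?thesis using card_insert_le_m1 by (auto intro!: order.trans[OF card_insert_le_m1])
  qed
  have fin: "finite (\<Union>u\<in>?B. ?N u)" by (rule finite_UN_I) (use Suc N in simp_all)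
  have "card (graph_ball G v (Suc k)) \<le> card (\<Union>u\<in>?B. ?N u)" by (rule card_mono[OF fin sub])
  also have "\<dots> \<le> (\<Sum>u\<in>?B. card (?N u))" using Suc by (intro card_UN_le) simp
  also have "\<dots> \<le> (\<Sum>u\<in>?B. d + 1)" using N by (intro sum_mono) blast
  also have "\<dots> = card ?B * (d + 1)" by simp
  also have "\<dots> \<le> (d + 1) ^ k * (d + 1)" using Suc by (intro mult_right_mono) simp_all
  finally show ?case using finite_subset[OF sub fin] by (simp add: mult.commute)
qed

text \<open>An explicit isomorphism is kept instead of an equality of types because it can be
  restricted to smaller balls around other vertices.\<close>

definition ball_iso ::
  "nat \<Rightarrow> ('a \<Rightarrow> 'b) \<Rightarrow> 'a ugraph \<Rightarrow> ('a \<Rightarrow> nat) \<Rightarrow> 'a \<Rightarrow> 'b ugraph \<Rightarrow> ('b \<Rightarrow> nat) \<Rightarrow> 'b \<Rightarrow> bool" where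
  "ball_iso k \<psi> G f v H g w \<longleftrightarrow> v \<in> verts G \<and> w \<in> verts H \<and>
     bij_betw \<psi> (graph_ball G v k) (graph_ball H w k) \<and>
     (\<forall>x\<in>graph_ball G v k. \<forall>y\<in>graph_ball G v k. (x, y) \<in> edges G \<longleftrightarrow> (\<psi> x, \<psi> y) \<in> edges H) \<and>
     (\<forall>x\<in>graph_ball G v k. g (\<psi> x) = f x) \<and> \<psi> v = w"

lemma ball_iso_sym:
  assumes "ball_iso k \<psi> G f v H g w"
  shows "ball_iso k (inv_into (graph_ball G v k) \<psi>) H g w G f v"
proof -
  let ?B = "graph_ball G v k" and ?B' = "graph_ball H w k" and ?\<chi> = "inv_into (graph_ball G v k) \<psi>"
  have b: "bij_betw \<psi> ?B ?B'" and v: "v \<in> verts G" "\<psi> v = w" using assms by (auto simp: ball_iso_def)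
  have b': "bij_betw ?\<chi> ?B' ?B" by (rule bij_betw_inv_into[OF b])
  have \<chi>: "?\<chi> x \<in> ?B \<and> \<psi> (?\<chi> x) = x" if "x \<in> ?B'" for x
    using bij_betw_apply[OF b' that] bij_betw_inv_into_right[OF b that] by simp
  have "?\<chi> w = v" using bij_betw_inv_into_left[OF b centre_in_ball[OF v(1)]] v(2) by simp
  then show ?thesis using assms b' \<chi> unfolding ball_iso_def by metis
qed

text \<open>A walk of \<open>t\<close> edges starting at distance at most \<open>r\<close> from the
  root stays in the ball of radius \<open>r + t \<le> k\<close>, where \<open>\<psi>\<close>
  preserves edges.\<close>

lemma ball_iso_walk:
  assumes iso: "ball_iso k \<psi> G f v H g w" and G: "simple_graph G"
    and u: "joined_within G r v u" and "r + t \<le> k" and walk: "(u, y) \<in> edges G ^^ t"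
  shows "(\<psi> u, \<psi> y) \<in> edges H ^^ t"
  using \<open>r + t \<le> k\<close> walk
proof (induction t arbitrary: y)
  case (Suc t)
  then obtain z where z: "(u, z) \<in> edges G ^^ t" "(z, y) \<in> edges G" by auto
  have v: "v \<in> verts G" using iso by (simp add: ball_iso_def)
  have "joined_within G t u z" using z by (auto simp: joined_within_def)
  then have "joined_within G (r + t) v z" using u by (auto intro: joined_within_trans)
  then have "joined_within G (r + t) v z" "joined_within G (Suc (r + t)) v y"
    using z(2) unfolding joined_within_Suc by blast+
  then have "z \<in> graph_ball G v k" "y \<in> graph_ball G v k"
    using Suc.prems(1) unfolding mem_ball_iff[OF G v] by (auto elim: joined_within_mono)
  then have "(\<psi> z, \<psi> y) \<in> edges H" using z(2) iso by (simp add: ball_iso_def)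
  moreover have "(\<psi> u, \<psi> z) \<in> edges H ^^ t" using Suc z(1) by simp
  ultimately show ?case by auto
qed simp

lemma ball_iso_joined:
  assumes iso: "ball_iso k \<psi> G f v H g w" and G: "simple_graph G"
    and u: "joined_within G r v u" and "r + t \<le> k" and "joined_within G t u y"
  shows "joined_within H t (\<psi> u) (\<psi> y)"
proof -
  obtain i where "i \<le> t" "(u, y) \<in> edges G ^^ i" using assms(5) unfolding joined_within_def by blast
  then show ?thesis using ball_iso_walk[OF iso G u, of i y] assms(4) unfolding joined_within_def by auto
qed

text \<open>Applied to \<open>\<psi>\<close>, \<open>ball_iso_joined\<close> sends the small ball
  into the small ball; applied to the inverse, it gives surjectivity.\<close>

lemma ball_iso_restrict:
  assumes iso: "ball_iso k \<psi> G f v H g w" and G: "simple_graph G" and H: "simple_graph H"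
    and u: "joined_within G r v u" and rt: "r + t \<le> k"
  shows "ball_iso t \<psi> G f u H g (\<psi> u)"
proof -
  let ?B = "graph_ball G v k" and ?\<chi> = "inv_into (graph_ball G v k) \<psi>"
  have vw: "v \<in> verts G" "w \<in> verts H" "\<psi> v = w" and b: "bij_betw \<psi> ?B (graph_ball H w k)"
    using iso by (auto simp: ball_iso_def)
  have uB: "u \<in> ?B" using u rt mem_ball_iff[OF G vw(1)] by (auto intro: joined_within_mono)
  have sub: "graph_ball G u t \<subseteq> ?B"
    using u rt mem_ball_iff[OF G vw(1)] by (auto simp: graph_ball_def intro: joined_within_trans)
  have \<psi>u: "joined_within H r w (\<psi> u)"
    using ball_iso_joined[OF iso G joined_within_refl[of G 0] _ u] rt vw(3) by simp
  have uV: "u \<in> verts G" "\<psi> u \<in> verts H"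
    using joined_within_verts[OF G vw(1) u] joined_within_verts[OF H vw(2) \<psi>u] by auto
  have "\<psi> ` graph_ball G u t = graph_ball H (\<psi> u) t"
  proof (intro equalityI subsetI)
    fix z assume "z \<in> \<psi> ` graph_ball G u t"
    then show "z \<in> graph_ball H (\<psi> u) t"
      using ball_iso_joined[OF iso G u rt] mem_ball_iff[OF G uV(1)] mem_ball_iff[OF H uV(2)] by auto
  next
    fix z assume z: "z \<in> graph_ball H (\<psi> u) t"
    then have "joined_within H t (\<psi> u) z" by (simp add: graph_ball_def)
    from ball_iso_joined[OF ball_iso_sym[OF iso] H \<psi>u rt this]
    have "joined_within G t u (?\<chi> z)" using bij_betw_inv_into_left[OF b uB] by simp
    then have "?\<chi> z \<in> graph_ball G u t" using mem_ball_iff[OF G uV(1)] by simp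
    moreover have "z \<in> graph_ball H w k" using z \<psi>u rt by (auto simp: graph_ball_def intro: joined_within_trans)
    then have "\<psi> (?\<chi> z) = z" by (rule bij_betw_inv_into_right[OF b])
    ultimately show "z \<in> \<psi> ` graph_ball G u t" by (metis imageI)
  qed
  moreover have "inj_on \<psi> (graph_ball G u t)" using b sub by (auto simp: bij_betw_def intro: inj_on_subset)
  ultimately show ?thesis using iso uV sub unfolding ball_iso_def bij_betw_def by blast
qed

lemma verts_induced_ball: "verts (induced G (graph_ball G v k)) = graph_ball G v k"
  by (auto simp: induced_def graph_ball_def)

lemma local_type_eq:
  assumes iso: "ball_iso k \<psi> G f v H g w"
  shows "local_type G f v k = local_type H g w k"
proof -
  \<comment> \<open>Stated for arbitrary vertex types, so that it applies to the inverse isomorphism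
    as well.\<close>
  have *: "local_type H g w k \<subseteq> local_type G f v k" if iso: "ball_iso k \<psi> G f v H g w"
    for \<psi> and G :: "'c ugraph" and f v and H :: "'d ugraph" and g w
  proof
    fix X assume "X \<in> local_type H g w k"
    then obtain H' g' w' \<phi> where X: "X = (H', g', w')" "finite_graph H'" "w' \<in> verts H'"
      and \<phi>: "is_graph_iso \<phi> (induced H (graph_ball H w k)) H'" "\<forall>x\<in>graph_ball H w k. g' (\<phi> x) = g x" "\<phi> w = w'"
      unfolding local_type_def iso_type_def verts_induced_ball by blast
    have b: "bij_betw \<psi> (graph_ball G v k) (graph_ball H w k)" using iso by (simp add: ball_iso_def)
    have \<psi>: "\<psi> x \<in> graph_ball H w k" if "x \<in> graph_ball G v k" for x by (rule bij_betw_apply[OF b that])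
    have "bij_betw \<phi> (graph_ball H w k) (verts H')"
      using \<phi>(1) unfolding is_graph_iso_def verts_induced_ball by blast
    from bij_betw_trans[OF b this] have "bij_betw (\<phi> \<circ> \<psi>) (graph_ball G v k) (verts H')" .
    moreover have "(x, y) \<in> edges (induced G (graph_ball G v k)) \<longleftrightarrow> ((\<phi> \<circ> \<psi>) x, (\<phi> \<circ> \<psi>) y) \<in> edges H'"
      if xy: "x \<in> graph_ball G v k" "y \<in> graph_ball G v k" for x y
    proof -
      have "(x, y) \<in> edges (induced G (graph_ball G v k)) \<longleftrightarrow> (\<psi> x, \<psi> y) \<in> edges (induced H (graph_ball H w k))"
        using iso xy \<psi> by (auto simp: ball_iso_def induced_def)
      also have "\<dots> \<longleftrightarrow> (\<phi> (\<psi> x), \<phi> (\<psi> y)) \<in> edges H'"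
        using \<phi>(1) \<psi>[OF xy(1)] \<psi>[OF xy(2)] unfolding is_graph_iso_def verts_induced_ball by blast
      finally show ?thesis by simp
    qed
    ultimately have "is_graph_iso (\<phi> \<circ> \<psi>) (induced G (graph_ball G v k)) H'"
      unfolding is_graph_iso_def verts_induced_ball by blast
    moreover have "\<forall>x\<in>graph_ball G v k. g' ((\<phi> \<circ> \<psi>) x) = f x" "(\<phi> \<circ> \<psi>) v = w'"
      using \<phi> \<psi> iso by (auto simp: ball_iso_def)
    ultimately show "X \<in> local_type G f v k"
      unfolding local_type_def iso_type_def verts_induced_ball using X by blast
  qed
  show ?thesis using *[OF iso] *[OF ball_iso_sym[OF iso]] by blast
qed

text \<open>An output at distance at most \<open>R\<close> from the root reads labels at most
  \<open>T\<close> further away, hence the radius \<open>R + T\<close>.\<close>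

lemma ball_iso_run_local:
  assumes iso: "ball_iso k \<psi> G f v H g w" and G: "simple_graph G" and H: "simple_graph H"
    and RT: "R + T \<le> k"
  shows "ball_iso R \<psi> G (run_local A T G f) v H (run_local A T H g) w"
proof -
  have v: "v \<in> verts G" "\<psi> v = w" using iso by (auto simp: ball_iso_def)
  have "ball_iso R \<psi> G f v H g w"
    using ball_iso_restrict[OF iso G H joined_within_refl[of G 0], of R] RT v by simp
  moreover have "run_local A T H g (\<psi> x) = run_local A T G f x" if "x \<in> graph_ball G v R" for x
    using local_type_eq[OF ball_iso_restrict[OF iso G H _ RT, of x]] that
    by (simp add: run_local_def graph_ball_def)
  ultimately show ?thesis unfolding ball_iso_def by blast
qed

section \<open>Failure events and their transfer between graphs\<close>

definition fails :: "lcl \<Rightarrow> local_algorithm \<Rightarrow> nat \<Rightarrow> 'a ugraph \<Rightarrow> ('a \<Rightarrow> nat) \<Rightarrow> 'a \<Rightarrow> bool" where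
  "fails L A T G f v \<longleftrightarrow> \<not> snd L (local_type G (run_local A T G f) v (fst L))"

lemma fails_iso:
  assumes "ball_iso (fst L + T) \<psi> G f v H g w" "simple_graph G" "simple_graph H"
  shows "fails L A T G f v \<longleftrightarrow> fails L A T H g w"
  unfolding fails_def using local_type_eq[OF ball_iso_run_local[OF assms order_refl]] by simp

lemma is_coloring_run_local_iff:
  "is_coloring L G (run_local A T G f) \<longleftrightarrow> (\<forall>v\<in>verts G. \<not> fails L A T G f v)"
  by (simp add: is_coloring_def fails_def)

lemma ball_iso_cong:
  assumes "v \<in> verts G" "\<And>x. x \<in> graph_ball G v k \<Longrightarrow> f x = g x"
  shows "ball_iso k id G f v G g v"
  unfolding ball_iso_def using assms by auto

lemma induced_relpow:
  assumes G: "simple_graph G" and v: "v \<in> verts G" and U: "graph_ball G v k \<subseteq> U"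
    and "t \<le> k" and walk: "(v, y) \<in> edges G ^^ t"
  shows "(v, y) \<in> edges (induced G U) ^^ t"
  using \<open>t \<le> k\<close> walk
proof (induction t arbitrary: y)
  case (Suc t)
  then obtain z where z: "(v, z) \<in> edges G ^^ t" "(z, y) \<in> edges G" by auto
  have "joined_within G k v z" using z(1) Suc.prems(1) by (auto simp: joined_within_def intro: exI[of _ t])
  moreover have "joined_within G k v y"
    unfolding joined_within_def by (intro exI[of _ "Suc t"]) (use Suc.prems in blast)
  ultimately have "z \<in> U" "y \<in> U" using U mem_ball_iff[OF G v] by blast+
  then have "(z, y) \<in> edges (induced G U)" using z(2) by (simp add: induced_def)
  then show ?case using Suc z(1) by auto
qed simp

lemma simple_induced: "simple_graph G \<Longrightarrow> simple_graph (induced G U)"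
  by (auto simp: simple_graph_def induced_def sym_def irrefl_def)

text \<open>Walks of at most \<open>k\<close> edges from \<open>v\<close> never leave the ball, so
  they survive in every induced subgraph containing it. This allows a ball of \<open>G\<close> to be
  examined inside a finite subgraph.\<close>

lemma ball_induced:
  assumes G: "simple_graph G" and v: "v \<in> verts G" and U: "graph_ball G v k \<subseteq> U"
  shows "graph_ball (induced G U) v k = graph_ball G v k"
proof (intro equalityI subsetI)
  fix x assume "x \<in> graph_ball (induced G U) v k"
  then obtain t where "t \<le> k" "(v, x) \<in> edges (induced G U) ^^ t" "x \<in> verts G"
    by (auto simp: graph_ball_def joined_within_def induced_def)
  moreover have "edges (induced G U) ^^ t \<subseteq> edges G ^^ t" by (rule relpow_mono) (auto simp: induced_def)
  ultimately show "x \<in> graph_ball G v k" by (auto simp: graph_ball_def joined_within_def)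
next
  fix x assume x: "x \<in> graph_ball G v k"
  then obtain t where "t \<le> k" "(v, x) \<in> edges G ^^ t" by (auto simp: graph_ball_def joined_within_def)
  then show "x \<in> graph_ball (induced G U) v k"
    using induced_relpow[OF assms] x U by (auto simp: graph_ball_def joined_within_def induced_def)
qed

lemma ball_iso_induced:
  assumes G: "simple_graph G" and v: "v \<in> verts G" and U: "graph_ball G v k \<subseteq> U"
  shows "ball_iso k id G f v (induced G U) f v"
proof -
  have "v \<in> U" using centre_in_ball[OF v] U by blast
  then show ?thesis
    using v U unfolding ball_iso_def ball_induced[OF assms] by (auto simp: induced_def)
qed

lemma graph_iso_relpow:
  assumes "is_graph_iso \<phi> G H" "simple_graph G" "x \<in> verts G" "(x, y) \<in> edges G ^^ t"
  shows "(\<phi> x, \<phi> y) \<in> edges H ^^ t"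
  using assms(4)
proof (induction t arbitrary: y)
  case (Suc t)
  then obtain z where z: "(x, z) \<in> edges G ^^ t" "(z, y) \<in> edges G" by auto
  then have "z \<in> verts G" "y \<in> verts G" using assms(2) by (auto simp: simple_graph_def)
  then have "(\<phi> z, \<phi> y) \<in> edges H" using assms(1) z(2) by (simp add: is_graph_iso_def)
  then show ?case using Suc z(1) by auto
qed simp

lemma graph_iso_inv:
  assumes "is_graph_iso \<phi> G H"
  shows "is_graph_iso (inv_into (verts G) \<phi>) H G"
proof -
  have b: "bij_betw \<phi> (verts G) (verts H)" using assms by (simp add: is_graph_iso_def)
  have \<chi>: "inv_into (verts G) \<phi> x \<in> verts G \<and> \<phi> (inv_into (verts G) \<phi> x) = x" if "x \<in> verts H" for x
    using bij_betw_apply[OF bij_betw_inv_into[OF b] that] bij_betw_inv_into_right[OF b that] by simp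
  show ?thesis using assms bij_betw_inv_into[OF b] \<chi> unfolding is_graph_iso_def by metis
qed

lemma graph_iso_ball_iso:
  assumes iso: "is_graph_iso \<phi> G H" and G: "simple_graph G" and H: "simple_graph H" and v: "v \<in> verts G"
    and f: "\<And>x. x \<in> verts G \<Longrightarrow> g (\<phi> x) = f x"
  shows "ball_iso k \<phi> G f v H g (\<phi> v)"
proof -
  have b: "bij_betw \<phi> (verts G) (verts H)" using iso by (simp add: is_graph_iso_def)
  have v': "\<phi> v \<in> verts H" by (rule bij_betw_apply[OF b v])
  have "\<phi> ` graph_ball G v k = graph_ball H (\<phi> v) k"
  proof (intro equalityI subsetI)
    fix z assume "z \<in> \<phi> ` graph_ball G v k"
    then show "z \<in> graph_ball H (\<phi> v) k"
      using graph_iso_relpow[OF iso G v] bij_betw_apply[OF b] by (auto simp: graph_ball_def joined_within_def)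
  next
    fix z assume z: "z \<in> graph_ball H (\<phi> v) k"
    let ?x = "inv_into (verts G) \<phi> z"
    have x: "?x \<in> verts G" "\<phi> ?x = z" using z bij_betw_apply[OF bij_betw_inv_into[OF b]] bij_betw_inv_into_right[OF b]
      by (auto simp: graph_ball_def)
    have "joined_within G k v ?x"
      using z graph_iso_relpow[OF graph_iso_inv[OF iso] H v', of z] bij_betw_inv_into_left[OF b v]
      by (auto simp: graph_ball_def joined_within_def)
    then show "z \<in> \<phi> ` graph_ball G v k" using x by (force simp: graph_ball_def)
  qed
  moreover have "inj_on \<phi> (graph_ball G v k)"
    using b by (auto simp: bij_betw_def graph_ball_def intro: inj_on_subset)
  ultimately show ?thesis using v v' iso f
    unfolding ball_iso_def bij_betw_def is_graph_iso_def by (auto simp: graph_ball_def)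
qed

section \<open>The Lovasz Local Lemma and residual failure probabilities\<close>

lemma prob_pair_pmf:
  "measure_pmf.prob (pair_pmf P Q) S = measure_pmf.expectation P (\<lambda>x. measure_pmf.prob Q {y. (x, y) \<in> S})"
proof -
  have "emeasure (measure_pmf (pair_pmf P Q)) S = (\<integral>\<^sup>+ x. emeasure (measure_pmf Q) {y. (x, y) \<in> S} \<partial>measure_pmf P)"
  proof -
    have "pair_pmf P Q = P \<bind> (\<lambda>x. map_pmf (Pair x) Q)"
      by (simp add: pair_pmf_def map_pmf_def)
    then show ?thesis by (simp add: emeasure_bind_pmf vimage_def)
  qed
  also have "\<dots> = (\<integral>\<^sup>+ x. ennreal (measure_pmf.prob Q {y. (x, y) \<in> S}) \<partial>measure_pmf P)"
    by (simp add: measure_pmf.emeasure_eq_measure)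
  also have "\<dots> = ennreal (measure_pmf.expectation P (\<lambda>x. measure_pmf.prob Q {y. (x, y) \<in> S}))"
    by (intro nn_integral_eq_integral measure_pmf.integrable_const_bound[where B = 1]) auto
  finally show ?thesis
    by (simp add: measure_pmf.emeasure_eq_measure integral_nonneg_AE)
qed

lemma prob_pair_pmf_times:
  "measure_pmf.prob (pair_pmf P Q) (A \<times> B) = measure_pmf.prob P A * measure_pmf.prob Q B"
proof -
  have "measure_pmf.prob Q {y. (x, y) \<in> A \<times> B} = indicator A x * measure_pmf.prob Q B" for x
    by (auto simp: indicator_def)
  then show ?thesis by (simp add: prob_pair_pmf)
qed

definition depends_on :: "'a set \<Rightarrow> ('a \<Rightarrow> 'b) set \<Rightarrow> bool" where
  "depends_on S E \<longleftrightarrow> (\<forall>t t'. (\<forall>x\<in>S. t x = t' x) \<longrightarrow> (t \<in> E \<longleftrightarrow> t' \<in> E))"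

lemma depends_on_cong: "depends_on S E \<Longrightarrow> (\<And>x. x \<in> S \<Longrightarrow> t x = t' x) \<Longrightarrow> t \<in> E \<longleftrightarrow> t' \<in> E"
  unfolding depends_on_def by blast

text \<open>The product distribution splits into the coordinates in \<open>S\<close> and the others,
  and \<open>A \<inter> B\<close> becomes a rectangle.\<close>

lemma prob_Pi_pmf_Int:
  assumes C: "finite C" and S: "S \<subseteq> C" and disj: "S \<inter> S' = {}" "S' \<subseteq> C"
    and A: "depends_on S A" and B: "depends_on S' B"
  shows "measure_pmf.prob (Pi_pmf C z p) (A \<inter> B) =
         measure_pmf.prob (Pi_pmf C z p) A * measure_pmf.prob (Pi_pmf C z p) B"
proof -
  let ?h = "\<lambda>(f, g) x. if x \<in> S then f x else g x"
  let ?P1 = "Pi_pmf S z p" and ?P2 = "Pi_pmf (C - S) z p"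
  have fin: "finite S" using finite_subset[OF S C] .
  have eq: "Pi_pmf C z p = map_pmf ?h (pair_pmf ?P1 ?P2)"
    using Pi_pmf_union[of S "C - S" z p] S C fin by (simp add: Un_absorb1)
  have *: "measure_pmf.prob (Pi_pmf C z p) (A' \<inter> B') = measure_pmf.prob ?P1 A' * measure_pmf.prob ?P2 B'"
    if "depends_on S A'" "depends_on S' B'" for A' B'
  proof -
    have "?h (f, g) \<in> A' \<longleftrightarrow> f \<in> A'" for f g by (rule depends_on_cong[OF that(1)]) simp
    moreover have "?h (f, g) \<in> B' \<longleftrightarrow> g \<in> B'" for f g
      by (rule depends_on_cong[OF that(2)]) (use disj in auto)
    ultimately have "?h -` (A' \<inter> B') = A' \<times> B'" by auto
    then show ?thesis unfolding eq measure_map_pmf by (simp add: prob_pair_pmf_times)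
  qed
  have U: "depends_on X UNIV" for X :: "'a set" by (simp add: depends_on_def)
  \<comment> \<open>Replacing one event by \<open>UNIV\<close> identifies each factor with a
    probability in the whole product.\<close>
  from *[OF A B] *[OF A U] *[OF U B] show ?thesis by (simp add: Int_commute)
qed

lemma depends_on_Inter_Compl:
  fixes E :: "'i \<Rightarrow> ('a \<Rightarrow> 'b) set"
  assumes "\<And>j. j \<in> J \<Longrightarrow> depends_on (S j) (E j)"
  shows "depends_on (\<Union>j\<in>J. S j) {t. \<forall>j\<in>J. t \<notin> E j}"
  unfolding depends_on_def
proof (intro allI impI)
  fix t t' :: "'a \<Rightarrow> 'b"
  assume t: "\<forall>x\<in>\<Union>j\<in>J. S j. t x = t' x"
  have "t \<in> E j \<longleftrightarrow> t' \<in> E j" if "j \<in> J" for j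
    by (rule depends_on_cong[OF assms[OF that]]) (use t that in blast)
  then show "t \<in> {t. \<forall>j\<in>J. t \<notin> E j} \<longleftrightarrow> t' \<in> {t. \<forall>j\<in>J. t \<notin> E j}" by blast
qed

text \<open>The usual induction bounds by \<open>2 * q\<close> the conditional probability of
  \<open>E i\<close> given that no event of \<open>J\<close> occurs. It is multiplied out in
  \<open>main\<close>, so that positivity of the condition can be shown afterwards.\<close>

theorem lovasz_local_lemma_Pi_pmf:
  fixes z :: 'b and D :: nat
  assumes C: "finite C" and I: "finite I" and S: "\<And>i. i \<in> I \<Longrightarrow> S i \<subseteq> C"
    and dep: "\<And>i. i \<in> I \<Longrightarrow> depends_on (S i) (E i)"
    and q: "\<And>i. i \<in> I \<Longrightarrow> measure_pmf.prob (Pi_pmf C z p) (E i) \<le> q"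
    and D: "\<And>i. i \<in> I \<Longrightarrow> card {j \<in> I. S j \<inter> S i \<noteq> {}} \<le> D" and "1 \<le> D" and "4 * q * D \<le> 1" "0 \<le> q"
  shows "\<exists>t\<in>set_pmf (Pi_pmf C z p). \<forall>i\<in>I. t \<notin> E i"
proof -
  let ?P = "measure_pmf.prob (Pi_pmf C z p)"
  define N where "N J = {t. \<forall>j\<in>J. t \<notin> E j}" for J
  have q4: "4 * q \<le> 1"
  proof -
    have "4 * q * 1 \<le> 4 * q * D" by (rule mult_left_mono) (use \<open>1 \<le> D\<close> \<open>0 \<le> q\<close> in auto)
    then show ?thesis using \<open>4 * q * D \<le> 1\<close> by simp
  qed
  have main: "?P (E i \<inter> N J) \<le> 2 * q * ?P (N J)" if "J \<subseteq> I" "i \<in> I - J" for i J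
    using that
  proof (induction "card J" arbitrary: i J rule: less_induct)
    case less
    have fJ: "finite J" using less.prems(1) I by (rule finite_subset)
    define J1 where "J1 = {j \<in> J. S j \<inter> S i \<noteq> {}}"
    define J2 where "J2 = J - J1"
    have J: "J = J1 \<union> J2" "J1 \<subseteq> J" "J2 \<subseteq> J" "finite J1" using fJ by (auto simp: J1_def J2_def)
    have N: "N J \<subseteq> N J2" using J by (auto simp: N_def)
    have ind: "?P (E i \<inter> N J2) = ?P (E i) * ?P (N J2)"
    proof (rule prob_Pi_pmf_Int[OF C, of "S i" "\<Union>j\<in>J2. S j"])
      show "S i \<subseteq> C" "depends_on (S i) (E i)" using S dep less.prems by auto
      show "S i \<inter> (\<Union>j\<in>J2. S j) = {}" by (auto simp: J1_def J2_def)
      show "(\<Union>j\<in>J2. S j) \<subseteq> C" using S less.prems J by blast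
      show "depends_on (\<Union>j\<in>J2. S j) (N J2)"
        unfolding N_def by (rule depends_on_Inter_Compl) (use dep less.prems J in blast)
    qed
    \<comment> \<open>Given \<open>N J2\<close>, the at most \<open>D\<close> events of
      \<open>J1\<close> have total probability at most \<open>2 * q * D \<le> 1/2\<close>, so
      avoiding them as well loses at most half.\<close>
    have half: "?P (N J2) \<le> 2 * ?P (N J)"
    proof (cases "J1 = {}")
      case True
      then show ?thesis using J by simp
    next
      case False
      have "J2 \<subset> J" using False J by (auto simp: J2_def)
      then have lt: "card J2 < card J" using fJ by (rule psubset_card_mono[rotated])
      have "N J2 \<subseteq> N J \<union> (\<Union>j\<in>J1. E j \<inter> N J2)" using J(1) by (auto simp: N_def)
      then have "?P (N J2) \<le> ?P (N J \<union> (\<Union>j\<in>J1. E j \<inter> N J2))"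
        by (intro measure_pmf.finite_measure_mono) auto
      also have "\<dots> \<le> ?P (N J) + ?P (\<Union>j\<in>J1. E j \<inter> N J2)"
        by (intro measure_Un_le) auto
      also have "?P (\<Union>j\<in>J1. E j \<inter> N J2) \<le> (\<Sum>j\<in>J1. ?P (E j \<inter> N J2))"
        by (intro measure_UNION_le) (use J(4) in auto)
      also have "\<dots> \<le> (\<Sum>j\<in>J1. 2 * q * ?P (N J2))"
      proof (rule sum_mono)
        fix j assume "j \<in> J1"
        then have "J2 \<subseteq> I" "j \<in> I - J2" using less.prems J(2,3) by (auto simp: J2_def)
        then show "?P (E j \<inter> N J2) \<le> 2 * q * ?P (N J2)" by (rule less.hyps[OF lt])
      qed
      also have "\<dots> = (2 * q * card J1) * ?P (N J2)" by simp
      also have "\<dots> \<le> 1 / 2 * ?P (N J2)"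
      proof (rule mult_right_mono)
        have "card J1 \<le> card {j \<in> I. S j \<inter> S i \<noteq> {}}"
          using less.prems I by (intro card_mono) (auto simp: J1_def)
        also have "\<dots> \<le> D" using D less.prems by blast
        finally have "4 * q * card J1 \<le> 4 * q * D" using \<open>0 \<le> q\<close> by (intro mult_left_mono) auto
        then show "2 * q * card J1 \<le> 1 / 2" using \<open>4 * q * D \<le> 1\<close> by linarith
      qed simp
      finally show ?thesis by simp
    qed
    have "?P (E i \<inter> N J) \<le> ?P (E i \<inter> N J2)" using N by (intro measure_pmf.finite_measure_mono) auto
    also have "\<dots> \<le> q * (2 * ?P (N J))"
      unfolding ind using q[of i] half less.prems \<open>0 \<le> q\<close> by (intro mult_mono) auto
    finally show ?case by simp
  qed
  \<comment> \<open>Each further event removes at most the fraction \<open>2 * q \<le> 1/2\<close>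
    of what is left.\<close>
  have pos: "0 < ?P (N J)" if "J \<subseteq> I" for J
    using finite_subset[OF that I] that
  proof (induction J rule: finite_induct)
    case empty
    then show ?case by (simp add: N_def)
  next
    case (insert i J)
    have "N J \<subseteq> N (insert i J) \<union> (E i \<inter> N J)" by (auto simp: N_def)
    then have "?P (N J) \<le> ?P (N (insert i J) \<union> (E i \<inter> N J))" by (intro measure_pmf.finite_measure_mono) auto
    also have "\<dots> \<le> ?P (N (insert i J)) + ?P (E i \<inter> N J)"
      by (intro measure_Un_le) auto
    also have "?P (E i \<inter> N J) \<le> 2 * q * ?P (N J)" using insert by (intro main) auto
    also have "2 * q * ?P (N J) \<le> 1 / 2 * ?P (N J)" using q4 by (intro mult_right_mono) auto
    finally have "?P (N J) \<le> 2 * ?P (N (insert i J))" by simp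
    then show ?case using insert by simp
  qed
  have "\<not> set_pmf (Pi_pmf C z p) \<inter> N I = {}"
    using pos[OF order_refl] measure_pmf_zero_iff[of "Pi_pmf C z p" "N I"] by auto
  then show ?thesis by (auto simp: N_def)
qed

section \<open>Residual failure probabilities\<close>

abbreviation unif :: "nat \<Rightarrow> 'a \<Rightarrow> nat pmf" where
  "unif l \<equiv> \<lambda>_. pmf_of_set {..<l}"

text \<open>Labels \<open>\<ge> l\<close> stand for vertices whose random label has not been revealed yet; \<open>residual_prob\<close> is the
  probability of the event \<open>B\<close> at \<open>v\<close> conditioned on the revealed labels.\<close>

definition fill :: "nat \<Rightarrow> ('a \<Rightarrow> nat) \<Rightarrow> ('a \<Rightarrow> nat) \<Rightarrow> 'a \<Rightarrow> nat" where
  "fill l f t u = (if f u < l then f u else t u)"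

definition residual_prob :: "nat \<Rightarrow> nat \<Rightarrow> 'a ugraph \<Rightarrow> (('a \<Rightarrow> nat) \<Rightarrow> 'a \<Rightarrow> bool) \<Rightarrow> ('a \<Rightarrow> nat) \<Rightarrow> 'a \<Rightarrow> real" where
  "residual_prob l k G B f v = measure_pmf.prob (Pi_pmf (graph_ball G v k) 0 (unif l)) {t. B (fill l f t) v}"

text \<open>Coordinates outside the ball integrate out. Residual probabilities can therefore be
  computed over any finite set containing the ball, in particular over one that also contains the
  vertices being revealed.\<close>

lemma residual_prob_superset:
  assumes W: "finite W" "graph_ball G v k \<subseteq> W"
    and loc: "\<And>f g. (\<And>x. x \<in> graph_ball G v k \<Longrightarrow> f x = g x) \<Longrightarrow> B f v \<longleftrightarrow> B g v"
  shows "residual_prob l k G B f v = measure_pmf.prob (Pi_pmf W 0 (unif l)) {t. B (fill l f t) v}"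
proof -
  have "B (fill l f (\<lambda>x. if x \<in> graph_ball G v k then t x else 0)) v \<longleftrightarrow> B (fill l f t) v" for t
    by (rule loc) (simp add: fill_def)
  then show ?thesis
    unfolding residual_prob_def Pi_pmf_subset[OF W] measure_map_pmf by (simp add: vimage_def)
qed

lemma Pi_pmf_unif: "finite W \<Longrightarrow> 0 < l \<Longrightarrow> Pi_pmf W z (unif l) = pmf_of_set (PiE_dflt W z (\<lambda>_. {..<l}))"
  by (rule Pi_pmf_of_set) auto

lemma Pi_pmf_reindex:
  assumes b: "bij_betw \<psi> W W'" and W: "finite W" "0 < l"
  shows "Pi_pmf W 0 (unif l) = map_pmf (\<lambda>t x. if x \<in> W then t (\<psi> x) else 0) (Pi_pmf W' 0 (unif l))"
proof -
  let ?\<chi> = "inv_into W \<psi>" and ?X = "\<lambda>W. PiE_dflt W 0 (\<lambda>_. {..<l})"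
  have W': "finite W'" using b W(1) bij_betw_finite by blast
  have \<chi>: "?\<chi> x \<in> W" "\<psi> (?\<chi> x) = x" if "x \<in> W'" for x
    using bij_betw_apply[OF bij_betw_inv_into[OF b] that] bij_betw_inv_into_right[OF b that] by auto
  have \<psi>: "\<psi> x \<in> W'" "?\<chi> (\<psi> x) = x" if "x \<in> W" for x
    using bij_betw_apply[OF b that] bij_betw_inv_into_left[OF b that] by auto
  have "bij_betw (\<lambda>t x. if x \<in> W then t (\<psi> x) else 0) (?X W') (?X W)"
    by (rule bij_betwI[where g = "\<lambda>t x. if x \<in> W' then t (?\<chi> x) else 0"])
      (auto simp: PiE_dflt_def fun_eq_iff \<chi> \<psi>)
  then have "map_pmf (\<lambda>t x. if x \<in> W then t (\<psi> x) else 0) (pmf_of_set (?X W')) = pmf_of_set (?X W)"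
    by (rule map_pmf_of_set_bij_betw) (use W W' in \<open>auto simp: PiE_dflt_empty_iff finite_PiE_dflt\<close>)
  then show ?thesis using W W' by (simp add: Pi_pmf_unif)
qed

text \<open>Fresh labels are carried along \<open>\<psi>\<close>, and filling commutes with this.
  The lemma serves twice: it moves the failure bound from finite members of the class to
  \<open>G\<close>, and it makes sets defined by residual probabilities Borel through
  \<open>invariant_sets\<close>.\<close>

lemma residual_prob_iso:
  assumes iso: "ball_iso k \<psi> G f v H g w" and fin: "finite (graph_ball G v k)" and "0 < l"
    and inv: "\<And>f g. ball_iso k \<psi> G f v H g w \<Longrightarrow> B f v \<longleftrightarrow> B' g w"
  shows "residual_prob l k G B f v = residual_prob l k H B' g w"
proof -
  let ?W = "graph_ball G v k" and ?W' = "graph_ball H w k"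
  have b: "bij_betw \<psi> ?W ?W'" using iso by (simp add: ball_iso_def)
  have "B (fill l f (\<lambda>x. if x \<in> ?W then t (\<psi> x) else 0)) v \<longleftrightarrow> B' (fill l g t) w" for t
    by (rule inv) (use iso in \<open>auto simp: ball_iso_def fill_def\<close>)
  then show ?thesis
    unfolding residual_prob_def Pi_pmf_reindex[OF b fin \<open>0 < l\<close>] measure_map_pmf by (simp add: vimage_def)
qed

text \<open>Markov's inequality applied to the conditional probability after revealing the labels on \<open>C\<close>.\<close>

lemma residual_prob_reveal:
  assumes C: "finite C" and fin: "finite (graph_ball G v k)" and "0 < p'" "0 < l"
    and loc: "\<And>f g. (\<And>x. x \<in> graph_ball G v k \<Longrightarrow> f x = g x) \<Longrightarrow> B f v \<longleftrightarrow> B g v"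
  shows "measure_pmf.prob (Pi_pmf C 0 (unif l))
      {t. p' < residual_prob l k G B (\<lambda>u. if u \<in> C then fill l f t u else f u) v} \<le> residual_prob l k G B f v / p'"
proof -
  define W where "W = graph_ball G v k \<union> C"
  let ?P1 = "Pi_pmf C 0 (unif l)" and ?P2 = "Pi_pmf (W - C) 0 (unif l)"
  let ?h = "\<lambda>(s, t) x. if x \<in> C then s x else t x :: nat"
  define ft where "ft t u = (if u \<in> C then fill l f t u else f u)" for t u
  have W: "finite W" "graph_ball G v k \<subseteq> W" using C fin by (auto simp: W_def)
  have W_eq: "W = C \<union> (W - C)" by (auto simp: W_def)
  have eq: "Pi_pmf W 0 (unif l) = map_pmf ?h (pair_pmf ?P1 ?P2)"
    by (subst W_eq, rule Pi_pmf_union) (use W C in auto)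
  have W_prob: "residual_prob l k G B f' v = measure_pmf.prob (Pi_pmf W 0 (unif l)) {t. B (fill l f' t) v}" for f'
    by (rule residual_prob_superset[where B = B, OF W]) (rule loc)
  \<comment> \<open>On \<open>C\<close> the labels of \<open>ft s\<close> are below
    \<open>l\<close>, so \<open>fill\<close> reads no fresh labels there; only the coordinates in
    \<open>W - C\<close> remain random.\<close>
  have step: "residual_prob l k G B (ft s) v = measure_pmf.prob ?P2 {t. B (fill l f (?h (s, t))) v}"
    if s: "s \<in> set_pmf ?P1" for s
  proof -
    have sl: "s x < l" if "x \<in> C" for x
      using s that C \<open>0 < l\<close> by (auto simp: set_Pi_pmf PiE_dflt_def set_pmf_of_set lessThan_empty_iff)
    have "residual_prob l k G B (ft s) v = measure_pmf.prob (Pi_pmf W 0 (unif l)) {t. B (fill l (ft s) t) v}"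
      by (rule W_prob)
    also have "\<dots> = measure_pmf.prob (pair_pmf ?P1 ?P2) {x. B (fill l (ft s) (?h x)) v}"
      unfolding eq measure_map_pmf by (simp add: vimage_def)
    also have "{x. B (fill l (ft s) (?h x)) v} = UNIV \<times> {t. B (fill l f (?h (s, t))) v}"
    proof -
      have "fill l (ft s) (?h (a, b)) = fill l f (?h (s, b))" for a b
        using sl by (auto simp: fun_eq_iff fill_def ft_def)
      then show ?thesis by auto
    qed
    finally show ?thesis by (simp add: prob_pair_pmf_times)
  qed
  have "residual_prob l k G B f v = measure_pmf.prob (pair_pmf ?P1 ?P2) {x. B (fill l f (?h x)) v}"
    unfolding W_prob eq measure_map_pmf by (simp add: vimage_def)
  also have "\<dots> = measure_pmf.expectation ?P1 (\<lambda>s. measure_pmf.prob ?P2 {t. B (fill l f (?h (s, t))) v})"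
    by (simp add: prob_pair_pmf)
  also have "\<dots> = measure_pmf.expectation ?P1 (\<lambda>s. residual_prob l k G B (ft s) v)"
    by (rule integral_cong_AE) (auto simp: AE_measure_pmf_iff step)
  finally have eq2: "residual_prob l k G B f v = measure_pmf.expectation ?P1 (\<lambda>s. residual_prob l k G B (ft s) v)" .
  have "measure_pmf.prob ?P1 {t. p' < residual_prob l k G B (ft t) v} \<le>
      measure_pmf.prob ?P1 {t \<in> space ?P1. p' \<le> residual_prob l k G B (ft t) v}"
    by (intro measure_pmf.finite_measure_mono) auto
  also have "\<dots> \<le> measure_pmf.expectation ?P1 (\<lambda>s. residual_prob l k G B (ft s) v) / p'"
    by (rule integral_Markov_inequality_measure[where A = "{}"])
      (auto simp: residual_prob_def \<open>0 < p'\<close> intro!: measure_pmf.integrable_const_bound[where B = 1])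
  finally show ?thesis unfolding eq2 by (simp add: ft_def[abs_def])
qed

section \<open>Borel combinatorics of bounded degree graphs\<close>

lemma sets_Collect_set_eq:
  fixes S :: "'a \<Rightarrow> 'p::countable set"
  assumes "\<And>p. {v \<in> space M. p \<in> S v} \<in> sets M"
  shows "{v \<in> space M. S v = A} \<in> sets M"
proof -
  have "{v \<in> space M. p \<in> S v \<longleftrightarrow> p \<in> A} \<in> sets M" for p
    using assms[of p] sets.sets_Collect_neg[OF assms[of p]] by (cases "p \<in> A") simp_all
  then have "{v \<in> space M. \<forall>p. p \<in> S v \<longleftrightarrow> p \<in> A} \<in> sets M"
    by (rule sets.sets_Collect_countable_All)
  then show ?thesis by (simp add: set_eq_iff)
qed

locale bounded_borel_graph =
  fixes M :: "'a measure" and G :: "'a ugraph" and d :: nat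
  assumes borel: "borel_graph M G"
    and degree: "u \<in> verts G \<Longrightarrow> finite {w. (u, w) \<in> edges G} \<and> card {w. (u, w) \<in> edges G} \<le> d"
begin

lemma simple: "simple_graph G" and verts_eq: "verts G = space M" and standard: "standard_borel_space M"
  and edges_sets: "edges G \<in> sets (M \<Otimes>\<^sub>M M)"
  using borel by (auto simp: borel_graph_def)

lemma finite_ball: "v \<in> space M \<Longrightarrow> finite (graph_ball G v k)"
  and card_ball: "v \<in> space M \<Longrightarrow> card (graph_ball G v k) \<le> (d + 1) ^ k"
  using finite_card_ball[OF simple _ degree] verts_eq by auto

section \<open>Borel neighbourhoods of Borel sets\<close>

definition near :: "nat \<Rightarrow> 'a set \<Rightarrow> 'a set" where
  "near k B = {x \<in> space M. \<exists>y\<in>B. joined_within G k x y}"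

lemma nbrs_sets:
  assumes B: "B \<in> sets M"
  shows "{x \<in> space M. \<exists>y\<in>B. (x, y) \<in> edges G} \<in> sets M"
proof -
  let ?E = "edges G \<inter> space M \<times> B"
  have "{x \<in> space M. \<exists>y. (x, y) \<in> ?E} \<in> sets M"
  proof (rule borel_projection_bounded_sections[OF standard, where d = d])
    show "?E \<in> sets (M \<Otimes>\<^sub>M M)" using edges_sets B by auto
    fix x assume x: "x \<in> space M"
    have sub: "{y. (x, y) \<in> ?E} \<subseteq> {y. (x, y) \<in> edges G}" by auto
    have deg: "finite {y. (x, y) \<in> edges G}" "card {y. (x, y) \<in> edges G} \<le> d"
      using degree x verts_eq by auto
    show "finite {y. (x, y) \<in> ?E}" by (rule finite_subset[OF sub deg(1)])
    show "card {y. (x, y) \<in> ?E} \<le> d" using card_mono[OF deg(1) sub] deg(2) by simp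
  qed
  also have "{x \<in> space M. \<exists>y. (x, y) \<in> ?E} = {x \<in> space M. \<exists>y\<in>B. (x, y) \<in> edges G}" by auto
  finally show ?thesis .
qed

lemma near_sets: "B \<in> sets M \<Longrightarrow> near k B \<in> sets M"
proof (induction k arbitrary: B)
  case 0
  have "near 0 B = B" using sets.sets_into_space[OF 0] by (auto simp: near_def joined_within_def)
  then show ?case using 0 by simp
next
  case (Suc k)
  let ?N = "{x \<in> space M. \<exists>y\<in>B. (x, y) \<in> edges G}"
  have "near (Suc k) B = near k B \<union> near k ?N"
  proof -
    have "w \<in> space M" if "x \<in> space M" "joined_within G k x w" for x w
      using joined_within_verts[OF simple _ that(2)] that(1) verts_eq by simp
    then show ?thesis unfolding near_def joined_within_Suc by blast
  qed
  then show ?case using Suc.IH[OF Suc.prems] Suc.IH[OF nbrs_sets[OF Suc.prems]] by simp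
qed

section \<open>Borel names of vertices and candidate labelings\<close>

definition baire_code :: "'a \<Rightarrow> baire" where
  "baire_code = (SOME \<phi>. inj_on \<phi> (space M) \<and> \<phi> \<in> borel_measurable M)"

lemma inj_code: "inj_on baire_code (space M)" and code_measurable: "baire_code \<in> borel_measurable M"
proof -
  have "\<exists>\<phi> :: 'a \<Rightarrow> baire. inj_on \<phi> (space M) \<and> \<phi> \<in> borel_measurable M"
    using standard_borel_space_code[OF standard] by metis
  from someI_ex[OF this] show "inj_on baire_code (space M)" "baire_code \<in> borel_measurable M"
    unfolding baire_code_def by auto
qed

text \<open>Prefixes take only countably many values; their cells are Borel, become finer as
  \<open>n\<close> grows, and together separate points.\<close>

definition code_prefix :: "nat \<Rightarrow> 'a \<Rightarrow> nat list" where
  "code_prefix n x = map (baire_code x) [0..<n]"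

lemma length_code_prefix [simp]: "length (code_prefix n x) = n"
  by (simp add: code_prefix_def)

lemma take_code_prefix: "m \<le> n \<Longrightarrow> take m (code_prefix n x) = code_prefix m x"
  by (simp add: code_prefix_def take_map)

lemma code_prefix_sets: "{x \<in> space M. code_prefix n x = s} \<in> sets M"
proof -
  have c: "{x \<in> space M. baire_code x i = q} \<in> sets M" for i q
    using measurable_sets[OF code_measurable borel_open[OF open_coordinate[of i q]]]
    by (simp add: vimage_def Int_def conj_commute)
  have "{x \<in> space M. length s = n \<and> (\<forall>i\<in>{..<n}. baire_code x i = s ! i)} \<in> sets M"
    by (intro sets.sets_Collect sets.sets_Collect_finite_All c) auto
  also have "{x \<in> space M. length s = n \<and> (\<forall>i\<in>{..<n}. baire_code x i = s ! i)} = {x \<in> space M. code_prefix n x = s}"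
    by (auto simp: code_prefix_def list_eq_iff_nth_eq)
  finally show ?thesis .
qed

lemma code_prefix_separates:
  assumes "finite C" "C \<subseteq> space M"
  shows "\<exists>n. inj_on (code_prefix n) C"
proof -
  have "\<exists>p. baire_code x p \<noteq> baire_code y p" if "x \<in> C" "y \<in> C" "x \<noteq> y" for x y
    using inj_onD[OF inj_code, of x y] that assms(2) by (auto simp: fun_eq_iff)
  then obtain p where p: "\<And>x y. x \<in> C \<Longrightarrow> y \<in> C \<Longrightarrow> x \<noteq> y \<Longrightarrow> baire_code x (p x y) \<noteq> baire_code y (p x y)" by metis
  have "finite ((\<lambda>(x, y). p x y) ` (C \<times> C))" using assms(1) by simp
  then obtain n where n: "\<And>x y. x \<in> C \<Longrightarrow> y \<in> C \<Longrightarrow> p x y < n"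
    unfolding finite_nat_set_iff_bounded by force
  have "inj_on (code_prefix n) C"
  proof (rule inj_onI, rule ccontr)
    fix x y assume xy: "x \<in> C" "y \<in> C" "code_prefix n x = code_prefix n y" "x \<noteq> y"
    then have "code_prefix n x ! p x y = code_prefix n y ! p x y" by simp
    then show False using n[OF xy(1,2)] p[OF xy(1,2,4)] by (simp add: code_prefix_def)
  qed
  then show ?thesis ..
qed

definition clash :: "nat \<Rightarrow> nat \<Rightarrow> 'a set" where
  "clash k n = {x \<in> space M. \<exists>y. joined_within G k x y \<and> y \<noteq> x \<and> code_prefix n y = code_prefix n x}"

text \<open>That \<open>y\<close> differs from \<open>x\<close> is witnessed by a longer prefix, so that only countably many
  sets of the form \<open>near k B\<close> are involved.\<close>

lemma clash_sets: "clash k n \<in> sets M"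
proof -
  let ?cell = "\<lambda>t. {x \<in> space M. code_prefix (length t) x = t}"
  let ?J = "{(t, t'). t \<noteq> t' \<and> length t = length t' \<and> n \<le> length t \<and> take n t = take n t'}"
  have "(\<Union>(t, t')\<in>?J. ?cell t \<inter> near k (?cell t')) \<in> sets M"
    by (intro sets.countable_UN'') (auto intro!: sets.Int near_sets code_prefix_sets)
  moreover have "clash k n = (\<Union>(t, t')\<in>?J. ?cell t \<inter> near k (?cell t'))"
  proof (intro equalityI subsetI)
    fix x assume "x \<in> clash k n"
    then obtain y where x: "x \<in> space M" and y: "joined_within G k x y" "y \<noteq> x" "code_prefix n y = code_prefix n x"
      by (auto simp: clash_def)
    have yM: "y \<in> space M" using joined_within_verts[OF simple _ y(1)] x verts_eq by simp
    obtain m where m: "inj_on (code_prefix m) {x, y}" using code_prefix_separates[of "{x, y}"] x yM by auto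
    let ?m = "max m n"
    have "code_prefix ?m x \<noteq> code_prefix ?m y"
    proof
      assume "code_prefix ?m x = code_prefix ?m y"
      then have "code_prefix m x = code_prefix m y" using take_code_prefix[of m ?m] by (metis max.cobounded1)
      then show False using m y(2) by (auto simp: inj_on_def)
    qed
    then have "(code_prefix ?m x, code_prefix ?m y) \<in> ?J" using y(3) by (auto simp: take_code_prefix)
    moreover have "x \<in> ?cell (code_prefix ?m x) \<inter> near k (?cell (code_prefix ?m y))"
      using x yM y(1) by (auto simp: near_def)
    ultimately show "x \<in> (\<Union>(t, t')\<in>?J. ?cell t \<inter> near k (?cell t'))" by blast
  next
    fix x assume "x \<in> (\<Union>(t, t')\<in>?J. ?cell t \<inter> near k (?cell t'))"
    then obtain t t' where t: "(t, t') \<in> ?J" "x \<in> ?cell t" "x \<in> near k (?cell t')" by blast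
    then obtain y where y: "joined_within G k x y" "code_prefix (length t') y = t'" by (auto simp: near_def)
    have "code_prefix n y = code_prefix n x"
      using t y take_code_prefix[of n "length t" x] take_code_prefix[of n "length t'" y] by auto
    moreover have "y \<noteq> x" using t y by auto
    ultimately show "x \<in> clash k n" using t y by (auto simp: clash_def)
  qed
  ultimately show ?thesis by simp
qed

text \<open>The shortest prefix that tells \<open>x\<close> apart from every other vertex within
  distance \<open>k\<close>. It is a proper Borel colouring of the power \<open>k\<close> of
  \<open>G\<close> with countably many colours.\<close>

definition name :: "nat \<Rightarrow> 'a \<Rightarrow> nat list" where
  "name k x = code_prefix (LEAST n. x \<notin> clash k n) x"

lemma not_clash:
  assumes "x \<in> space M"
  shows "\<exists>n. x \<notin> clash k n"
proof -
  have "graph_ball G x k \<subseteq> space M" using verts_eq by (auto simp: graph_ball_def)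
  then obtain n where n: "inj_on (code_prefix n) (graph_ball G x k)"
    using code_prefix_separates[OF finite_ball[OF assms]] by blast
  have "x \<notin> clash k n"
  proof
    assume "x \<in> clash k n"
    then obtain y where y: "joined_within G k x y" "y \<noteq> x" "code_prefix n y = code_prefix n x" by (auto simp: clash_def)
    moreover have "y \<in> graph_ball G x k" "x \<in> graph_ball G x k"
      using mem_ball_iff[OF simple] assms verts_eq y(1) by auto
    ultimately show False using n by (auto simp: inj_on_def)
  qed
  then show ?thesis ..
qed

text \<open>Equal names have equal length, so both vertices stop at the same level, where
  \<open>x\<close> would still clash with \<open>y\<close>.\<close>

lemma name_inj:
  assumes "x \<in> space M" "joined_within G k x y" "name k x = name k y"
  shows "x = y"
proof (rule ccontr)
  assume "x \<noteq> y"
  let ?n = "LEAST n. x \<notin> clash k n"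
  have "?n = (LEAST n. y \<notin> clash k n)" using arg_cong[OF assms(3), of length] by (simp add: name_def)
  then have "code_prefix ?n y = code_prefix ?n x" using assms(3) by (simp add: name_def)
  then have "x \<in> clash k ?n" using assms \<open>x \<noteq> y\<close> by (auto simp: clash_def)
  moreover have "x \<notin> clash k ?n" by (rule LeastI_ex[OF not_clash[OF assms(1)]])
  ultimately show False by blast
qed

lemma name_sets: "{x \<in> space M. name k x = s} \<in> sets M"
proof -
  have "{x \<in> space M. code_prefix (length s) x = s \<and> x \<notin> clash k (length s) \<and> (\<forall>m\<in>{..<length s}. x \<in> clash k m)} \<in> sets M"
    by (intro sets.sets_Collect sets.sets_Collect_finite_All code_prefix_sets)
      (use clash_sets sets.sets_into_space[OF clash_sets] in \<open>auto simp: Collect_conj_eq2[symmetric] Int_absorb1 Int_def[symmetric]\<close>)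
  moreover have "name k x = s \<longleftrightarrow> code_prefix (length s) x = s \<and> x \<notin> clash k (length s) \<and> (\<forall>m\<in>{..<length s}. x \<in> clash k m)"
    if x: "x \<in> space M" for x
  proof -
    have L: "(LEAST n. x \<notin> clash k n) = length s \<longleftrightarrow> x \<notin> clash k (length s) \<and> (\<forall>m\<in>{..<length s}. x \<in> clash k m)"
      (is "?l = _ \<longleftrightarrow> _")
    proof
      assume e: "?l = length s"
      have "x \<notin> clash k ?l" by (rule LeastI_ex[OF not_clash[OF x]])
      moreover have "x \<in> clash k m" if "m < ?l" for m using not_less_Least[OF that] by blast
      ultimately show "x \<notin> clash k (length s) \<and> (\<forall>m\<in>{..<length s}. x \<in> clash k m)"
        unfolding e by simp
    next
      assume *: "x \<notin> clash k (length s) \<and> (\<forall>m\<in>{..<length s}. x \<in> clash k m)"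
      show "?l = length s"
      proof (rule Least_equality)
        show "length s \<le> m" if "x \<notin> clash k m" for m using * that by (meson lessThan_iff not_less)
      qed (use * in blast)
    qed
    have "name k x = s \<longleftrightarrow> ?l = length s \<and> code_prefix (length s) x = s"
    proof
      assume "name k x = s"
      then show "?l = length s \<and> code_prefix (length s) x = s"
        unfolding name_def by (metis length_code_prefix)
    qed (simp add: name_def)
    then show ?thesis using L by blast
  qed
  then have "{x \<in> space M. name k x = s} =
     {x \<in> space M. code_prefix (length s) x = s \<and> x \<notin> clash k (length s) \<and> (\<forall>m\<in>{..<length s}. x \<in> clash k m)}"
    by blast
  ultimately show ?thesis by simp
qed

text \<open>The index \<open>j\<close> encodes a prefix length and a finite table from prefixes to
  labels; prefixes missing from the table get the default label 0. For positive \<open>l\<close>,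
  reduction modulo \<open>l\<close> makes every table legal and leaves labels below \<open>l\<close>
  unchanged.\<close>

definition candidate :: "nat \<Rightarrow> nat \<Rightarrow> 'a \<Rightarrow> nat" where
  "candidate l j x = (case from_nat j :: nat \<times> (nat list \<times> nat) list of (n, m) \<Rightarrow>
     (case map_of m (code_prefix n x) of None \<Rightarrow> 0 | Some i \<Rightarrow> i mod l))"

lemma candidate_less: "0 < l \<Longrightarrow> candidate l j x < l"
  by (auto simp: candidate_def split: prod.split option.split)

lemma candidate_sets: "{x \<in> space M. candidate l j x = i} \<in> sets M"
proof -
  obtain n m where nm: "(from_nat j :: nat \<times> (nat list \<times> nat) list) = (n, m)" by fastforce
  let ?S = "{s. (case map_of m s of None \<Rightarrow> 0 | Some i \<Rightarrow> i mod l) = i}"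
  have "(\<Union>s\<in>?S. {x \<in> space M. code_prefix n x = s}) \<in> sets M"
    by (intro sets.countable_UN'' code_prefix_sets) auto
  moreover have "(\<Union>s\<in>?S. {x \<in> space M. code_prefix n x = s}) = {x \<in> space M. candidate l j x = i}"
    by (auto simp: candidate_def nm)
  ultimately show ?thesis by simp
qed

text \<open>At a prefix length that separates the finite set \<open>C\<close>, its labeling can be
  written as a finite table.\<close>

lemma candidate_realises:
  assumes C: "finite C" "C \<subseteq> space M" and t: "\<And>u. u \<in> C \<Longrightarrow> t u < l"
  shows "\<exists>j. \<forall>u\<in>C. candidate l j u = t u"
proof -
  obtain n where n: "inj_on (code_prefix n) C" using code_prefix_separates[OF C] by blast
  obtain us where us: "set us = C" using finite_list[OF C(1)] by blast
  define m where "m = map (\<lambda>u. (code_prefix n u, t u)) us"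
  have "map_of m (code_prefix n u) = Some (t u)" if "u \<in> C" for u
  proof -
    have "map_of (map (\<lambda>u. (code_prefix n u, t u)) us) (code_prefix n u) = Some (t u)" if "u \<in> set us" "set us \<subseteq> C" for us
      using that inj_onD[OF n, of _ u] \<open>u \<in> C\<close> by (induction us) auto
    then show ?thesis using us that unfolding m_def by blast
  qed
  then have "candidate l (to_nat (n, m)) u = t u" if "u \<in> C" for u
    using that t by (simp add: candidate_def)
  then show ?thesis by blast
qed

end

section \<open>Extending partial labelings\<close>

context bounded_borel_graph
begin

lemma mem_ball_joined: "v \<in> space M \<Longrightarrow> u \<in> graph_ball G v k \<longleftrightarrow> joined_within G k v u"
  using mem_ball_iff[OF simple, of v u k] verts_eq by simp

lemma ball_in_space: "u \<in> graph_ball G v k \<Longrightarrow> u \<in> space M"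
  using verts_eq by (auto simp: graph_ball_def)

lemma joined_in_ball:
  assumes "u \<in> graph_ball G v k" "u' \<in> graph_ball G v k" "v \<in> space M"
  shows "joined_within G (2 * k) u u'"
proof -
  have "joined_within G k v u" "joined_within G k v u'" using assms mem_ball_joined by simp_all
  from joined_within_trans[OF joined_within_sym[OF simple this(1)] this(2)] show ?thesis by simp
qed

text \<open>The Borel map \<open>name (2 * k + 1)\<close> is injective on all the balls that matter, so the isomorphism type of a labeled ball
  is determined by finite sets of names. There are only countably many such sets.\<close>

lemma invariant_sets:
  assumes f: "\<And>i. {x \<in> space M. f x = i} \<in> sets M"
    and Q: "\<And>\<psi> v w. ball_iso k \<psi> G f v G f w \<Longrightarrow> Q v = Q w"
  shows "{v \<in> space M. Q v} \<in> sets M"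
proof -
  let ?B = "\<lambda>v. graph_ball G v k"
  \<comment> \<open>The extra 1 accounts for an edge that may leave the ball: its outer end has
    distance at most \<open>2 * k + 1\<close> from every vertex of the ball.\<close>
  define c where "c = name (2 * k + 1)"
  have c_inj: "u = u'" if "u \<in> ?B v" "u' \<in> ?B v" "v \<in> space M" "c u = c u'" for u u' v
  proof (rule name_inj)
    show "u \<in> space M" using ball_in_space that(1) .
    show "joined_within G (2 * k + 1) u u'" by (rule joined_within_mono[OF joined_in_ball[OF that(1-3)]]) simp
    show "name (2 * k + 1) u = name (2 * k + 1) u'" using that(4) by (simp add: c_def)
  qed
  have c_inj': "w = u'" if "u \<in> ?B v" "u' \<in> ?B v" "v \<in> space M" "(u, w) \<in> edges G" "c w = c u'" for u u' v w
  proof (rule name_inj)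
    show "w \<in> space M" using that(4) simple verts_eq by (auto simp: simple_graph_def)
    have "joined_within G 1 u w" using that(4) by (auto simp: joined_within_def intro!: exI[of _ 1])
    then have "joined_within G 1 w u" by (rule joined_within_sym[OF simple])
    then show "joined_within G (2 * k + 1) w u'" by (rule joined_within_trans[OF _ joined_in_ball[OF that(1-3)]]) simp
    show "name (2 * k + 1) w = name (2 * k + 1) u'" using that(5) by (simp add: c_def)
  qed
  define V where "V v = (\<lambda>u. (c u, f u)) ` ?B v" for v
  define W where "W v = {(c u, c u') | u u'. u \<in> ?B v \<and> u' \<in> ?B v \<and> (u, u') \<in> edges G}" for v
  have W_I: "(c u, c u') \<in> W v" if "u \<in> ?B v" "u' \<in> ?B v" "(u, u') \<in> edges G" for u u' v
    unfolding W_def using that by (intro CollectI exI[of _ u] exI[of _ u']) simp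
  have V_sets: "{v \<in> space M. V v = A} \<in> sets M" for A
  proof (rule sets_Collect_set_eq)
    fix p :: "nat list \<times> nat"
    have "{v \<in> space M. p \<in> V v} = near k ({x \<in> space M. c x = fst p} \<inter> {x \<in> space M. f x = snd p})"
      using mem_ball_joined ball_in_space by (force simp: V_def near_def)
    also have "\<dots> \<in> sets M" unfolding c_def by (intro near_sets sets.Int name_sets f)
    finally show "{v \<in> space M. p \<in> V v} \<in> sets M" .
  qed
  have W_sets: "{v \<in> space M. W v = A} \<in> sets M" for A
  proof (rule sets_Collect_set_eq)
    fix p :: "nat list \<times> nat list"
    let ?C = "\<lambda>a. {x \<in> space M. c x = a}"
    let ?N = "{x \<in> space M. \<exists>y\<in>?C (snd p). (x, y) \<in> edges G}"
    \<comment> \<open>A neighbour named \<open>snd p\<close> of a vertex in the ball need not itself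
      be in the ball. The second \<open>near\<close> supplies a vertex of the ball with that name,
      and \<open>c_inj'\<close> identifies the two.\<close>
    have "{v \<in> space M. p \<in> W v} = near k (?C (fst p) \<inter> ?N) \<inter> near k (?C (snd p))"
    proof (intro equalityI subsetI)
      fix v assume "v \<in> {v \<in> space M. p \<in> W v}"
      then obtain u u' where u: "v \<in> space M" "u \<in> ?B v" "u' \<in> ?B v" "(u, u') \<in> edges G" "p = (c u, c u')"
        by (auto simp: W_def)
      then have "u \<in> ?C (fst p) \<inter> ?N" "u' \<in> ?C (snd p)" using ball_in_space by auto
      then show "v \<in> near k (?C (fst p) \<inter> ?N) \<inter> near k (?C (snd p))"
        using u mem_ball_joined unfolding near_def by blast
    next
      fix v assume v: "v \<in> near k (?C (fst p) \<inter> ?N) \<inter> near k (?C (snd p))"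
      then obtain u u' where u: "v \<in> space M" "joined_within G k v u" "c u = fst p" "u \<in> ?N"
        "joined_within G k v u'" "c u' = snd p" by (auto simp: near_def)
      then obtain w where w: "(u, w) \<in> edges G" "c w = snd p" by blast
      have B: "u \<in> ?B v" "u' \<in> ?B v" using u mem_ball_joined by auto
      have "w = u'" by (rule c_inj'[OF B u(1) w(1)]) (use w u in simp)
      then show "v \<in> {v \<in> space M. p \<in> W v}" using u w B by (force simp: W_def)
    qed
    also have "\<dots> \<in> sets M" unfolding c_def by (intro near_sets sets.Int name_sets nbrs_sets)
    finally show "{v \<in> space M. p \<in> W v} \<in> sets M" .
  qed
  define view where "view v = (V v, W v, c v)" for v
  have view_iso: "\<exists>\<psi>. ball_iso k \<psi> G f v G f v'" if v: "v \<in> space M" "v' \<in> space M" "view v = view v'" for v v'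
  proof -
    have eq: "V v = V v'" "W v = W v'" "c v = c v'" using v(3) by (auto simp: view_def)
    have "fst ` V x = c ` ?B x" for x by (force simp: V_def)
    then have cB: "c ` ?B v = c ` ?B v'" using eq(1) by metis
    \<comment> \<open>The names occurring in the two balls are the same, so vertices of equal name
      are matched.\<close>
    define \<psi> where "\<psi> = inv_into (?B v') c \<circ> c"
    have b: "bij_betw c (?B v) (c ` ?B v)" "bij_betw c (?B v') (c ` ?B v)"
      unfolding bij_betw_def cB using c_inj v(1,2) by (auto simp: inj_on_def cB)
    have bij: "bij_betw \<psi> (?B v) (?B v')"
      unfolding \<psi>_def by (rule bij_betw_trans[OF b(1) bij_betw_inv_into[OF b(2)]])
    have \<psi>: "\<psi> u \<in> ?B v'" "c (\<psi> u) = c u" if "u \<in> ?B v" for u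
      using bij_betw_apply[OF bij that] f_inv_into_f[of "c u" c "?B v'"] that cB by (auto simp: \<psi>_def)
    have centre: "v \<in> ?B v" "v' \<in> ?B v'" using v verts_eq by (auto intro: centre_in_ball)
    have "\<psi> v = v'" by (rule c_inj[OF \<psi>(1)[OF centre(1)] centre(2) v(2)]) (use \<psi>(2)[OF centre(1)] eq(3) in simp)
    moreover have "f (\<psi> u) = f u" if u: "u \<in> ?B v" for u
    proof -
      have "(c u, f u) \<in> V v'" using u eq(1) unfolding V_def by blast
      then obtain w where w: "w \<in> ?B v'" "c w = c u" "f w = f u" by (auto simp: V_def)
      have "w = \<psi> u" by (rule c_inj[OF w(1) \<psi>(1)[OF u] v(2)]) (use w \<psi>(2)[OF u] in simp)
      then show ?thesis using w by simp
    qed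
    moreover have "(x, y) \<in> edges G \<longleftrightarrow> (\<psi> x, \<psi> y) \<in> edges G" if xy: "x \<in> ?B v" "y \<in> ?B v" for x y
    proof
      assume "(x, y) \<in> edges G"
      then have "(c x, c y) \<in> W v'" using W_I[OF xy] eq(2) by simp
      then obtain w w' where w: "w \<in> ?B v'" "w' \<in> ?B v'" "c w = c x" "c w' = c y" "(w, w') \<in> edges G"
        by (auto simp: W_def)
      have "w = \<psi> x" by (rule c_inj[OF w(1) \<psi>(1)[OF xy(1)] v(2)]) (use w \<psi>(2)[OF xy(1)] in simp)
      moreover have "w' = \<psi> y" by (rule c_inj[OF w(2) \<psi>(1)[OF xy(2)] v(2)]) (use w \<psi>(2)[OF xy(2)] in simp)
      ultimately show "(\<psi> x, \<psi> y) \<in> edges G" using w(5) by simp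
    next
      assume "(\<psi> x, \<psi> y) \<in> edges G"
      then have "(c (\<psi> x), c (\<psi> y)) \<in> W v'" by (rule W_I[OF \<psi>(1)[OF xy(1)] \<psi>(1)[OF xy(2)]])
      then have "(c x, c y) \<in> W v" using \<psi>(2) xy eq(2) by simp
      then obtain w w' where w: "w \<in> ?B v" "w' \<in> ?B v" "c w = c x" "c w' = c y" "(w, w') \<in> edges G"
        by (auto simp: W_def)
      have "w = x" by (rule c_inj[OF w(1) xy(1) v(1) w(3)])
      moreover have "w' = y" by (rule c_inj[OF w(2) xy(2) v(1) w(4)])
      ultimately show "(x, y) \<in> edges G" using w(5) by simp
    qed
    ultimately have "ball_iso k \<psi> G f v G f v'"
      unfolding ball_iso_def using bij v verts_eq by blast
    then show ?thesis by (rule exI[of _ \<psi>])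
  qed
  define Z where "Z = view ` {v \<in> space M. Q v}"
  have "Z \<subseteq> Collect finite \<times> Collect finite \<times> UNIV"
  proof
    fix z assume "z \<in> Z"
    then obtain v where v: "v \<in> space M" "z = view v" by (auto simp: Z_def)
    have fin: "finite (?B v)" by (rule finite_ball[OF v(1)])
    have "W v \<subseteq> (\<lambda>(u, u'). (c u, c u')) ` (?B v \<times> ?B v)" by (auto simp: W_def)
    then have "finite (W v)" by (rule finite_subset) (use fin in simp)
    moreover have "finite (V v)" using fin by (simp add: V_def)
    ultimately show "z \<in> Collect finite \<times> Collect finite \<times> UNIV" using v by (simp add: view_def)
  qed
  then have cZ: "countable Z"
    by (rule countable_subset) (intro countable_SIGMA countable_Collect_finite countableI_type)
  have "(\<Union>z\<in>Z. {v \<in> space M. view v = z}) \<in> sets M"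
  proof (intro sets.countable_UN'' cZ)
    fix z :: "(nat list \<times> nat) set \<times> (nat list \<times> nat list) set \<times> nat list"
    obtain A A' s where z: "z = (A, A', s)" by (cases z)
    have "{v \<in> space M. view v = z} = {v \<in> space M. V v = A} \<inter> ({v \<in> space M. W v = A'} \<inter> {v \<in> space M. c v = s})"
      by (auto simp: z view_def)
    also have "\<dots> \<in> sets M" using V_sets W_sets name_sets unfolding c_def by (intro sets.Int)
    finally show "{v \<in> space M. view v = z} \<in> sets M" .
  qed
  moreover have "(\<Union>z\<in>Z. {v \<in> space M. view v = z}) = {v \<in> space M. Q v}"
  proof (intro equalityI subsetI)
    fix v assume "v \<in> (\<Union>z\<in>Z. {v \<in> space M. view v = z})"
    then obtain v0 where v0: "v \<in> space M" "v0 \<in> space M" "Q v0" "view v = view v0" by (auto simp: Z_def)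
    then obtain \<psi> where "ball_iso k \<psi> G f v G f v0" using view_iso by blast
    then show "v \<in> {v \<in> space M. Q v}" using Q v0 by simp
  qed (auto simp: Z_def)
  ultimately show ?thesis by simp
qed

text \<open>A candidate is discarded on a whole component of \<open>U\<close> as soon as it spoils a
  vertex whose ball meets that component. The vertices of \<open>U\<close> in one ball of radius
  \<open>k\<close> lie in one component, so they all use the same candidate, and the residual
  probability at the centre is the one that this candidate gives.\<close>

lemma extend_labels:
  fixes B :: "('a \<Rightarrow> nat) \<Rightarrow> 'a \<Rightarrow> bool" and k :: nat
  defines "D \<equiv> (d + 1) ^ (2 * k)"
  assumes inv: "\<And>\<psi> f v g w. ball_iso k \<psi> G f v G g w \<Longrightarrow> B f v \<longleftrightarrow> B g w"
    and l: "0 < l" and p: "0 < p" and U: "U \<in> sets M"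
    and comp_fin: "component_finite (induced (graph_power G (2 * k)) U)"
    and f: "\<And>i. {x \<in> space M. f x = i} \<in> sets M"
    and bound: "\<And>v. v \<in> space M \<Longrightarrow> residual_prob l k G B f v \<le> p"
  shows "\<exists>f'. (\<forall>i. {x \<in> space M. f' x = i} \<in> sets M) \<and> (\<forall>u\<in>U. f' u < l) \<and> (\<forall>u. u \<notin> U \<longrightarrow> f' u = f u) \<and>
    (\<forall>v\<in>space M. residual_prob l k G B f' v \<le> 4 * real D * p)"
proof -
  let ?B = "\<lambda>v. graph_ball G v k" and ?H = "induced (graph_power G (2 * k)) U"
  let ?rp = "residual_prob l k G B"
  define p' where "p' = 4 * real D * p"
  have D: "1 \<le> D" unfolding D_def by simp
  have p': "0 < p'" "p \<le> p'" using p D by (auto simp: p'_def)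
  have U_space: "u \<in> space M" if "u \<in> U" for u using sets.sets_into_space[OF U] that by blast
  have loc: "B g v \<longleftrightarrow> B h v" if "v \<in> space M" "\<And>x. x \<in> ?B v \<Longrightarrow> g x = h x" for g h v
    by (rule inv[OF ball_iso_cong]) (use that verts_eq in auto)
  have rp_iso: "?rp g v = ?rp h w" if "ball_iso k \<psi> G g v G h w" for \<psi> g v h w
  proof (rule residual_prob_iso[OF that _ l])
    show "finite (?B v)" using that verts_eq by (intro finite_ball) (simp add: ball_iso_def)
  qed (rule inv)
  have rp_cong: "?rp g v = ?rp h v" if "v \<in> space M" "\<And>x. x \<in> ?B v \<Longrightarrow> g x = h x" for g h v
    by (rule rp_iso[OF ball_iso_cong]) (use that verts_eq in auto)

  \<comment> \<open>On \<open>U\<close> the labeling \<open>t\<close> is used only where no label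
    has been revealed, so a vertex that belongs to sets of several rounds keeps its first
    label.\<close>
  define ext where "ext t u = (if u \<in> U then fill l f t u else f u)" for t u
  define Bad where "Bad j = {v \<in> space M. p' < ?rp (ext (candidate l j)) v}" for j
  have f_fill: "{x \<in> space M. fill l f (candidate l j) x = i} \<in> sets M" for i j
  proof -
    have "{x \<in> space M. fill l f (candidate l j) x = i} =
        (if i < l then {x \<in> space M. f x = i} else {}) \<union>
        ((\<Union>m\<in>{l..}. {x \<in> space M. f x = m}) \<inter> {x \<in> space M. candidate l j x = i})"
      by (auto simp: fill_def)
    also have "\<dots> \<in> sets M"
      by (intro sets.Un sets.Int sets.countable_UN'' candidate_sets f) (auto simp: f)
    finally show ?thesis .
  qed
  have ext_sets: "{x \<in> space M. ext (candidate l j) x = i} \<in> sets M" for i j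
  proof -
    have "{x \<in> space M. ext (candidate l j) x = i} =
        (U \<inter> {x \<in> space M. fill l f (candidate l j) x = i}) \<union> ({x \<in> space M. f x = i} - U)"
      using U_space by (auto simp: ext_def)
    also have "\<dots> \<in> sets M" by (intro sets.Un sets.Int sets.Diff U f f_fill)
    finally show ?thesis .
  qed
  have Bad_sets: "Bad j \<in> sets M" for j
    unfolding Bad_def by (rule invariant_sets[OF ext_sets[where j = j], where k = k]) (drule rp_iso, simp)

  \<comment> \<open>\<open>R j\<close> starts from the vertices of \<open>U\<close> that are close
    enough to influence a bad vertex and spreads along the edges of \<open>?H\<close>, so
    \<open>Reach j\<close> is a union of components. Spreading by countably many Borel steps keeps
    it Borel.\<close>
  define R where "R j = rec_nat (U \<inter> near k (Bad j)) (\<lambda>_ X. U \<inter> near (2 * k) X)" for j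
  have R_0: "R j 0 = U \<inter> near k (Bad j)" and R_Suc: "R j (Suc n) = U \<inter> near (2 * k) (R j n)" for j n
    by (simp_all add: R_def)
  define Reach where "Reach j = (\<Union>n. R j n)" for j
  have "R j n \<in> sets M" for j n
    by (induction n) (auto simp: R_0 R_Suc intro!: sets.Int U near_sets Bad_sets)
  then have Reach_sets: "Reach j \<in> sets M" for j unfolding Reach_def by (intro sets.countable_UN'') auto
  have Reach_step: "x \<in> Reach j" if xu: "x \<in> U" "joined_within G (2 * k) x u" "u \<in> Reach j" for x u j
  proof -
    obtain n where "u \<in> R j n" using xu(3) by (auto simp: Reach_def)
    then have "x \<in> R j (Suc n)" using xu U_space by (auto simp: R_Suc near_def)
    then show ?thesis unfolding Reach_def by blast
  qed
  have Reach_cong: "x \<in> Reach j \<longleftrightarrow> u \<in> Reach j" if "x \<in> U" "u \<in> U" "joined_within G (2 * k) x u" for x u j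
    using Reach_step[of x u j] Reach_step[of u x j] joined_within_sym[OF simple that(3)] that by blast
  define comp where "comp x = {u \<in> U. (x, u) \<in> (edges ?H)\<^sup>*}" for x
  have verts_H: "verts ?H = U" using U_space verts_eq by (auto simp: induced_def graph_power_def)
  have fin_comp: "finite (comp x)" if "x \<in> U" for x
    using comp_fin that verts_H by (simp add: component_finite_def comp_def)
  have edge_H: "(u, u') \<in> (edges ?H)\<^sup>*" if "u \<in> U" "u' \<in> U" "joined_within G (2 * k) u u'" for u u'
  proof (cases "u = u'")
    case False
    then have "(u, u') \<in> edges ?H" using that U_space verts_eq by (simp add: induced_def graph_power_def)
    then show ?thesis by blast
  qed simp
  have Reach_comp: "\<exists>u\<in>comp x. u \<in> near k (Bad j)" if x: "x \<in> Reach j" for x j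
  proof -
    obtain n where "x \<in> R j n" using x by (auto simp: Reach_def)
    then show ?thesis
    proof (induction n arbitrary: x)
      case 0
      then show ?case by (auto simp: R_0 comp_def)
    next
      case (Suc n)
      then obtain y where y: "x \<in> U" "y \<in> R j n" "joined_within G (2 * k) x y" by (auto simp: R_Suc near_def)
      have "y \<in> U" using y(2) by (cases n) (auto simp: R_0 R_Suc)
      obtain u where u: "u \<in> comp y" "u \<in> near k (Bad j)" using Suc.IH[OF y(2)] by blast
      have "(x, u) \<in> (edges ?H)\<^sup>*"
        using edge_H[OF y(1) \<open>y \<in> U\<close> y(3)] u(1) by (auto simp: comp_def)
      then show ?case using u by (auto simp: comp_def)
    qed
  qed

  have avoid: "\<exists>j. x \<notin> Reach j" if x: "x \<in> U" for x
  proof -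
    let ?C = "comp x"
    \<comment> \<open>These are the finitely many vertices whose residual probability can be
      affected by labels on \<open>?C\<close>.\<close>
    define I where "I = (\<Union>u\<in>?C. ?B u)"
    define ft where "ft t u = (if u \<in> ?C then fill l f t u else f u)" for t u
    define E where "E v = {t. p' < ?rp (ft t) v}" for v
    have C: "finite ?C" "?C \<subseteq> U" using fin_comp[OF x] by (auto simp: comp_def)
    have I: "finite I" "I \<subseteq> space M" using C U_space finite_ball ball_in_space by (auto simp: I_def)
    \<comment> \<open>Only the labels on \<open>?C\<close> are random, so the event at
      \<open>v\<close> is supported on \<open>?B v \<inter> ?C\<close>. Events with overlapping
      supports have centres at distance at most \<open>2 * k\<close>, which gives the dependency
      bound \<open>D\<close>.\<close>
    have "\<exists>t\<in>set_pmf (Pi_pmf ?C 0 (unif l)). \<forall>v\<in>I. t \<notin> E v"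
    proof (rule lovasz_local_lemma_Pi_pmf[where S = "\<lambda>v. ?B v \<inter> ?C" and q = "1 / (4 * real D)" and D = D])
      fix v assume v: "v \<in> I"
      then have vM: "v \<in> space M" using I by blast
      show "depends_on (?B v \<inter> ?C) (E v)"
        unfolding depends_on_def
      proof (intro allI impI)
        fix t t' :: "'a \<Rightarrow> nat" assume "\<forall>x\<in>?B v \<inter> ?C. t x = t' x"
        then have "?rp (ft t) v = ?rp (ft t') v" by (intro rp_cong vM) (auto simp: ft_def fill_def)
        then show "t \<in> E v \<longleftrightarrow> t' \<in> E v" by (simp add: E_def)
      qed
      have "measure_pmf.prob (Pi_pmf ?C 0 (unif l)) (E v) \<le> ?rp f v / p'"
        unfolding E_def ft_def by (rule residual_prob_reveal[where B = B, OF C(1) finite_ball[OF vM] p'(1) l]) (rule loc[OF vM])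
      also have "\<dots> \<le> p / p'" using bound[OF vM] p' by (intro divide_right_mono) auto
      also have "\<dots> = 1 / (4 * real D)" using p by (simp add: p'_def)
      finally show "measure_pmf.prob (Pi_pmf ?C 0 (unif l)) (E v) \<le> 1 / (4 * real D)" .
      have "{w \<in> I. (?B w \<inter> ?C) \<inter> (?B v \<inter> ?C) \<noteq> {}} \<subseteq> graph_ball G v (2 * k)"
      proof
        fix w assume w: "w \<in> {w \<in> I. (?B w \<inter> ?C) \<inter> (?B v \<inter> ?C) \<noteq> {}}"
        then obtain y where y: "y \<in> ?B w" "y \<in> ?B v" by blast
        have "w \<in> ?B y" using ball_sym[OF simple _ y(1)] w I verts_eq by auto
        then show "w \<in> graph_ball G v (2 * k)" by (rule ball_trans[OF y(2)]) simp
      qed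
      then have "card {w \<in> I. (?B w \<inter> ?C) \<inter> (?B v \<inter> ?C) \<noteq> {}} \<le> card (graph_ball G v (2 * k))"
        by (rule card_mono[OF finite_ball[OF vM]])
      also have "\<dots> \<le> D" unfolding D_def by (rule card_ball[OF vM])
      finally show "card {w \<in> I. (?B w \<inter> ?C) \<inter> (?B v \<inter> ?C) \<noteq> {}} \<le> D" .
    qed (use C I D in auto)
    then obtain t where t: "t \<in> set_pmf (Pi_pmf ?C 0 (unif l))" "\<And>v. v \<in> I \<Longrightarrow> t \<notin> E v" by blast
    have tl: "t u < l" if "u \<in> ?C" for u
      using t(1) that C l by (auto simp: set_Pi_pmf PiE_dflt_def set_pmf_of_set lessThan_empty_iff)
    obtain j where j: "\<And>u. u \<in> ?C \<Longrightarrow> candidate l j u = t u"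
      using candidate_realises[of ?C t l] C tl U_space by blast
    have "x \<notin> Reach j"
    proof
      assume "x \<in> Reach j"
      then obtain u where u: "u \<in> ?C" "u \<in> near k (Bad j)" using Reach_comp by blast
      then obtain v where v: "v \<in> Bad j" "joined_within G k u v" by (auto simp: near_def)
      have vM: "v \<in> space M" using v(1) by (simp add: Bad_def)
      have uU: "u \<in> U" "u \<in> space M" using u C U_space by auto
      have "v \<in> ?B u" using v(2) mem_ball_joined[OF uU(2)] by simp
      then have vI: "v \<in> I" using u(1) unfolding I_def by blast
      have uB: "u \<in> ?B v" using mem_ball_joined[OF vM] joined_within_sym[OF simple v(2)] by simp
      \<comment> \<open>The ball of \<open>v\<close> meets no component of \<open>U\<close> other
        than \<open>?C\<close>, so on this ball the candidate and \<open>t\<close> yield the same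
        extension of \<open>f\<close>.\<close>
      have "y \<in> ?C" if y: "y \<in> ?B v" "y \<in> U" for y
      proof -
        have "(u, y) \<in> (edges ?H)\<^sup>*" by (rule edge_H[OF uU(1) y(2) joined_in_ball[OF uB y(1) vM]])
        then show ?thesis using u(1) y(2) by (auto simp: comp_def)
      qed
      then have "?rp (ext (candidate l j)) v = ?rp (ft t) v"
        by (intro rp_cong vM) (use C j in \<open>auto simp: ext_def ft_def fill_def\<close>)
      then show False using t(2)[OF vI] v(1) by (simp add: E_def Bad_def)
    qed
    then show ?thesis ..
  qed

  \<comment> \<open>Since \<open>Reach j\<close> is a union of components, the least admissible
    index is constant on each component.\<close>
  define J where "J x = (LEAST j. x \<notin> Reach j)" for x
  define f' where "f' u = ext (candidate l (J u)) u" for u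
  have J: "u \<notin> Reach (J u)" if "u \<in> U" for u unfolding J_def by (rule LeastI_ex[OF avoid[OF that]])
  have J_sets: "{x \<in> U. J x = j} \<in> sets M" for j
  proof -
    have "{x \<in> U. J x = j} = {x \<in> space M. x \<in> U \<and> x \<notin> Reach j \<and> (\<forall>m\<in>{..<j}. x \<in> Reach m)}"
    proof -
      have "J x = j \<longleftrightarrow> x \<notin> Reach j \<and> (\<forall>m\<in>{..<j}. x \<in> Reach m)" if x: "x \<in> U" for x
      proof
        assume e: "J x = j"
        have "x \<in> Reach m" if "m < J x" for m using not_less_Least[OF that[unfolded J_def]] by blast
        then show "x \<notin> Reach j \<and> (\<forall>m\<in>{..<j}. x \<in> Reach m)" using J[OF x] unfolding e by simp
      next
        assume *: "x \<notin> Reach j \<and> (\<forall>m\<in>{..<j}. x \<in> Reach m)"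
        show "J x = j" unfolding J_def
        proof (rule Least_equality)
          show "j \<le> m" if "x \<notin> Reach m" for m using * that by (meson lessThan_iff not_less)
        qed (use * in blast)
      qed
      then show ?thesis using U_space by blast
    qed
    also have "\<dots> \<in> sets M"
    proof -
      have mem: "{x \<in> space M. x \<in> X} \<in> sets M" if "X \<in> sets M" for X
        using that sets.sets_into_space[OF that] by (simp add: Collect_conj_eq Int_absorb1)
      show ?thesis
        by (intro sets.sets_Collect sets.sets_Collect_finite_All mem U Reach_sets) simp
    qed
    finally show ?thesis .
  qed
  have f'_eq: "f' u = f u" if "u \<notin> U" for u using that by (simp add: f'_def ext_def)
  have "{x \<in> space M. f' x = i} \<in> sets M" for i
  proof -
    have "{x \<in> space M. f' x = i} =
      (\<Union>j. {x \<in> U. J x = j} \<inter> {x \<in> space M. ext (candidate l j) x = i}) \<union> ({x \<in> space M. f x = i} - U)"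
      using f'_eq U_space by (auto simp: f'_def)
    also have "\<dots> \<in> sets M" by (intro sets.Un sets.Diff sets.Int sets.countable_UN'' J_sets ext_sets U f) auto
    finally show ?thesis .
  qed
  moreover have "f' u < l" if "u \<in> U" for u
    using that candidate_less[OF l] by (simp add: f'_def ext_def fill_def)
  moreover have "?rp f' v \<le> p'" if v: "v \<in> space M" for v
  proof (cases "?B v \<inter> U = {}")
    case True
    then have "?rp f' v = ?rp f v" by (intro rp_cong v f'_eq) blast
    then show ?thesis using bound[OF v] p' by simp
  next
    case False
    then obtain u0 where u0: "u0 \<in> ?B v" "u0 \<in> U" by blast
    have "J u = J u0" if u: "u \<in> ?B v" "u \<in> U" for u
      unfolding J_def using Reach_cong[OF u(2) u0(2) joined_in_ball[OF u(1) u0(1) v]] by simp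
    then have "?rp f' v = ?rp (ext (candidate l (J u0))) v"
      by (intro rp_cong v) (auto simp: f'_def ext_def)
    moreover have "v \<notin> Bad (J u0)"
    proof
      assume "v \<in> Bad (J u0)"
      moreover have "joined_within G k u0 v"
        using u0(1) mem_ball_joined[OF v] joined_within_sym[OF simple, of k v u0] by simp
      ultimately have "u0 \<in> R (J u0) 0" using u0(2) U_space by (auto simp: R_0 near_def)
      then show False using J[OF u0(2)] unfolding Reach_def by blast
    qed
    ultimately show ?thesis using v by (simp add: Bad_def)
  qed
  ultimately show ?thesis using f'_eq unfolding p'_def by (intro exI[of _ f'] conjI allI ballI impI)
qed

end

section \<open>The main theorem\<close>

context bounded_borel_graph
begin

text \<open>In the constant labeling \<open>l\<close> nothing has been revealed. A revealed vertex
  stays revealed: outside the new set the labels are kept, and inside it they are all below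
  \<open>l\<close>.\<close>

lemma extend_labels_iterate:
  fixes B :: "('a \<Rightarrow> nat) \<Rightarrow> 'a \<Rightarrow> bool" and k :: nat and U :: "nat \<Rightarrow> 'a set"
  assumes inv: "\<And>\<psi> f v g w. ball_iso k \<psi> G f v G g w \<Longrightarrow> B f v \<longleftrightarrow> B g w"
    and l: "0 < l" and p: "0 < p"
    and U: "\<And>i. i < m \<Longrightarrow> U i \<in> sets M"
    and comp_fin: "\<And>i. i < m \<Longrightarrow> component_finite (induced (graph_power G (2 * k)) (U i))"
    and bound: "\<And>v. v \<in> space M \<Longrightarrow> residual_prob l k G B (\<lambda>_. l) v \<le> p"
  shows "\<exists>f. (\<forall>i. {x \<in> space M. f x = i} \<in> sets M) \<and> (\<forall>i<m. \<forall>u\<in>U i. f u < l) \<and>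
    (\<forall>v\<in>space M. residual_prob l k G B f v \<le> (4 * real (d + 1) ^ (2 * k)) ^ m * p)"
  using U comp_fin
proof (induction m)
  case 0
  have "{x \<in> space M. l = i} \<in> sets M" for i by (cases "l = i") auto
  then show ?case using bound by (intro exI[of _ "\<lambda>_. l"]) auto
next
  case (Suc m)
  obtain f where f: "\<And>i. {x \<in> space M. f x = i} \<in> sets M" "\<And>i u. i < m \<Longrightarrow> u \<in> U i \<Longrightarrow> f u < l"
    "\<And>v. v \<in> space M \<Longrightarrow> residual_prob l k G B f v \<le> (4 * real (d + 1) ^ (2 * k)) ^ m * p"
    using Suc.IH Suc.prems by force
  have p': "0 < (4 * real (d + 1) ^ (2 * k)) ^ m * p" using p by simp
  have "\<exists>f'. (\<forall>i. {x \<in> space M. f' x = i} \<in> sets M) \<and> (\<forall>u\<in>U m. f' u < l) \<and> (\<forall>u. u \<notin> U m \<longrightarrow> f' u = f u) \<and>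
    (\<forall>v\<in>space M. residual_prob l k G B f' v \<le> 4 * real ((d + 1) ^ (2 * k)) * ((4 * real (d + 1) ^ (2 * k)) ^ m * p))"
    by (rule extend_labels[where B = B, OF _ l p' Suc.prems(1)[OF lessI] Suc.prems(2)[OF lessI] f(1)])
      (rule inv, assumption, rule f(3))
  then obtain f' where f': "\<And>i. {x \<in> space M. f' x = i} \<in> sets M" "\<And>u. u \<in> U m \<Longrightarrow> f' u < l"
    "\<And>u. u \<notin> U m \<Longrightarrow> f' u = f u"
    "\<And>v. v \<in> space M \<Longrightarrow> residual_prob l k G B f' v \<le> 4 * real ((d + 1) ^ (2 * k)) * ((4 * real (d + 1) ^ (2 * k)) ^ m * p)"
    by blast
  have "f' u < l" if "i < Suc m" "u \<in> U i" for i u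
    using that f(2)[of i u] f'(2)[of u] f'(3)[of u] by (cases "u \<in> U m") (auto simp: less_Suc_eq)
  then show ?case using f' by (intro exI[of _ f']) (auto simp: mult.assoc)
qed

lemma borel_solution:
  fixes B :: "('a \<Rightarrow> nat) \<Rightarrow> 'a \<Rightarrow> bool" and k :: nat and U :: "nat \<Rightarrow> 'a set"
  assumes inv: "\<And>\<psi> f v g w. ball_iso k \<psi> G f v G g w \<Longrightarrow> B f v \<longleftrightarrow> B g w"
    and l: "0 < l" and p: "0 < p"
    and U: "\<And>i. i < m \<Longrightarrow> U i \<in> sets M"
    and comp_fin: "\<And>i. i < m \<Longrightarrow> component_finite (induced (graph_power G (2 * k)) (U i))"
    and cover: "(\<Union>i<m. U i) = space M"
    and bound: "\<And>v. v \<in> space M \<Longrightarrow> residual_prob l k G B (\<lambda>_. l) v \<le> p"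
    and small: "(4 * real (d + 1) ^ (2 * k)) ^ m * p < 1"
  shows "\<exists>f. (\<forall>i. {x \<in> space M. f x = i} \<in> sets M) \<and> (\<forall>v\<in>space M. \<not> B f v)"
proof -
  have "\<exists>f. (\<forall>i. {x \<in> space M. f x = i} \<in> sets M) \<and> (\<forall>i<m. \<forall>u\<in>U i. f u < l) \<and>
    (\<forall>v\<in>space M. residual_prob l k G B f v \<le> (4 * real (d + 1) ^ (2 * k)) ^ m * p)"
    by (rule extend_labels_iterate[where B = B, OF _ l p])
      (rule inv U comp_fin bound, assumption)+
  then obtain f where f: "\<And>i. {x \<in> space M. f x = i} \<in> sets M" "\<And>i u. i < m \<Longrightarrow> u \<in> U i \<Longrightarrow> f u < l"
    "\<And>v. v \<in> space M \<Longrightarrow> residual_prob l k G B f v \<le> (4 * real (d + 1) ^ (2 * k)) ^ m * p"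
    by blast
  have "\<not> B f v" if v: "v \<in> space M" for v
  proof
    assume "B f v"
    have "f u < l" if "u \<in> space M" for u using that f(2) cover by blast
    then have "B (fill l f t) v" for t
      using \<open>B f v\<close> inv[OF ball_iso_cong[of v G k "fill l f t" f]] v verts_eq ball_in_space
      by (simp add: fill_def)
    then have "residual_prob l k G B f v = 1" by (simp add: residual_prob_def)
    then show False using f(3)[OF v] small by simp
  qed
  then show ?thesis using f(1) by blast
qed

end

text \<open>A failure at \<open>w\<close> already spoils the colouring of the whole of
  \<open>H\<close>, so the global failure probability is an upper bound.\<close>

lemma residual_prob_of_global_success:
  fixes H :: "'a ugraph" and w :: 'a
  assumes H: "finite_graph H" and w: "w \<in> verts H" and l: "0 < l"
    and good: "1 - q \<le> measure_pmf.prob (pmf_of_set (verts H \<rightarrow>\<^sub>E {..<l}))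
      {\<theta>. is_coloring L H (run_local A T H \<theta>)}"
  shows "residual_prob l (fst L + T) H (fails L A T H) (\<lambda>_. l) w \<le> q"
proof -
  let ?k = "fst L + T" and ?V = "verts H"
  have fin: "finite ?V" and simple: "simple_graph H" using H by (auto simp: finite_graph_def)
  have loc: "fails L A T H f w \<longleftrightarrow> fails L A T H g w" if "\<And>x. x \<in> graph_ball H w ?k \<Longrightarrow> f x = g x" for f g
    by (rule fails_iso[OF ball_iso_cong[OF w that] simple simple])
  have sub: "graph_ball H w ?k \<subseteq> ?V" by (auto simp: graph_ball_def)
  have loc': "fails L A T H (\<lambda>x. if x \<in> ?V then t x else 0) w \<longleftrightarrow> fails L A T H t w" for t
    by (rule loc) (use sub in auto)
  have "PiE_dflt ?V undefined (\<lambda>_. {..<l}) = ?V \<rightarrow>\<^sub>E {..<l}"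
    by (auto simp: PiE_dflt_def PiE_def Pi_def extensional_def)
  then have unif: "Pi_pmf ?V undefined (unif l) = pmf_of_set (?V \<rightarrow>\<^sub>E {..<l})"
    using Pi_pmf_unif[OF fin l, of undefined] by simp
  let ?P = "pmf_of_set (?V \<rightarrow>\<^sub>E {..<l})"
  have "residual_prob l ?k H (fails L A T H) (\<lambda>_. l) w =
      measure_pmf.prob (Pi_pmf ?V 0 (unif l)) {t. fails L A T H (fill l (\<lambda>_. l) t) w}"
    by (rule residual_prob_superset[where B = "fails L A T H", OF fin sub]) (rule loc)
  also have "\<dots> = measure_pmf.prob (Pi_pmf ?V 0 (unif l)) {t. fails L A T H t w}"
  proof -
    have "fill l (\<lambda>_. l) t = t" for t :: "'a \<Rightarrow> nat" by (simp add: fill_def fun_eq_iff)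
    then show ?thesis by simp
  qed
  \<comment> \<open>Labelings in \<open>verts H \<rightarrow>\<^sub>E {..<l}\<close> are
    \<open>undefined\<close> outside \<open>verts H\<close>, whereas residual probabilities use the
    default 0; by \<open>loc'\<close> the failure at \<open>w\<close> does not see the
    difference.\<close>
  also have "Pi_pmf ?V 0 (unif l) = map_pmf (\<lambda>t x. if x \<in> ?V then t x else 0) ?P"
    unfolding unif[symmetric] by (rule Pi_pmf_default_swap[OF fin, symmetric])
  also have "measure_pmf.prob \<dots> {t. fails L A T H t w} = measure_pmf.prob ?P {t. fails L A T H t w}"
    unfolding measure_map_pmf by (simp add: vimage_def loc')
  also have "\<dots> \<le> measure_pmf.prob ?P (UNIV - {\<theta>. is_coloring L H (run_local A T H \<theta>)})"
    by (intro measure_pmf.finite_measure_mono) (use w in \<open>auto simp: is_coloring_run_local_iff\<close>)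
  also have "\<dots> = 1 - measure_pmf.prob ?P {\<theta>. is_coloring L H (run_local A T H \<theta>)}"
    using measure_pmf.prob_compl[of "{\<theta>. is_coloring L H (run_local A T H \<theta>)}" ?P] by simp
  finally show ?thesis using good by simp
qed

section \<open>Consequences of the asymptotic hypotheses\<close>

lemma Inf_enat_attained:
  assumes "Inf {enat s | s. P s} = enat s"
  shows "P s"
proof -
  have "{enat s | s. P s} \<noteq> {}"
  proof
    assume "{enat s | s. P s} = {}"
    then show False using assms by (simp add: Inf_enat_def)
  qed
  then obtain x where "x \<in> {enat s | s. P s}" by blast
  from wellorder_InfI[OF this] have "Inf {enat s | s. P s} \<in> {enat s | s. P s}" .
  then show ?thesis unfolding assms by auto
qed

text \<open>The order of quantifiers is the point: \<open>S\<close> is independent of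
  \<open>R\<close>. It enters the choice of \<open>n\<close>, and only then are \<open>T\<close> and
  the power \<open>R = 2 * k\<close> known.\<close>

lemma asi_partition:
  assumes "asi M G < \<infinity>"
  shows "\<exists>S. \<forall>R. \<exists>s\<le>S. \<exists>U :: nat \<Rightarrow> 'a set. (\<forall>i\<le>s. U i \<in> sets M) \<and> (\<Union>i\<le>s. U i) = verts G \<and>
     (\<forall>i\<le>s. component_finite (induced (graph_power G R) (U i)))"
proof -
  obtain S where S: "asi M G = enat S" using assms by auto
  have "\<exists>s\<le>S. \<exists>U :: nat \<Rightarrow> 'a set. (\<forall>i\<le>s. U i \<in> sets M) \<and> (\<Union>i\<le>s. U i) = verts G \<and>
     (\<forall>i\<le>s. component_finite (induced (graph_power G R) (U i)))" for R
  proof -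
    have "si M (graph_power G R) \<le> enat S" unfolding S[symmetric] asi_def by (rule SUP_upper) simp
    then obtain s where s: "si M (graph_power G R) = enat s" "s \<le> S"
      by (cases "si M (graph_power G R)") auto
    from Inf_enat_attained[OF s(1)[unfolded si_def]] show ?thesis
      using s(2) by (intro exI[of _ s] conjI) (auto simp: graph_power_def)
  qed
  then show ?thesis by blast
qed

text \<open>Eventually \<open>h n \<le> c * ln n\<close> with \<open>c * ln b \<le> 1/2\<close>, so
  \<open>b powr h n \<le> sqrt n\<close>; the constant is absorbed by
  \<open>C < sqrt n\<close>.\<close>

lemma eventually_power_less:
  fixes C b :: real and h :: "nat \<Rightarrow> real"
  assumes h: "h \<in> o(\<lambda>n. ln (real n))" and h0: "\<And>n. 0 \<le> h n" and C: "0 < C" and b: "1 \<le> b"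
  shows "\<forall>\<^sub>F n in sequentially. C * b powr h n < real n"
proof -
  \<comment> \<open>The summand 1 keeps \<open>c\<close> positive when \<open>b = 1\<close>.\<close>
  define c where "c = 1 / (2 * (ln b + 1))"
  have lb: "0 \<le> ln b" using b by simp
  then have c: "0 < c" by (simp add: c_def)
  have "\<forall>\<^sub>F n in sequentially. norm (h n) \<le> c * norm (ln (real n))" by (rule landau_o.smallD[OF h c])
  moreover have "\<forall>\<^sub>F n in sequentially. real n > max 1 (C ^ 2)"
    by (rule eventually_compose_filterlim[OF eventually_gt_at_top filterlim_real_sequentially])
  ultimately show ?thesis
  proof eventually_elim
    case (elim n)
    have n: "1 < real n" "C ^ 2 < real n" using elim by auto
    have ln: "0 \<le> ln (real n)" using n by simp
    have "h n * ln b \<le> (c * ln (real n)) * ln b" using elim h0[of n] ln lb by (intro mult_right_mono) auto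
    also have "\<dots> = (c * ln b) * ln (real n)" by simp
    also have "\<dots> \<le> 1 / 2 * ln (real n)"
      by (rule mult_right_mono[OF _ ln]) (use lb in \<open>simp add: c_def field_simps\<close>)
    finally have "b powr h n \<le> exp (1 / 2 * ln (real n))" using b by (simp add: powr_def)
    also have "\<dots> = sqrt (real n)" using n by (simp add: powr_half_sqrt[symmetric] powr_def)
    finally have "C * b powr h n \<le> C * sqrt (real n)" using C by simp
    also have "\<dots> < sqrt (real n) * sqrt (real n)"
      using n C real_less_rsqrt[of C "real n"] by (intro mult_strict_right_mono) auto
    finally show ?case using n by simp
  qed
qed

text \<open>On a finite space some prefix length separates all points, so every subset is a finite
  union of Borel cells.\<close>

lemma (in bounded_borel_graph) borel_map_finite:
  assumes "finite (verts G)"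
  shows "borel_map M G f"
  unfolding borel_map_def
proof
  fix i
  obtain n where n: "inj_on (code_prefix n) (space M)"
    using code_prefix_separates[of "space M"] assms verts_eq by auto
  have "(\<Union>s\<in>code_prefix n ` {v \<in> space M. f v = i}. {v \<in> space M. code_prefix n v = s}) \<in> sets M"
    by (intro sets.countable_UN'' code_prefix_sets) auto
  also have "(\<Union>s\<in>code_prefix n ` {v \<in> space M. f v = i}. {v \<in> space M. code_prefix n v = s}) =
      {v \<in> verts G. f v = i}" using inj_onD[OF n] verts_eq by auto
  finally show "{v \<in> verts G. f v = i} \<in> sets M" .
qed

lemma colorable_iso:
  assumes iso: "is_graph_iso \<phi> G H" and G: "simple_graph G" and H: "simple_graph H" and "colorable L H"
  shows "colorable L G"
proof -
  obtain h where h: "is_coloring L H h" using \<open>colorable L H\<close> by (auto simp: colorable_def)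
  have "snd L (local_type G (h \<circ> \<phi>) v (fst L))" if v: "v \<in> verts G" for v
  proof -
    have "\<phi> v \<in> verts H" using iso v by (auto simp: is_graph_iso_def bij_betw_def)
    moreover have "ball_iso (fst L) \<phi> G (h \<circ> \<phi>) v H h (\<phi> v)"
      by (rule graph_iso_ball_iso[OF iso G H v]) simp
    ultimately show ?thesis using h local_type_eq by (metis is_coloring_def)
  qed
  then show ?thesis unfolding colorable_def is_coloring_def by blast
qed

theorem theorem1p42:
  fixes L :: lcl
    and \<GG> :: "nat ugraph set"
    and M :: "'a measure"
    and G :: "'a ugraph"
  assumes "\<And>H. H \<in> \<GG> \<Longrightarrow> finite_graph H \<and> colorable L H"
    and "little_o_log (Rand L \<GG>)"
    and "borel_graph M G"
    and "finite_max_degree G"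
    and "\<And>U. finite U \<Longrightarrow> U \<subseteq> verts G \<Longrightarrow> in_class (induced G U) \<GG>"
    and "asi M G < \<infinity>"
  shows "\<exists>f. borel_map M G f \<and> is_coloring L G f"
proof -
  obtain d where "\<forall>v\<in>verts G. finite {u. (v, u) \<in> edges G} \<and> card {u. (v, u) \<in> edges G} \<le> d"
    using assms(4) by (auto simp: finite_max_degree_def)
  then interpret bounded_borel_graph M G d by unfold_locales (use assms(3) in auto)
  show ?thesis
  proof (cases "finite (verts G)")
    \<comment> \<open>A finite \<open>G\<close> may have fewer than \<open>n\<close> vertices for
      the \<open>n\<close> chosen below, so the algorithm says nothing about it. Here
      \<open>G\<close> is isomorphic to a colourable member of the class.\<close>
    case True
    have "induced G (verts G) = G" using simple by (cases G) (auto simp: induced_def simple_graph_def)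
    then obtain H \<phi> where H: "H \<in> \<GG>" "is_graph_iso \<phi> G H"
      using assms(5)[OF True order_refl] by (auto simp: in_class_def)
    have "colorable L G"
      using assms(1)[OF H(1)] by (intro colorable_iso[OF H(2) simple]) (auto simp: finite_graph_def)
    then show ?thesis using borel_map_finite[OF True] by (auto simp: colorable_def)
  next
    case infinite: False
    obtain S where S: "\<And>R. \<exists>s\<le>S. \<exists>U :: nat \<Rightarrow> 'a set. (\<forall>i\<le>s. U i \<in> sets M) \<and> (\<Union>i\<le>s. U i) = verts G \<and>
       (\<forall>i\<le>s. component_finite (induced (graph_power G R) (U i)))" using asi_partition[OF assms(6)] by blast
    let ?b = "real (d + 1)" and ?r = "\<lambda>n. real (the_enat (Rand L \<GG> n))"
    \<comment> \<open>This is \<open>(4 * ?b ^ (2 * (fst L + T))) ^ Suc S < n\<close> with the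
      factor that depends on \<open>T\<close> split off and \<open>T\<close> written as
      \<open>?r n\<close>.\<close>
    have "\<forall>\<^sub>F n in sequentially. (4 * ?b ^ (2 * fst L)) ^ Suc S * (?b ^ (2 * Suc S)) powr ?r n < real n"
    proof (rule eventually_power_less)
      show "?r \<in> o(\<lambda>n. ln (real n))" using assms(2) by (simp add: little_o_log_def)
      show "1 \<le> ?b ^ (2 * Suc S)" by (rule one_le_power) simp
    qed simp_all
    moreover have "\<forall>\<^sub>F n in sequentially. Rand L \<GG> n \<noteq> \<infinity>" using assms(2) by (simp add: little_o_log_def)
    moreover have "\<forall>\<^sub>F n::nat in sequentially. 0 < n" by (rule eventually_gt_at_top)
    ultimately have "\<forall>\<^sub>F n in sequentially. 0 < n \<and> Rand L \<GG> n \<noteq> \<infinity> \<and>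
        (4 * ?b ^ (2 * fst L)) ^ Suc S * (?b ^ (2 * Suc S)) powr ?r n < real n"
      by eventually_elim simp
    then obtain n where n: "0 < n" "Rand L \<GG> n \<noteq> \<infinity>"
        "(4 * ?b ^ (2 * fst L)) ^ Suc S * (?b ^ (2 * Suc S)) powr ?r n < real n"
      using eventually_happens'[OF sequentially_bot] by blast
    obtain T where T: "Rand L \<GG> n = enat T" using n(2) by auto
    let ?k = "fst L + T"
    obtain l A where l: "(l::nat) > 0" and A: "\<And>H. H \<in> \<GG> \<Longrightarrow> card (verts H) = n \<Longrightarrow>
        measure_pmf.prob (pmf_of_set (verts H \<rightarrow>\<^sub>E {..<l})) {\<theta>. is_coloring L H (run_local A T H \<theta>)} \<ge> 1 - 1 / real n"
      using Inf_enat_attained[OF T[unfolded Rand_def]] by blast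
    have T_pow: "(?b ^ (2 * Suc S)) powr ?r n = (?b ^ (2 * T)) ^ Suc S"
      by (simp add: T powr_realpow power_mult[symmetric] mult.commute mult.left_commute del: power_Suc)
    then have big: "(4 * ?b ^ (2 * ?k)) ^ Suc S < real n"
    proof -
      have "4 * ?b ^ (2 * ?k) = (4 * ?b ^ (2 * fst L)) * ?b ^ (2 * T)"
        by (simp only: distrib_left power_add mult.assoc)
      then have "(4 * ?b ^ (2 * ?k)) ^ Suc S = (4 * ?b ^ (2 * fst L)) ^ Suc S * (?b ^ (2 * T)) ^ Suc S"
        by (simp only: power_mult_distrib)
      then show ?thesis using n(3) unfolding T_pow by (simp only:)
    qed
    have ge1: "1 \<le> 4 * ?b ^ (2 * ?k)"
    proof -
      have "1 \<le> ?b ^ (2 * ?k)" by (rule one_le_power) simp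
      then show ?thesis by linarith
    qed
    \<comment> \<open>Balls of radius \<open>?k\<close> are thus small enough to be padded to
      \<open>n\<close> vertices.\<close>
    have bk: "(d + 1) ^ ?k \<le> n"
    proof -
      have "?b ^ ?k \<le> ?b ^ (2 * ?k)" by (rule power_increasing) auto
      also have "\<dots> \<le> (4 * ?b ^ (2 * ?k)) ^ 1" by simp
      also have "\<dots> \<le> (4 * ?b ^ (2 * ?k)) ^ Suc S"
        by (rule power_increasing[OF _ ge1]) simp
      also have "\<dots> < real n" by (rule big)
      finally have "real ((d + 1) ^ ?k) < real n" by (simp only: of_nat_power)
      then show ?thesis by (simp only: of_nat_less_iff)
    qed
    have bound: "residual_prob l ?k G (fails L A T G) (\<lambda>_. l) v \<le> 1 / n" if v: "v \<in> space M" for v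
    proof -
      let ?B = "graph_ball G v ?k"
      have B: "finite ?B" "card ?B \<le> n" "?B \<subseteq> verts G"
        using finite_ball[OF v] card_ball[OF v] bk by (auto simp: graph_ball_def intro: order.trans)
      \<comment> \<open>Arbitrary further vertices bring the ball up to exactly \<open>n\<close>
        vertices, the size for which the success probability of \<open>A\<close> is known.\<close>
      have "infinite (verts G - ?B)" using infinite B(1) by simp
      then obtain U0 where U0: "finite U0" "card U0 = n - card ?B" "U0 \<subseteq> verts G - ?B"
        using infinite_arbitrarily_large by blast
      define U where "U = ?B \<union> U0"
      have "card U = card ?B + card U0" unfolding U_def by (rule card_Un_disjoint) (use B U0 in auto)
      then have U: "finite U" "card U = n" "U \<subseteq> verts G" "?B \<subseteq> U" using B U0 by (auto simp: U_def)
      obtain H \<phi> where H: "H \<in> \<GG>" "is_graph_iso \<phi> (induced G U) H"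
        using assms(5)[OF U(1,3)] by (auto simp: in_class_def)
      have finH: "finite_graph H" and simple': "simple_graph H" "simple_graph (induced G U)"
        using assms(1)[OF H(1)] simple_induced[OF simple] by (auto simp: finite_graph_def)
      have verts_U: "verts (induced G U) = U" using U(3) by (auto simp: induced_def)
      have vU: "v \<in> U" using centre_in_ball[of v G ?k] v verts_eq U(4) by auto
      have "bij_betw \<phi> U (verts H)" using H(2) verts_U by (simp add: is_graph_iso_def)
      then have cardH: "card (verts H) = n" and \<phi>v: "\<phi> v \<in> verts H"
        using U(2) vU bij_betw_same_card bij_betw_apply by fastforce+
      have ball_eq: "graph_ball (induced G U) v ?k = ?B" using v verts_eq by (intro ball_induced simple U(4)) simp
      have "residual_prob l ?k G (fails L A T G) (\<lambda>_. l) v =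
          residual_prob l ?k (induced G U) (fails L A T (induced G U)) (\<lambda>_. l) v"
      proof (rule residual_prob_iso[where \<psi> = id])
        show "ball_iso ?k id G (\<lambda>_. l) v (induced G U) (\<lambda>_. l) v"
          by (rule ball_iso_induced[OF simple _ U(4)]) (use v verts_eq in simp)
      qed (use B(1) l fails_iso[OF _ simple simple'(2)] in auto)
      also have "\<dots> = residual_prob l ?k H (fails L A T H) (\<lambda>_. l) (\<phi> v)"
      proof (rule residual_prob_iso[where \<psi> = \<phi>])
        show "ball_iso ?k \<phi> (induced G U) (\<lambda>_. l) v H (\<lambda>_. l) (\<phi> v)"
          by (rule graph_iso_ball_iso[OF H(2) simple'(2,1)]) (use vU verts_U in auto)
      qed (use B(1) l ball_eq fails_iso[OF _ simple'(2,1)] in auto)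
      also have "\<dots> \<le> 1 / n"
        by (rule residual_prob_of_global_success[OF finH \<phi>v l A[OF H(1) cardH]])
      finally show ?thesis .
    qed
    obtain s and U :: "nat \<Rightarrow> 'a set" where s: "s \<le> S" and U: "\<And>i. i \<le> s \<Longrightarrow> U i \<in> sets M" "(\<Union>i\<le>s. U i) = verts G"
      "\<And>i. i \<le> s \<Longrightarrow> component_finite (induced (graph_power G (2 * ?k)) (U i))"
      using S[of "2 * ?k"] by blast
    have "\<exists>f. (\<forall>i. {x \<in> space M. f x = i} \<in> sets M) \<and> (\<forall>v\<in>space M. \<not> fails L A T G f v)"
    proof (rule borel_solution[where k = ?k and U = U and m = "Suc s" and l = l and p = "1 / n"])
      show "fails L A T G f v \<longleftrightarrow> fails L A T G g w" if "ball_iso ?k \<psi> G f v G g w" for \<psi> f v g w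
        by (rule fails_iso[OF that simple simple])
      show "(\<Union>i<Suc s. U i) = space M" using U(2) verts_eq by (simp add: lessThan_Suc_atMost)
      have "(4 * ?b ^ (2 * ?k)) ^ Suc s \<le> (4 * ?b ^ (2 * ?k)) ^ Suc S"
        using s by (intro power_increasing[OF _ ge1]) simp
      from this big have "(4 * ?b ^ (2 * ?k)) ^ Suc s < real n" by (rule le_less_trans)
      moreover have "x * (1 / real n) < 1" if "x < real n" for x using that n(1) by (simp add: field_simps)
      ultimately show "(4 * ?b ^ (2 * ?k)) ^ Suc s * (1 / real n) < 1" by blast
    qed (use l n U bound in \<open>auto simp: less_Suc_eq_le\<close>)
    then obtain f where f: "\<And>i. {x \<in> space M. f x = i} \<in> sets M" "\<And>v. v \<in> space M \<Longrightarrow> \<not> fails L A T G f v"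
      by blast
    have "is_coloring L G (run_local A T G f)"
      using f(2) verts_eq by (simp add: is_coloring_run_local_iff)
    \<comment> \<open>An output depends only on the isomorphism type of a labeled ball of radius
      \<open>T\<close>, and the labels \<open>f\<close> are Borel.\<close>
    moreover have "borel_map M G (run_local A T G f)"
      unfolding borel_map_def verts_eq
    proof
      fix i
      show "{v \<in> space M. run_local A T G f v = i} \<in> sets M"
        by (rule invariant_sets[OF f(1), where k = T]) (simp add: run_local_def local_type_eq)
    qed
    ultimately show ?thesis by blast
  qed
qed

end
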